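(* Let $p>1$ and $-d<\gamma<0$. There is an explicit constant $s_{p,d,\gamma}>2+|\gamma|$, depending only on $p,d,\gamma$, such that the following holds for every $s\ge s_{p,d,\gamma}$. Assume the angular kernel $b$ is bounded. Let $f_0\in L^1_s(\mathbb{R}^d)\cap L^p(\mathbb{R}^d)$ be a non-negative function with unit mass, and let $f=f(t)$ be the solution to $\partial_t f=\boldsymbol{L}_\gamma f$, $f(0)=f_0$. Then for any $$\sigma<-1+\frac{s-2}{|\gamma|}$$ there exists a constant $C_0>0$, depending only on $d,\gamma,p,s,\sigma,\|f_0\|_{L^1_s},\|f_0\|_p$, $H(f_0|\mathcal{M})$ (and on the fixed angular kernel $b$), such that $$H(f(t)|\mathcal{M})\le C_0(1+t)^{-\sigma}\qquad\text{for all }t\ge 0.$$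
   Context: Setting: $d\ge 2$, $\gamma\in(-d,0)$; $b:[-1,1]\to[0,\infty)$ is an even function with $\|b\|_1:=\int_{\mathbb{S}^{d-1}}b(\cos\theta)\,d\sigma=|\mathbb{S}^{d-2}|\int_{-1}^1 b(x)(1-x^2)^{\frac{d-3}{2}}dx=1$. The Maxwellian is $\mathcal{M}(v)=(2\pi)^{-d/2}e^{-|v|^2/2}$. For $v,v_*\in\mathbb{R}^d$ and $\sigma\in\mathbb{S}^{d-1}$ (integration variable), $v'=\frac{v+v_*}{2}+\frac{|v-v_*|}{2}\sigma$, $v_*'=\frac{v+v_*}{2}-\frac{|v-v_*|}{2}\sigma$, $\cos\theta=\frac{v-v_*}{|v-v_*|}\cdot\sigma$. The linear Boltzmann operator is $$\boldsymbol{L}_\gamma f(v)=\int_{\mathbb{R}^d\times\mathbb{S}^{d-1}}|v-v_*|^\gamma b(\cos\theta)\big(f(v')\mathcal{M}(v_*')-f(v)\mathcal{M}(v_* )\big)\,dv_*\,d\sigma .$$ It is a bounded operator on $L^1(\mathbb{R}^d)$; the solution with initial datum $f_0\in L^1(\mathbb{R}^d)$ is $f(t)=U(t)f_0$, where $(U(t))_{t\ge0}$ is the positive, mass-preserving $C_0$-semigroup on $L^1(\mathbb{R}^d)$ generated by $\boldsymbol{L}_\gamma$. Unit mass means $\int_{\mathbb{R}^d} f_0\,dv=1$. Notation: $\langle v\rangle=\sqrt{1+|v|^2}$; $\|f\|_{L^1_s}=\int_{\mathbb{R}^d}\langle v\rangle^s|f(v)|\,dv$, and $L^1_s(\mathbb{R}^d)$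 is the space of measurable $f$ with $\|f\|_{L^1_s}<\infty$; $\|\cdot\|_p$ is the $L^p(\mathbb{R}^d)$ norm. The relative entropy of a non-negative $f$ of unit mass is $H(f|\mathcal{M})=\int_{\mathbb{R}^d}f\log\frac{f}{\mathcal{M}}\,dv$. *)

theory Defs
  imports "HOL-Analysis.Analysis"
begin

subsection \<open>Surface measure of the unit sphere\<close>

text \<open>
  The surface measure of a Borel set \<open>A\<close> of the unit sphere is \<open>d\<close> times the Lebesgue measure
  of the truncated cone \<open>{x. 0 < norm x \<le> 1 \<and> x /\<^sub>R norm x \<in> A}\<close>; this is the measure \<open>d\<omega>\<close>
  of the polar coordinate formula \<open>dx = r\<^sup>d\<^sup>-\<^sup>1 dr d\<omega>\<close>. The underlying space of the measure is the
  sphere itself, so only values of \<open>b\<close> on \<open>[-1, 1]\<close> ever enter below.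
\<close>

definition sphere_measure :: "'a::euclidean_space measure" where
  "sphere_measure =
     scale_measure (ennreal (real DIM('a)))
       (distr (restrict_space lborel (cball 0 1 - {0})) (restrict_space borel (sphere 0 1)) sgn)"


subsection \<open>The linear Boltzmann operator\<close>

definition maxwellian :: "'a::euclidean_space \<Rightarrow> real" where
  "maxwellian v = (2 * pi) powr (- real DIM('a) / 2) * exp (- (norm v)\<^sup>2 / 2)"

text \<open>
  The type argument fixes the space \<open>'a\<close> carrying the sphere over which \<open>b\<close> is normalised.
  By rotation invariance the integral does not depend on the unit vector \<open>e\<close>.
\<close>

definition angular_kernel :: "'a::euclidean_space itself \<Rightarrow> (real \<Rightarrow> real) \<Rightarrow> bool" where
  "angular_kernel _ b \<longleftrightarrow>
     b \<in> borel_measurable (restrict_space borel {-1..1}) \<and>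
     (\<forall>x\<in>{-1..1}. 0 \<le> b x) \<and>
     (\<forall>x\<in>{-1..1}. b (- x) = b x) \<and>
     (\<forall>e::'a. norm e = 1 \<longrightarrow> (\<integral>\<omega>. b (e \<bullet> \<omega>) \<partial>sphere_measure) = 1)"

definition post :: "'a::euclidean_space \<Rightarrow> 'a \<Rightarrow> 'a \<Rightarrow> 'a" where
  "post v w \<omega> = (v + w) /\<^sub>R 2 + (norm (v - w) / 2) *\<^sub>R \<omega>"

definition post_star :: "'a::euclidean_space \<Rightarrow> 'a \<Rightarrow> 'a \<Rightarrow> 'a" where
  "post_star v w \<omega> = (v + w) /\<^sub>R 2 - (norm (v - w) / 2) *\<^sub>R \<omega>"

text \<open>
  The integral runs over \<open>(v\<^sub>*, \<omega>)\<close>, with \<open>w\<close> standing for \<open>v\<^sub>*\<close>. For integrable \<open>f\<close> it converges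
  absolutely for almost every \<open>v\<close>; on the exceptional null set the Bochner integral is 0.
\<close>

definition boltzmann_op ::
    "real \<Rightarrow> (real \<Rightarrow> real) \<Rightarrow> ('a::euclidean_space \<Rightarrow> real) \<Rightarrow> 'a \<Rightarrow> real" where
  "boltzmann_op \<gamma> b f v =
     (\<integral>(w, \<omega>). norm (v - w) powr \<gamma> * b (sgn (v - w) \<bullet> \<omega>) *
        (f (post v w \<omega>) * maxwellian (post_star v w \<omega>) - f v * maxwellian w)
      \<partial>(lborel \<Otimes>\<^sub>M sphere_measure))"


subsection \<open>Weighted spaces and relative entropy\<close>

definition bracket :: "'a::euclidean_space \<Rightarrow> real" where
  "bracket v = sqrt (1 + (norm v)\<^sup>2)"

definition L1w :: "real \<Rightarrow> ('a::euclidean_space \<Rightarrow> real) set" where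
  "L1w s = {f \<in> borel_measurable borel. integrable lborel (\<lambda>v. bracket v powr s * \<bar>f v\<bar>)}"

definition norm_L1w :: "real \<Rightarrow> ('a::euclidean_space \<Rightarrow> real) \<Rightarrow> real" where
  "norm_L1w s f = (\<integral>v. bracket v powr s * \<bar>f v\<bar> \<partial>lborel)"

definition Lp :: "real \<Rightarrow> ('a::euclidean_space \<Rightarrow> real) set" where
  "Lp p = {f \<in> borel_measurable borel. integrable lborel (\<lambda>v. \<bar>f v\<bar> powr p)}"

definition norm_Lp :: "real \<Rightarrow> ('a::euclidean_space \<Rightarrow> real) \<Rightarrow> real" where
  "norm_Lp p f = (\<integral>v. \<bar>f v\<bar> powr p \<partial>lborel) powr (1 / p)"

definition entropy_integrand :: "('a::euclidean_space \<Rightarrow> real) \<Rightarrow> 'a \<Rightarrow> real" where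
  "entropy_integrand f v = f v * ln (f v / maxwellian v)"

text \<open>
  For a non-negative \<open>f\<close> of unit mass the negative part of the integrand is always integrable, so
  the entropy is finite iff the integrand is integrable. Since the Bochner integral is 0
  otherwise, an upper bound on the entropy has to be stated together with integrability.
\<close>

definition relative_entropy :: "('a::euclidean_space \<Rightarrow> real) \<Rightarrow> real" where
  "relative_entropy f = (\<integral>v. entropy_integrand f v \<partial>lborel)"


subsection \<open>Strongly continuous semigroups on \<open>L\<^sup>1\<close>\<close>

text \<open>
  Elements of \<open>L\<^sup>1\<close> are represented by Borel functions, with equality almost everywhere made
  explicit. Nothing is required of \<open>U t\<close> for negative \<open>t\<close> or outside \<open>L\<^sup>1\<close>.
\<close>

definition L1 :: "('a::euclidean_space \<Rightarrow> real) set" where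
  "L1 = {f. integrable lborel f}"

definition norm_L1 :: "('a::euclidean_space \<Rightarrow> real) \<Rightarrow> real" where
  "norm_L1 f = (\<integral>v. \<bar>f v\<bar> \<partial>lborel)"

definition bounded_linear_L1 ::
    "(('a::euclidean_space \<Rightarrow> real) \<Rightarrow> 'a \<Rightarrow> real) \<Rightarrow> bool" where
  "bounded_linear_L1 T \<longleftrightarrow>
     (\<forall>f\<in>L1. T f \<in> L1) \<and>
     (\<forall>f\<in>L1. \<forall>g\<in>L1. (AE v in lborel. f v = g v) \<longrightarrow> (AE v in lborel. T f v = T g v)) \<and>
     (\<forall>f\<in>L1. \<forall>g\<in>L1. AE v in lborel. T (\<lambda>x. f x + g x) v = T f v + T g v) \<and>
     (\<forall>c. \<forall>f\<in>L1. AE v in lborel. T (\<lambda>x. c * f x) v = c * T f v) \<and>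
     (\<exists>K. \<forall>f\<in>L1. norm_L1 (T f) \<le> K * norm_L1 f)"

definition C0_semigroup_L1 ::
    "(real \<Rightarrow> ('a::euclidean_space \<Rightarrow> real) \<Rightarrow> 'a \<Rightarrow> real) \<Rightarrow> bool" where
  "C0_semigroup_L1 U \<longleftrightarrow>
     (\<forall>t\<ge>0. bounded_linear_L1 (U t)) \<and>
     (\<forall>f\<in>L1. AE v in lborel. U 0 f v = f v) \<and>
     (\<forall>s\<ge>0. \<forall>t\<ge>0. \<forall>f\<in>L1. AE v in lborel. U (s + t) f v = U s (U t f) v) \<and>
     (\<forall>f\<in>L1. ((\<lambda>t. norm_L1 (\<lambda>v. U t f v - f v)) \<longlongrightarrow> 0) (at_right 0))"

text \<open>
  \<open>A\<close> is an everywhere defined generator: the right derivative of \<open>U t f\<close> at 0 exists in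
  \<open>L\<^sup>1\<close> and equals \<open>A f\<close> for every \<open>f\<close> in \<open>L\<^sup>1\<close>.
\<close>

definition generates_L1 ::
    "(('a::euclidean_space \<Rightarrow> real) \<Rightarrow> 'a \<Rightarrow> real) \<Rightarrow>
     (real \<Rightarrow> ('a \<Rightarrow> real) \<Rightarrow> 'a \<Rightarrow> real) \<Rightarrow> bool" where
  "generates_L1 A U \<longleftrightarrow>
     (\<forall>f\<in>L1. A f \<in> L1 \<and>
        ((\<lambda>h. norm_L1 (\<lambda>v. (U h f v - f v) / h - A f v)) \<longlongrightarrow> 0) (at_right 0))"

definition positive_L1 ::
    "(real \<Rightarrow> ('a::euclidean_space \<Rightarrow> real) \<Rightarrow> 'a \<Rightarrow> real) \<Rightarrow> bool" where
  "positive_L1 U \<longleftrightarrow>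
     (\<forall>t\<ge>0. \<forall>f\<in>L1. (AE v in lborel. 0 \<le> f v) \<longrightarrow> (AE v in lborel. 0 \<le> U t f v))"

definition mass_preserving_L1 ::
    "(real \<Rightarrow> ('a::euclidean_space \<Rightarrow> real) \<Rightarrow> 'a \<Rightarrow> real) \<Rightarrow> bool" where
  "mass_preserving_L1 U \<longleftrightarrow>
     (\<forall>t\<ge>0. \<forall>f\<in>L1. (\<integral>v. U t f v \<partial>lborel) = (\<integral>v. f v \<partial>lborel))"

definition boltzmann_semigroup ::
    "real \<Rightarrow> (real \<Rightarrow> real) \<Rightarrow> (real \<Rightarrow> ('a::euclidean_space \<Rightarrow> real) \<Rightarrow> 'a \<Rightarrow> real) \<Rightarrow> bool" where
  "boltzmann_semigroup \<gamma> b U \<longleftrightarrow>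
     C0_semigroup_L1 U \<and> generates_L1 (boltzmann_op \<gamma> b) U \<and>
     positive_L1 U \<and> mass_preserving_L1 U"

end

theory Submission
  imports Defs "HOL-Probability.Distributions"
begin

text \<open>
  Jensen's inequality for the stochastic operator \<open>U t\<close>, applied not to \<open>\<Phi> x = x ln x - x + 1\<close> itself
  but to the part of \<open>\<Phi>\<close> above its tangent at a large \<open>B\<close>, bounds \<open>H (U t f | M)\<close> by
  \<open>ln B * \<parallel>U t f - M\<parallel>\<^sub>1\<close> plus a tail of the initial datum alone. With \<open>ln B = R\<^sup>2\<close> the moment of order
  \<open>s\<close> and the \<open>L\<^sup>p\<close> norm make this tail \<open>O(R powr (2 - s))\<close>, and \<open>R\<close> is a power of \<open>1 + t\<close>. So only
  decay in \<open>L\<^sup>1\<close> is needed, at the rate \<open>(s - k) / \<bar>\<gamma>\<bar>\<close> with \<open>k = \<bar>\<gamma>\<bar> s / (s - 2)\<close>; this rate is exactly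
  what the balance of the two terms at \<open>\<sigma> = (s - 2) / \<bar>\<gamma>\<bar> - 1\<close> requires.

  The \<open>L\<^sup>1\<close> decay is a subgeometric Harris argument at the level of the generator: a drift condition
  for the weights \<open>bracket v powr k\<close>, a lower bound of the gain kernel on balls, and interpolation between
  weighted norms. It is carried out for the Euler steps \<open>f + h L f\<close>, which converge to \<open>U t f\<close> since
  \<open>L\<close> is bounded, so that no differentiation of norms in time is needed.
\<close>


subsection \<open>Orthogonal invariance of Lebesgue and surface measure\<close>

text \<open>The constant has to be fixed before the semigroup \<open>U\<close>. The Euler iterates
  of the explicit operator make this possible: their bounds are uniform in the step size and mention
  no \<open>U\<close>. The collision frequency is only bounded below by a multiple of
  \<open>bracket v powr \<gamma>\<close>, so dissipation in the weight \<open>k\<close> controls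
  just the weight \<open>k + \<gamma>\<close>; this loss is where the denominator
  \<open>\<bar>\<gamma>\<bar>\<close> comes from. Evenness of \<open>b\<close> puts at least half of
  its mass on \<open>cos \<theta> \<le> 0\<close>, which serves twice: large moments contract
  strictly, and collisions spread mass over a ball. Integrals of the gain are taken in
  \<open>ennreal\<close>, where Tonelli needs no integrability, and loss terms stay on the left so
  that nothing infinite is subtracted. Polar coordinates and the pre-post-collisional change of
  variables are both replaced by one fact: a finite rotation invariant measure is unchanged when the
  direction is resampled uniformly. It gives reversibility of the gain with respect to the
  Maxwellian, hence the duality that turns weighted norms of the gain into pointwise bounds for its
  adjoint \<open>A\<close>.\<close>

lemma nn_integral_lborel_shift:
  fixes c :: "'a::euclidean_space"
  assumes [measurable]: "F \<in> borel_measurable borel"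
  shows "(\<integral>\<^sup>+x. F (c + x) \<partial>lborel) = (\<integral>\<^sup>+x. F x \<partial>lborel)"
    and "(\<integral>\<^sup>+x. F (c - x) \<partial>lborel) = (\<integral>\<^sup>+x. F x \<partial>lborel)"
proof -
  show "(\<integral>\<^sup>+x. F (c + x) \<partial>lborel) = (\<integral>\<^sup>+x. F x \<partial>lborel)"
    by (subst (2) lborel_distr_plus[of c, symmetric]) (simp add: nn_integral_distr)
  show "(\<integral>\<^sup>+x. F (c - x) \<partial>lborel) = (\<integral>\<^sup>+x. F x \<partial>lborel)"
    by (subst (2) lborel_affine[of "-1" c]) (simp_all add: nn_integral_density nn_integral_distr)
qed

text \<open>Many pointwise relations below can fail at relative velocity 0, where \<open>sgn\<close>
  is 0 rather than a unit vector and \<open>0 powr \<gamma>\<close> is 0.\<close>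

lemma nn_integral_lborel_cong_except:
  assumes "\<And>x::'a::euclidean_space. x \<noteq> c \<Longrightarrow> F x = G x"
  shows "(\<integral>\<^sup>+x. F x \<partial>lborel) = (\<integral>\<^sup>+x. G x \<partial>lborel)"
  by (rule nn_integral_cong_AE) (use AE_lborel_singleton[of c] assms in \<open>auto elim!: eventually_mono\<close>)

lemma nn_integral_lborel_mono_except:
  assumes "\<And>x::'a::euclidean_space. x \<noteq> c \<Longrightarrow> F x \<le> G x"
  shows "(\<integral>\<^sup>+x. F x \<partial>lborel) \<le> (\<integral>\<^sup>+x. G x \<partial>lborel)"
  by (rule nn_integral_mono_AE) (use AE_lborel_singleton[of c] assms in \<open>auto elim!: eventually_mono\<close>)

lemma nn_integral_lborel_scale:
  fixes F :: "'a::euclidean_space \<Rightarrow> ennreal"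
  assumes [measurable]: "F \<in> borel_measurable borel" and "r > 0"
  shows "(\<integral>\<^sup>+x. F x \<partial>lborel) = ennreal (r ^ DIM('a)) * (\<integral>\<^sup>+x. F (r *\<^sub>R x) \<partial>lborel)"
  using \<open>r > 0\<close>
  by (subst lborel_affine[of r 0]) (simp_all add: nn_integral_density nn_integral_distr nn_integral_cmult)

lemma borel_measurable_orthogonal [measurable_dest]:
  fixes f :: "'a::euclidean_space \<Rightarrow> 'a"
  shows "orthogonal_transformation f \<Longrightarrow> f \<in> borel_measurable borel"
  by (intro borel_measurable_continuous_onI linear_continuous_on)
     (simp add: orthogonal_transformation_linear linear_conv_bounded_linear[symmetric])

text \<open>Uniqueness of Haar measure in disguise, with no determinant: the double integral of
  \<open>F (f x) * B (y - f x)\<close>, with \<open>B\<close> the indicator of the unit ball, is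
  computed in both orders. One order returns the left-hand side times the ball volume, the other the
  right-hand side times the same finite nonzero factor.\<close>

lemma nn_integral_lborel_orthogonal:
  fixes f :: "'a::euclidean_space \<Rightarrow> 'a"
  assumes f: "orthogonal_transformation f" and [measurable]: "F \<in> borel_measurable borel"
  shows "(\<integral>\<^sup>+x. F (f x) \<partial>lborel) = (\<integral>\<^sup>+x. F x \<partial>lborel)"
proof -
  define B :: "'a \<Rightarrow> ennreal" where "B = indicator (ball 0 1)"
  define V where "V = (\<integral>\<^sup>+x. B x \<partial>lborel)"
  note [measurable] = borel_measurable_orthogonal[OF f]
  have [measurable]: "B \<in> borel_measurable borel"
    by (simp add: B_def borel_measurable_indicator)
  have lin: "f (x - y) = f x - f y" for x y
    using f by (simp add: linear_diff orthogonal_transformation_linear)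
  have B: "B (f x) = B x" for x
    using f by (simp add: B_def indicator_def orthogonal_transformation_norm)
  have V: "V = emeasure lborel (ball (0::'a) 1)"
    by (simp add: V_def B_def)
  have "emeasure lborel (ball (0::'a) 1) \<noteq> 0"
    using emeasure_lborel_cbox_finite
    by (metis content_ball_pos enn2real_0 less_irrefl measure_def zero_less_one measure_completion sets_lborel borel_open open_ball)
  then have V0: "V \<noteq> 0" "V \<noteq> top"
    using emeasure_lborel_ball_finite[of "0::'a" 1] by (auto simp: V)
  have "(\<integral>\<^sup>+x. F (f x) \<partial>lborel) * V = (\<integral>\<^sup>+x. \<integral>\<^sup>+y. F (f x) * B y \<partial>lborel \<partial>lborel)"
    by (simp add: nn_integral_cmult nn_integral_multc V_def)
  also have "\<dots> = (\<integral>\<^sup>+x. \<integral>\<^sup>+y. F (f x) * B (y - f x) \<partial>lborel \<partial>lborel)"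
    using nn_integral_lborel_shift(1)[of "\<lambda>y. F (f x) * B y" "- f x" for x]
    by (simp add: algebra_simps)
  also have "\<dots> = (\<integral>\<^sup>+y. \<integral>\<^sup>+x. F (f x) * B (y - f x) \<partial>lborel \<partial>lborel)"
    by (rule lborel_pair.Fubini') measurable
  \<comment> \<open>The substitution replaces \<open>x\<close> by \<open>y' - x\<close>, where
    \<open>f y' = y\<close>. It exchanges the arguments \<open>f x\<close> and
    \<open>y - f x\<close>, and \<open>B\<close> does not see \<open>f\<close>.\<close>
  also have "\<dots> = (\<integral>\<^sup>+y. \<integral>\<^sup>+x. F (y - f x) * B x \<partial>lborel \<partial>lborel)"
  proof (rule nn_integral_cong)
    fix y
    obtain y' where y: "y = f y'"
      using orthogonal_transformation_surj[OF f] by (metis surjD)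
    show "(\<integral>\<^sup>+x. F (f x) * B (y - f x) \<partial>lborel) = (\<integral>\<^sup>+x. F (y - f x) * B x \<partial>lborel)"
      using nn_integral_lborel_shift(2)[of "\<lambda>x. F (f x) * B (y - f x)" y']
      by (simp add: lin y B)
  qed
  also have "\<dots> = (\<integral>\<^sup>+x. \<integral>\<^sup>+y. F (y - f x) * B x \<partial>lborel \<partial>lborel)"
    by (rule lborel_pair.Fubini'[symmetric]) measurable
  also have "\<dots> = (\<integral>\<^sup>+x. \<integral>\<^sup>+y. F y * B x \<partial>lborel \<partial>lborel)"
    using nn_integral_lborel_shift(1)[of "\<lambda>y. F y * B x" "- f x" for x]
    by (simp add: algebra_simps)
  also have "\<dots> = (\<integral>\<^sup>+x. F x \<partial>lborel) * V"
    by (simp add: nn_integral_cmult nn_integral_multc V_def)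
  finally have "V * (\<integral>\<^sup>+x. F (f x) \<partial>lborel) = V * (\<integral>\<^sup>+x. F x \<partial>lborel)"
    by (simp add: mult.commute)
  then show ?thesis
    by (subst (asm) ennreal_mult_cancel_left) (use V0 in auto)
qed

text \<open>The witness is the Householder reflection along \<open>n = x - y\<close>. Equal norms
  give \<open>2 * (x \<bullet> n) = n \<bullet> n\<close>, which is exactly what sends
  \<open>x\<close> to \<open>y\<close>.\<close>

lemma orthogonal_transformation_moving:
  fixes x y :: "'a::euclidean_space"
  assumes "norm x = norm y"
  obtains f where "orthogonal_transformation f" "f x = y"
proof (cases "x = y")
  case True
  then show ?thesis using that[of "\<lambda>x. x"] by (simp add: orthogonal_transformation_def linear_id[unfolded id_def])
next
  case False
  define n where "n = x - y"
  define f where "f z = z - (2 * (z \<bullet> n) / (n \<bullet> n)) *\<^sub>R n" for z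
  have n: "n \<bullet> n \<noteq> 0" using False by (simp add: n_def)
  have "linear f"
    unfolding f_def by (intro linearI) (simp_all add: inner_simps algebra_simps add_divide_distrib)
  moreover have "f v \<bullet> f w = v \<bullet> w" for v w
    using n by (simp add: f_def inner_simps inner_commute field_simps power2_eq_square)
  ultimately have "orthogonal_transformation f"
    by (simp add: orthogonal_transformation_def)
  moreover have "x \<bullet> x = y \<bullet> y"
    using assms by (simp add: dot_square_norm)
  then have "2 * (x \<bullet> n) = n \<bullet> n"
    by (simp add: n_def inner_simps inner_commute)
  then have "f x = y"
    using n by (simp add: f_def) (simp add: n_def)
  ultimately show ?thesis using that by blast
qed

text \<open>A copy of the surface measure on the whole space, concentrated on the sphere. Its
  sigma-algebra is \<open>borel\<close>, so measurability and Fubini need no restricted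
  spaces.\<close>

definition usphere :: "'a::euclidean_space measure" where
  "usphere = distr sphere_measure borel (\<lambda>x. x)"

lemma sets_usphere [simp, measurable_cong]: "sets usphere = sets borel"
  and space_usphere [simp]: "space usphere = UNIV"
  by (simp_all add: usphere_def)

lemma sets_sphere_measure:
  "sets (sphere_measure :: 'a::euclidean_space measure) = sets (restrict_space borel (sphere 0 1))"
  and space_sphere_measure: "space (sphere_measure :: 'a::euclidean_space measure) = sphere 0 1"
  by (simp_all add: sphere_measure_def space_scale_measure space_restrict_space)

lemma measurable_ident_sphere_measure:
  "(\<lambda>x. x) \<in> sphere_measure \<rightarrow>\<^sub>M (borel :: 'a::euclidean_space measure)"
  by (subst measurable_cong_sets[OF sets_sphere_measure refl])
     (intro measurable_restrict_space1, simp)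

lemma borel_measurable_sgn_euclidean [measurable]:
  "(sgn :: 'a::euclidean_space \<Rightarrow> 'a) \<in> borel_measurable borel"
  unfolding sgn_div_norm[abs_def] by measurable

lemma nn_integral_usphere_eq:
  assumes [measurable]: "F \<in> borel_measurable borel"
  shows "(\<integral>\<^sup>+x. F x \<partial>usphere) = (\<integral>\<^sup>+x. F x \<partial>sphere_measure)"
  unfolding usphere_def
  by (rule nn_integral_distr[OF measurable_ident_sphere_measure]) simp

lemma nn_integral_usphere:
  fixes F :: "'a::euclidean_space \<Rightarrow> ennreal"
  assumes [measurable]: "F \<in> borel_measurable borel"
  shows "(\<integral>\<^sup>+x. F x \<partial>usphere) =
    ennreal (real DIM('a)) * (\<integral>\<^sup>+y. F (sgn y) * indicator (cball 0 1 - {0}) y \<partial>lborel)"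
proof -
  have m: "sgn \<in> restrict_space lborel (cball 0 1 - {0}) \<rightarrow>\<^sub>M restrict_space borel (sphere (0::'a) 1)"
    by (intro measurable_restrict_space2 measurable_restrict_space1)
       (auto simp: space_restrict_space norm_sgn)
  have F: "F \<in> borel_measurable (restrict_space borel (sphere 0 1))"
    by (intro measurable_restrict_space1) measurable
  show ?thesis
    unfolding nn_integral_usphere_eq[OF assms] sphere_measure_def
    by (subst nn_integral_scale_measure)
       (use F m in \<open>auto simp: nn_integral_distr nn_integral_restrict_space\<close>)
qed

lemma AE_usphere: "AE x in (usphere :: 'a::euclidean_space measure). norm x = 1"
  unfolding usphere_def
  by (subst AE_distr_iff[OF measurable_ident_sphere_measure]) (auto simp: space_sphere_measure intro!: AE_I2)

lemma nn_integral_usphere_cong: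
  assumes "\<And>x::'a::euclidean_space. norm x = 1 \<Longrightarrow> F x = G x"
  shows "(\<integral>\<^sup>+x. F x \<partial>usphere) = (\<integral>\<^sup>+x. G x \<partial>usphere)"
  by (rule nn_integral_cong_AE) (use AE_usphere[where 'a='a] assms in \<open>auto elim!: eventually_mono\<close>)

lemma nn_integral_usphere_mono:
  assumes "\<And>x::'a::euclidean_space. norm x = 1 \<Longrightarrow> F x \<le> G x"
  shows "(\<integral>\<^sup>+x. F x \<partial>usphere) \<le> (\<integral>\<^sup>+x. G x \<partial>usphere)"
  by (rule nn_integral_mono_AE) (use AE_usphere[where 'a='a] assms in \<open>auto elim!: eventually_mono\<close>)

text \<open>Inherited from Lebesgue measure through the cone representation, because
  \<open>sgn\<close> commutes with orthogonal maps and the punctured ball is invariant.\<close>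

lemma nn_integral_usphere_orthogonal:
  fixes f :: "'a::euclidean_space \<Rightarrow> 'a"
  assumes f: "orthogonal_transformation f" and [measurable]: "F \<in> borel_measurable borel"
  shows "(\<integral>\<^sup>+x. F (f x) \<partial>usphere) = (\<integral>\<^sup>+x. F x \<partial>usphere)"
proof -
  note [measurable] = borel_measurable_orthogonal[OF f]
  have lin: "linear f" using f by (simp add: orthogonal_transformation_linear)
  have sg: "sgn (f x) = f (sgn x)" for x
    using f by (simp add: sgn_div_norm orthogonal_transformation_norm linear_scale[OF lin])
  have ind: "indicator (cball 0 1 - {0}) (f x) = (indicator (cball 0 1 - {0}) x :: ennreal)" for x
  proof -
    have "f x = 0 \<longleftrightarrow> x = 0" using orthogonal_transformation_norm[OF f, of x] by (metis norm_eq_zero)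
    then show ?thesis
      using f by (auto simp: indicator_def orthogonal_transformation_norm)
  qed
  have "(\<lambda>y. F (sgn y) * indicator (cball 0 1 - {0}) y) \<in> borel_measurable borel"
    by (intro borel_measurable_times_ennreal borel_measurable_indicator) measurable
  from nn_integral_lborel_orthogonal[OF f this] show ?thesis
    by (simp add: nn_integral_usphere sg ind)
qed

lemma emeasure_lborel_open_pos:
  fixes A :: "'a::euclidean_space set"
  assumes "open A" "A \<noteq> {}"
  shows "emeasure lborel A > 0"
proof -
  have "A \<notin> null_sets lebesgue"
    using open_not_negligible[OF assms] by (simp add: negligible_iff_null_sets)
  then show ?thesis
    using assms by (auto simp: null_sets_completion_iff2 null_sets_def zero_less_iff_neq_zero)
qed

lemma emeasure_usphere_finite: "emeasure (usphere :: 'a::euclidean_space measure) A < \<infinity>"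
proof -
  have "emeasure (usphere :: 'a measure) A \<le> emeasure (usphere :: 'a measure) UNIV"
    by (rule emeasure_mono) auto
  also have "\<dots> = ennreal (real DIM('a)) * emeasure lborel (cball (0::'a) 1 - {0})"
    using nn_integral_usphere[of "\<lambda>_. 1"] by simp
  also have "\<dots> \<le> ennreal (real DIM('a)) * emeasure lborel (cball (0::'a) 1)"
    by (intro mult_left_mono emeasure_mono) auto
  also have "\<dots> < \<infinity>"
    using emeasure_lborel_cball_finite[of "0::'a" 1] by (simp add: ennreal_mult_less_top)
  finally show ?thesis .
qed

interpretation usphere: finite_measure "usphere :: 'a::euclidean_space measure"
  by (rule finite_measureI) (metis emeasure_usphere_finite infinity_ennreal_def less_irrefl)

lemma emeasure_usphere_cap_pos:
  fixes e :: "'a::euclidean_space"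
  assumes "norm e = 1" "\<epsilon> > 0"
  shows "emeasure usphere {x. norm (e - x) < \<epsilon>} > 0"
proof -
  \<comment> \<open>The open cone over the cap, with the origin removed so that \<open>sgn\<close>
    is continuous. It contains \<open>e / 2\<close>, so its volume is positive.\<close>
  define A where "A = {y\<in>ball 0 1 - {0}. norm (e - sgn y) < \<epsilon>}"
  have cont: "continuous_on (ball 0 1 - {0}) (\<lambda>y. norm (e - sgn y))"
    unfolding sgn_div_norm by (intro continuous_intros) auto
  have "open A"
    unfolding A_def
    using continuous_open_preimage[OF cont, of "{..<\<epsilon>}"] open_delete[of "ball 0 1" 0]
    by (simp add: vimage_def Int_def)
  moreover have "(1/2) *\<^sub>R e \<in> A"
    using assms by (auto simp: A_def sgn_scaleR) (simp add: sgn_div_norm)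
  ultimately have "emeasure lborel A > 0"
    by (intro emeasure_lborel_open_pos) auto
  also have "emeasure lborel A \<le>
     (\<integral>\<^sup>+y. indicator {x. norm (e - x) < \<epsilon>} (sgn y) * indicator (cball 0 1 - {0}) y \<partial>lborel)"
  proof -
    have "A \<in> sets lborel" using \<open>open A\<close> by simp
    then have "emeasure lborel A = (\<integral>\<^sup>+y. indicator A y \<partial>lborel)"
      by simp
    also have "\<dots> \<le> (\<integral>\<^sup>+y. indicator {x. norm (e - x) < \<epsilon>} (sgn y) * indicator (cball 0 1 - {0}) y \<partial>lborel)"
      by (intro nn_integral_mono) (auto simp: A_def indicator_def)
    finally show ?thesis .
  qed
  also have "\<dots> \<le> ennreal (real DIM('a)) * \<dots>"
  proof -
    have "1 \<le> ennreal (real DIM('a))"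
      using DIM_positive[where 'a='a] by (simp add: Suc_leI)
    from mult_right_mono[OF this] show ?thesis by simp
  qed
  also have "\<dots> = (\<integral>\<^sup>+x. indicator {x. norm (e - x) < \<epsilon>} x \<partial>usphere)"
    by (rule nn_integral_usphere[symmetric]) measurable
  also have "\<dots> = emeasure usphere {x. norm (e - x) < \<epsilon>}"
    by (rule nn_integral_indicator) simp
  finally show ?thesis .
qed

lemma ennreal_mult_divide_cancel:
  fixes a x :: ennreal
  assumes "a \<noteq> 0" "a \<noteq> top"
  shows "a * x / a = x" and "a * (x / a) = x"
  using assms
  by (simp_all add: ennreal_times_divide ennreal_mult_divide_eq mult.commute[of a x])

lemma ennreal_le_of_diff_le:
  fixes a b t :: ennreal
  assumes "t - a \<le> t - b" "a \<le> t" "b \<le> t" "t \<noteq> top"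
  shows "b \<le> a"
proof -
  obtain t' a' b' where "t = ennreal t'" "a = ennreal a'" "b = ennreal b'" "0 \<le> a'" "0 \<le> b'" "0 \<le> t'"
    using assms by (metis ennreal_cases top_unique)
  with assms show ?thesis by (auto simp: ennreal_minus ennreal_le_iff2)
qed

lemma emeasure_usphere_pos: "emeasure (usphere :: 'a::euclidean_space measure) UNIV > 0"
proof -
  obtain e :: 'a where e: "norm e = 1"
    using SOME_Basis norm_Basis by blast
  have "0 < emeasure usphere {x. norm (e - x) < 1}"
    using emeasure_usphere_cap_pos[OF e] by simp
  also have "\<dots> \<le> emeasure (usphere :: 'a measure) UNIV"
    by (rule emeasure_mono) auto
  finally show ?thesis .
qed

subsection \<open>Spherical averages\<close>

lemma emeasure_usphere_neq:
  "emeasure (usphere :: 'a::euclidean_space measure) UNIV \<noteq> 0"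
  "emeasure (usphere :: 'a::euclidean_space measure) UNIV \<noteq> top"
  using emeasure_usphere_pos[where 'a='a] emeasure_usphere_finite[of "UNIV :: 'a set"] by auto

text \<open>
  By invariance, averaging \<open>indicator G (norm z *\<^sub>R x)\<close> over the cap of radius \<open>\<epsilon>\<close> around \<open>sgn z\<close> and
  then over \<open>\<mu>\<close> gives the full spherical average for every \<open>\<epsilon>\<close>; for open \<open>G\<close>, Fatou's lemma as
  \<open>\<epsilon> \<rightarrow> 0\<close> yields one inequality. Outer regularity and complements turn it into equality.
\<close>

lemma rotation_invariant_le_spherical_average_open:
  fixes \<mu> :: "'a::euclidean_space measure"
  assumes sets [measurable_cong, simp]: "sets \<mu> = sets borel" and fin: "finite_measure \<mu>"
    and inv: "\<And>f F. orthogonal_transformation f \<Longrightarrow> F \<in> borel_measurable borel \<Longrightarrow>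
      (\<integral>\<^sup>+z. F (f z) \<partial>\<mu>) = (\<integral>\<^sup>+z. F z \<partial>\<mu>)"
    and nz: "AE z in \<mu>. z \<noteq> 0"
    and G: "open G"
  shows "emeasure usphere (UNIV :: 'a set) * emeasure \<mu> G \<le>
    (\<integral>\<^sup>+z. \<integral>\<^sup>+x. indicator G (norm z *\<^sub>R x) \<partial>usphere \<partial>\<mu>)"
proof -
  interpret mu: finite_measure \<mu> by (rule fin)
  interpret pair_sigma_finite \<mu> "usphere :: 'a measure" ..
  have [measurable]: "G \<in> sets borel" using G by simp
  define s where "s = emeasure (usphere :: 'a measure) UNIV"
  have s: "s \<noteq> 0" "s \<noteq> top"
    unfolding s_def by (rule emeasure_usphere_neq)+
  \<comment> \<open>\<open>\<kappa> \<epsilon> z x\<close> tests whether \<open>x\<close> lies in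
    the cap of radius \<open>\<epsilon>\<close> around the direction of \<open>z\<close>. It is
    invariant under rotating both arguments, so its integral \<open>a \<epsilon>\<close> over
    \<open>x\<close> is the same for every \<open>z \<noteq> 0\<close>.\<close>
  define \<kappa> :: "real \<Rightarrow> 'a \<Rightarrow> 'a \<Rightarrow> ennreal"
    where "\<kappa> \<epsilon> z x = indicator {..<\<epsilon>} (norm (sgn z - x))" for \<epsilon> z x
  have [measurable]: "(\<lambda>(z, x). \<kappa> \<epsilon> z x) \<in> borel_measurable (borel \<Otimes>\<^sub>M borel)" for \<epsilon>
    unfolding \<kappa>_def[abs_def] by measurable
  define a where "a \<epsilon> = (\<integral>\<^sup>+x. \<kappa> \<epsilon> (SOME e. norm e = 1) x \<partial>usphere)" for \<epsilon>
  have sgn_orth: "sgn (f z) = f (sgn z)" if "orthogonal_transformation f" for f and z :: 'a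
    using that
    by (simp add: sgn_div_norm orthogonal_transformation_norm linear_scale[OF orthogonal_transformation_linear])
  have \<kappa>_orth: "\<kappa> \<epsilon> (f z) (f x) = \<kappa> \<epsilon> z x" if f: "orthogonal_transformation f" for f \<epsilon> z x
  proof -
    have "sgn (f z) - f x = f (sgn z - x)"
      using f by (simp add: sgn_orth linear_diff orthogonal_transformation_linear)
    then show ?thesis
      using f by (simp add: \<kappa>_def orthogonal_transformation_norm)
  qed
  have some: "norm (SOME e::'a. norm e = 1) = 1"
    by (rule someI_ex) (metis SOME_Basis norm_Basis)
  have a_eq: "(\<integral>\<^sup>+x. \<kappa> \<epsilon> z x \<partial>usphere) = a \<epsilon>" if z: "z \<noteq> 0" for \<epsilon> z
  proof -
    define e where "e = (SOME e::'a. norm e = 1)"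
    have sge: "sgn e = e" "sgn (sgn z) = sgn z"
      using some z by (simp_all add: e_def sgn_div_norm)
    obtain f where f: "orthogonal_transformation f" "f e = sgn z"
      using orthogonal_transformation_moving[of e "sgn z"] some z by (auto simp: e_def norm_sgn)
    have "(\<integral>\<^sup>+x. \<kappa> \<epsilon> z x \<partial>usphere) = (\<integral>\<^sup>+x. \<kappa> \<epsilon> (f e) x \<partial>usphere)"
      by (simp add: f \<kappa>_def sge)
    also have "\<dots> = (\<integral>\<^sup>+x. \<kappa> \<epsilon> (f e) (f x) \<partial>usphere)"
      by (rule nn_integral_usphere_orthogonal[OF f(1), symmetric]) measurable
    also have "\<dots> = a \<epsilon>"
      by (simp add: \<kappa>_orth[OF f(1)] a_def e_def)
    finally show ?thesis .
  qed
  have a_pos: "a \<epsilon> \<noteq> 0" "a \<epsilon> \<noteq> top" if "\<epsilon> > 0" for \<epsilon>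
  proof -
    define e where "e = (SOME e::'a. norm e = 1)"
    have "sgn e = e" using some by (simp add: e_def sgn_div_norm)
    then have "a \<epsilon> = (\<integral>\<^sup>+x. indicator {x. norm (e - x) < \<epsilon>} x \<partial>usphere)"
      unfolding a_def e_def[symmetric] by (intro nn_integral_cong) (simp add: \<kappa>_def indicator_def)
    also have "\<dots> = emeasure usphere {x. norm (e - x) < \<epsilon>}"
      by (rule nn_integral_indicator) simp
    finally show "a \<epsilon> \<noteq> 0" "a \<epsilon> \<noteq> top"
      using emeasure_usphere_cap_pos[of e \<epsilon>] emeasure_usphere_finite[of "{x. norm (e - x) < \<epsilon>}"] that some
      by (auto simp: e_def)
  qed
  \<comment> \<open>By invariance of \<open>\<mu>\<close> the integral on the left is the same for
    all unit \<open>x\<close>; averaging it over \<open>x\<close> and exchanging the integrals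
    evaluates it.\<close>
  have radial: "s * (\<integral>\<^sup>+z. \<kappa> \<epsilon> z x * H (norm z) \<partial>\<mu>) = a \<epsilon> * (\<integral>\<^sup>+z. H (norm z) \<partial>\<mu>)"
    if x: "norm x = 1" and [measurable]: "H \<in> borel_measurable borel" for \<epsilon> x and H :: "real \<Rightarrow> ennreal"
  proof -
    have eq: "(\<integral>\<^sup>+z. \<kappa> \<epsilon> z x * H (norm z) \<partial>\<mu>) = (\<integral>\<^sup>+z. \<kappa> \<epsilon> z y * H (norm z) \<partial>\<mu>)"
      if "norm y = 1" for y
    proof -
      obtain f where f: "orthogonal_transformation f" "f y = x"
        using orthogonal_transformation_moving[of y x] x \<open>norm y = 1\<close> by auto
      have "(\<integral>\<^sup>+z. \<kappa> \<epsilon> z x * H (norm z) \<partial>\<mu>) = (\<integral>\<^sup>+z. \<kappa> \<epsilon> (f z) x * H (norm (f z)) \<partial>\<mu>)"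
        by (rule inv[OF f(1), symmetric]) measurable
      also have "\<dots> = (\<integral>\<^sup>+z. \<kappa> \<epsilon> (f z) (f y) * H (norm z) \<partial>\<mu>)"
        by (simp add: f orthogonal_transformation_norm[OF f(1)])
      finally show ?thesis by (simp add: \<kappa>_orth[OF f(1)])
    qed
    have "s * (\<integral>\<^sup>+z. \<kappa> \<epsilon> z x * H (norm z) \<partial>\<mu>) =
        (\<integral>\<^sup>+y. (\<integral>\<^sup>+z. \<kappa> \<epsilon> z x * H (norm z) \<partial>\<mu>) \<partial>(usphere :: 'a measure))"
      by (simp add: s_def mult.commute)
    also have "\<dots> = (\<integral>\<^sup>+y. \<integral>\<^sup>+z. \<kappa> \<epsilon> z y * H (norm z) \<partial>\<mu> \<partial>usphere)"
      by (rule nn_integral_usphere_cong) (rule eq)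
    also have "\<dots> = (\<integral>\<^sup>+z. \<integral>\<^sup>+y. \<kappa> \<epsilon> z y * H (norm z) \<partial>usphere \<partial>\<mu>)"
      by (rule Fubini') measurable
    also have "\<dots> = (\<integral>\<^sup>+z. (\<integral>\<^sup>+y. \<kappa> \<epsilon> z y \<partial>usphere) * H (norm z) \<partial>\<mu>)"
      by (intro nn_integral_cong nn_integral_multc) measurable
    also have "\<dots> = (\<integral>\<^sup>+z. a \<epsilon> * H (norm z) \<partial>\<mu>)"
      by (rule nn_integral_cong_AE) (use nz in \<open>auto simp: a_eq elim!: eventually_mono\<close>)
    finally show ?thesis by (simp add: nn_integral_cmult)
  qed
  define F where "F z x = (indicator G (norm z *\<^sub>R x) :: ennreal)" for z x :: 'a
  have F [measurable]: "(\<lambda>(z, x). F z x) \<in> borel_measurable (borel \<Otimes>\<^sub>M borel)"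
    unfolding F_def[abs_def] by measurable
  \<comment> \<open>For fixed \<open>x\<close>, the function \<open>F z x\<close> depends on
    \<open>z\<close> through \<open>norm z\<close> alone, so \<open>radial\<close> applies. The cap
    average therefore has the same integral for every \<open>\<epsilon>\<close>.\<close>
  have avg: "s * (\<integral>\<^sup>+z. (\<integral>\<^sup>+x. \<kappa> \<epsilon> z x * F z x \<partial>usphere) / a \<epsilon> \<partial>\<mu>) =
      (\<integral>\<^sup>+z. \<integral>\<^sup>+x. F z x \<partial>usphere \<partial>\<mu>)" if "\<epsilon> > 0" for \<epsilon>
  proof -
    have "s * (\<integral>\<^sup>+z. \<integral>\<^sup>+x. \<kappa> \<epsilon> z x * F z x \<partial>usphere \<partial>\<mu>) =
        s * (\<integral>\<^sup>+x. \<integral>\<^sup>+z. \<kappa> \<epsilon> z x * F z x \<partial>\<mu> \<partial>usphere)"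
      by (rule arg_cong[where f="(*) s"], rule Fubini'[symmetric]) measurable
    also have "\<dots> = (\<integral>\<^sup>+x. s * (\<integral>\<^sup>+z. \<kappa> \<epsilon> z x * F z x \<partial>\<mu>) \<partial>usphere)"
      by (rule nn_integral_cmult[symmetric]) measurable
    also have "\<dots> = (\<integral>\<^sup>+x. a \<epsilon> * (\<integral>\<^sup>+z. F z x \<partial>\<mu>) \<partial>usphere)"
    proof (rule nn_integral_usphere_cong)
      fix x :: 'a assume x: "norm x = 1"
      show "s * (\<integral>\<^sup>+z. \<kappa> \<epsilon> z x * F z x \<partial>\<mu>) = a \<epsilon> * (\<integral>\<^sup>+z. F z x \<partial>\<mu>)"
        using radial[OF x, of "\<lambda>r. indicator G (r *\<^sub>R x)"] by (simp add: F_def)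
    qed
    also have "\<dots> = a \<epsilon> * (\<integral>\<^sup>+x. \<integral>\<^sup>+z. F z x \<partial>\<mu> \<partial>usphere)"
      by (rule nn_integral_cmult) measurable
    also have "(\<integral>\<^sup>+x. \<integral>\<^sup>+z. F z x \<partial>\<mu> \<partial>usphere) = (\<integral>\<^sup>+z. \<integral>\<^sup>+x. F z x \<partial>usphere \<partial>\<mu>)"
      by (rule Fubini') measurable
    finally have "s * (\<integral>\<^sup>+z. \<integral>\<^sup>+x. \<kappa> \<epsilon> z x * F z x \<partial>usphere \<partial>\<mu>) / a \<epsilon> =
        (\<integral>\<^sup>+z. \<integral>\<^sup>+x. F z x \<partial>usphere \<partial>\<mu>)"
      by (rule ssubst) (rule ennreal_mult_divide_cancel(1)[OF a_pos[OF that]])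
    moreover have "(\<integral>\<^sup>+z. (\<integral>\<^sup>+x. \<kappa> \<epsilon> z x * F z x \<partial>usphere) / a \<epsilon> \<partial>\<mu>) =
        (\<integral>\<^sup>+z. \<integral>\<^sup>+x. \<kappa> \<epsilon> z x * F z x \<partial>usphere \<partial>\<mu>) / a \<epsilon>"
      by (rule nn_integral_divide) measurable
    ultimately show ?thesis
      by (simp only: ennreal_times_divide)
  qed
  define q where "q n z = (\<integral>\<^sup>+x. \<kappa> (1 / Suc n) z x * F z x \<partial>usphere) / a (1 / Suc n)" for n z
  have [measurable]: "q n \<in> borel_measurable borel" for n
    unfolding q_def[abs_def] by measurable
  have conv: "indicator G z \<le> liminf (\<lambda>n. q n z)" if z: "z \<noteq> 0" for z
  proof (cases "z \<in> G")
    case True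
    then obtain \<epsilon> where \<epsilon>: "\<epsilon> > 0" "ball z \<epsilon> \<subseteq> G"
      using G by (auto simp: open_contains_ball)
    have "\<forall>\<^sub>F n in sequentially. 1 / Suc n * norm z < \<epsilon>"
    proof -
      have "((\<lambda>n. 1 / Suc n * norm z) \<longlonglongrightarrow> 0 * norm z)"
        by (intro tendsto_mult tendsto_const) (use LIMSEQ_inverse_real_of_nat in \<open>simp add: inverse_eq_divide\<close>)
      then show ?thesis using \<epsilon> order_tendstoD(2) by fastforce
    qed
    then have "\<forall>\<^sub>F n in sequentially. 1 \<le> q n z"
    proof eventually_elim
      case (elim n)
      \<comment> \<open>For \<open>x\<close> in the cap, the point of norm \<open>norm z\<close> in
        direction \<open>x\<close> is within \<open>norm z / Suc n\<close> of \<open>z\<close>,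
        hence in \<open>G\<close>.\<close>
      have "\<kappa> (1 / Suc n) z x * F z x = \<kappa> (1 / Suc n) z x" for x
      proof (cases "norm (sgn z - x) < 1 / Suc n")
        case True
        have "z - norm z *\<^sub>R x = norm z *\<^sub>R (sgn z - x)"
          using z by (simp add: sgn_div_norm algebra_simps)
        then have "norm (z - norm z *\<^sub>R x) = norm z * norm (sgn z - x)"
          by simp
        also have "\<dots> \<le> norm z * (1 / Suc n)"
          by (rule mult_left_mono) (use True in simp_all)
        finally have "norm (z - norm z *\<^sub>R x) \<le> norm z * (1 / Suc n)" .
        then have "norm (z - norm z *\<^sub>R x) < \<epsilon>"
          using elim by (simp add: mult.commute)
        then have "norm z *\<^sub>R x \<in> G"
          using \<epsilon> by (auto simp: subset_iff dist_norm)
        then show ?thesis by (simp add: F_def)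
      qed (simp add: \<kappa>_def)
      then have "q n z = 1"
        using ennreal_mult_divide_cancel(1)[OF a_pos, of "1 / Suc n" 1] z by (simp add: q_def a_eq)
      then show ?case by simp
    qed
    then have "1 \<le> liminf (\<lambda>n. q n z)"
      by (rule Liminf_bounded)
    then show ?thesis using True by simp
  qed simp
  have "emeasure \<mu> G = (\<integral>\<^sup>+z. indicator G z \<partial>\<mu>)"
    by simp
  also have "\<dots> \<le> (\<integral>\<^sup>+z. liminf (\<lambda>n. q n z) \<partial>\<mu>)"
    by (rule nn_integral_mono_AE) (use nz conv in \<open>auto elim!: eventually_mono\<close>)
  also have "\<dots> \<le> liminf (\<lambda>n. \<integral>\<^sup>+z. q n z \<partial>\<mu>)"
    by (rule nn_integral_liminf) measurable
  finally have "s * emeasure \<mu> G \<le> s * liminf (\<lambda>n. \<integral>\<^sup>+z. q n z \<partial>\<mu>)"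
    by (rule mult_left_mono) simp
  also have "(\<lambda>n. \<integral>\<^sup>+z. q n z \<partial>\<mu>) = (\<lambda>n. (\<integral>\<^sup>+z. \<integral>\<^sup>+x. F z x \<partial>usphere \<partial>\<mu>) / s)"
  proof
    fix n
    have "s * (\<integral>\<^sup>+z. q n z \<partial>\<mu>) / s = (\<integral>\<^sup>+z. \<integral>\<^sup>+x. F z x \<partial>usphere \<partial>\<mu>) / s"
      using avg[of "1 / Suc n"] by (simp add: q_def)
    then show "(\<integral>\<^sup>+z. q n z \<partial>\<mu>) = (\<integral>\<^sup>+z. \<integral>\<^sup>+x. F z x \<partial>usphere \<partial>\<mu>) / s"
      by (simp only: ennreal_mult_divide_cancel(1)[OF s])
  qed
  also have "s * liminf (\<lambda>n. (\<integral>\<^sup>+z. \<integral>\<^sup>+x. F z x \<partial>usphere \<partial>\<mu>) / s) =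
      (\<integral>\<^sup>+z. \<integral>\<^sup>+x. F z x \<partial>usphere \<partial>\<mu>)"
    by (simp add: Liminf_const ennreal_mult_divide_cancel(2)[OF s])
  finally show ?thesis
    by (simp add: s_def F_def)
qed

lemma rotation_invariant_spherical_average:
  fixes \<mu> :: "'a::euclidean_space measure"
  assumes sets [measurable_cong, simp]: "sets \<mu> = sets borel" and fin: "finite_measure \<mu>"
    and inv: "\<And>f F. orthogonal_transformation f \<Longrightarrow> F \<in> borel_measurable borel \<Longrightarrow>
      (\<integral>\<^sup>+z. F (f z) \<partial>\<mu>) = (\<integral>\<^sup>+z. F z \<partial>\<mu>)"
    and nz: "AE z in \<mu>. z \<noteq> 0"
    and F [measurable]: "F \<in> borel_measurable borel"
  shows "emeasure usphere (UNIV :: 'a set) * (\<integral>\<^sup>+z. F z \<partial>\<mu>) =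
    (\<integral>\<^sup>+z. \<integral>\<^sup>+x. F (norm z *\<^sub>R x) \<partial>usphere \<partial>\<mu>)"
proof -
  interpret mu: finite_measure \<mu> by (rule fin)
  interpret pair_sigma_finite \<mu> "usphere :: 'a measure" ..
  define s where "s = emeasure (usphere :: 'a measure) UNIV"
  have s: "s \<noteq> 0" "s \<noteq> top"
    unfolding s_def by (rule emeasure_usphere_neq)+
  have sp: "space \<mu> = UNIV" using sets_eq_imp_space_eq[OF sets] by simp
  \<comment> \<open>\<open>\<nu>\<close> is the image of \<open>\<mu>\<close> when the direction is
    replaced by an independent uniform one, and \<open>\<rho>\<close> is \<open>\<mu>\<close> scaled
    to the same total mass. Between finite measures of equal mass, an inequality on all Borel sets
    is an equality.\<close>
  define \<nu> where "\<nu> = distr (\<mu> \<Otimes>\<^sub>M usphere) borel (\<lambda>(z, x). norm z *\<^sub>R (x::'a))"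
  define \<rho> where "\<rho> = scale_measure s \<mu>"
  have s\<rho>: "sets \<rho> = sets borel" and s\<nu>: "sets \<nu> = sets borel"
    by (simp_all add: \<rho>_def \<nu>_def)
  have nuF: "(\<integral>\<^sup>+z. F z \<partial>\<nu>) = (\<integral>\<^sup>+z. \<integral>\<^sup>+x. F (norm z *\<^sub>R x) \<partial>usphere \<partial>\<mu>)"
    if [measurable]: "F \<in> borel_measurable borel" for F
  proof -
    have "(\<integral>\<^sup>+z. F z \<partial>\<nu>) = (\<integral>\<^sup>+p. F (norm (fst p) *\<^sub>R snd p) \<partial>(\<mu> \<Otimes>\<^sub>M usphere))"
      unfolding \<nu>_def by (subst nn_integral_distr) (simp_all add: case_prod_beta')
    also have "\<dots> = (\<integral>\<^sup>+z. \<integral>\<^sup>+x. F (norm z *\<^sub>R x) \<partial>usphere \<partial>\<mu>)"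
      by (subst usphere.nn_integral_fst[symmetric]) simp_all
    finally show ?thesis .
  qed
  have tot: "emeasure \<nu> UNIV = emeasure \<rho> UNIV"
    using nuF[of "\<lambda>_. 1"] by (simp add: \<nu>_def \<rho>_def emeasure_scale_measure s_def[symmetric] sp)
  have fin1: "emeasure \<rho> UNIV \<noteq> top"
    using s mu.emeasure_finite[of UNIV] by (auto simp: \<rho>_def ennreal_mult_eq_top_iff)
  have open_le: "emeasure \<rho> G \<le> emeasure \<nu> G" if G: "open G" for G
  proof -
    have [measurable]: "G \<in> sets borel" using G by simp
    have "emeasure \<rho> G = s * emeasure \<mu> G"
      by (simp only: \<rho>_def emeasure_scale_measure)
    also have "\<dots> \<le> (\<integral>\<^sup>+z. \<integral>\<^sup>+x. indicator G (norm z *\<^sub>R x) \<partial>usphere \<partial>\<mu>)"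
      unfolding s_def by (rule rotation_invariant_le_spherical_average_open[OF assms(1-4) G])
    also have "\<dots> = (\<integral>\<^sup>+z. indicator G z \<partial>\<nu>)"
      by (rule nuF[symmetric]) measurable
    also have "\<dots> = emeasure \<nu> G"
      by (rule nn_integral_indicator) (simp add: s\<nu>)
    finally show ?thesis .
  qed
  have le: "emeasure \<rho> A \<le> emeasure \<nu> A" if A: "A \<in> sets borel" for A
  proof -
    have "emeasure \<nu> (space \<nu>) \<noteq> \<infinity>"
      using tot fin1 by (simp add: \<nu>_def)
    then have "emeasure \<nu> A = (INF U \<in> {U. A \<subseteq> U \<and> open U}. emeasure \<nu> U)"
      using A s\<nu> by (intro outer_regular) simp_all
    moreover have "emeasure \<rho> A \<le> emeasure \<nu> U" if "A \<subseteq> U" "open U" for U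
      using order_trans[OF emeasure_mono[OF \<open>A \<subseteq> U\<close>, of \<rho>] open_le[OF \<open>open U\<close>]] \<open>open U\<close> s\<rho> by simp
    ultimately show ?thesis by (metis (no_types, lifting) INF_greatest mem_Collect_eq)
  qed
  have "\<rho> = \<nu>"
  proof (rule measure_eqI)
    show "sets \<rho> = sets \<nu>" by (simp add: s\<rho> s\<nu>)
    fix A assume "A \<in> sets \<rho>"
    then have A: "A \<in> sets borel" by (simp add: s\<rho>)
    have spl: "space \<rho> = UNIV" "space \<nu> = UNIV" using sp by (simp_all add: \<rho>_def \<nu>_def space_scale_measure)
    have m: "emeasure \<rho> A \<le> emeasure \<rho> UNIV" "emeasure \<nu> A \<le> emeasure \<nu> UNIV"
      by (rule emeasure_mono; simp add: s\<rho> s\<nu>)+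
    then have "emeasure \<rho> A \<noteq> \<infinity>" "emeasure \<nu> A \<noteq> \<infinity>"
      using fin1 tot by (metis infinity_ennreal_def neq_top_trans)+
    then have compl: "emeasure \<rho> (- A) = emeasure \<rho> UNIV - emeasure \<rho> A"
      "emeasure \<nu> (- A) = emeasure \<nu> UNIV - emeasure \<nu> A"
      using emeasure_compl[of A \<rho>] emeasure_compl[of A \<nu>] A
      by (simp_all add: Compl_eq_Diff_UNIV s\<rho> s\<nu> spl)
    have "emeasure \<rho> (- A) \<le> emeasure \<nu> (- A)"
      by (rule le) (simp add: A borel_comp)
    then have "emeasure \<nu> A \<le> emeasure \<rho> A"
      unfolding compl tot by (rule ennreal_le_of_diff_le[OF _ m(1) m(2)[unfolded tot] fin1])
    with le[OF A] show "emeasure \<rho> A = emeasure \<nu> A" by simp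
  qed
  then have "(\<integral>\<^sup>+z. F z \<partial>\<rho>) = (\<integral>\<^sup>+z. F z \<partial>\<nu>)" by simp
  then show ?thesis
    by (simp add: nuF \<rho>_def nn_integral_scale_measure s_def)
qed

section \<open>The Maxwellian, and averaging over directions under Lebesgue measure\<close>

lemma borel_measurable_maxwellian [measurable]: "maxwellian \<in> borel_measurable borel"
  unfolding maxwellian_def[abs_def] by measurable

lemma maxwellian_pos: "maxwellian v > 0"
  by (simp add: maxwellian_def)

text \<open>The density factorises over \<open>Basis\<close> into one-dimensional standard normal
  densities.\<close>

lemma nn_integral_maxwellian: "(\<integral>\<^sup>+v. ennreal (maxwellian (v::'a::euclidean_space)) \<partial>lborel) = 1"
proof -
  have c: "(2 * pi) powr (- real DIM('a) / 2) = (\<Prod>b\<in>(Basis::'a set). 1 / sqrt (2 * pi))"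
  proof -
    have "(2 * pi) powr (- (1 / 2)) = 1 / sqrt (2 * pi)"
      by (simp add: powr_minus_divide powr_half_sqrt)
    then have "(\<Prod>b\<in>(Basis::'a set). 1 / sqrt (2 * pi)) = ((2 * pi) powr (- (1 / 2))) powr real DIM('a)"
      by (simp add: powr_realpow)
    also have "\<dots> = (2 * pi) powr (- (1 / 2) * real DIM('a))"
      by (rule powr_powr)
    also have "- (1 / 2) * real DIM('a) = - real DIM('a) / 2"
      by simp
    finally show ?thesis ..
  qed
  have e: "exp (- (norm v)\<^sup>2 / 2) = (\<Prod>b\<in>Basis. exp (- (v \<bullet> b)\<^sup>2 / 2))" for v :: 'a
  proof -
    have "(norm v)\<^sup>2 = (\<Sum>b\<in>Basis. (v \<bullet> b)\<^sup>2)"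
      by (subst norm_eq_sqrt_inner, subst euclidean_inner)
         (simp add: power2_eq_square sum_nonneg)
    then have "- (norm v)\<^sup>2 / 2 = (\<Sum>b\<in>Basis. - (v \<bullet> b)\<^sup>2 / 2)"
      by (simp add: sum_divide_distrib sum_negf)
    also have "exp \<dots> = (\<Prod>b\<in>Basis. exp (- (v \<bullet> b)\<^sup>2 / 2))"
      by (rule exp_sum) simp
    finally show ?thesis .
  qed
  have "maxwellian v = (\<Prod>b\<in>Basis. std_normal_density (v \<bullet> b))" for v :: 'a
    unfolding maxwellian_def c e by (simp only: std_normal_density_def prod.distrib)
  then have "(\<integral>\<^sup>+v. ennreal (maxwellian (v::'a)) \<partial>lborel) =
      (\<integral>\<^sup>+v. (\<Prod>b\<in>Basis. ennreal (std_normal_density (v \<bullet> b))) \<partial>(lborel :: 'a measure))"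
    by (simp add: prod_ennreal)
  also have "\<dots> = (\<Prod>b\<in>(Basis::'a set). \<integral>\<^sup>+x. ennreal (std_normal_density x) \<partial>lborel)"
    by (rule nn_integral_lborel_prod) auto
  also have "(\<integral>\<^sup>+x. ennreal (std_normal_density x) \<partial>lborel) = 1"
    using nn_integral_eq_integral[OF integrable_normal_density[of 1 0]] by simp
  finally show ?thesis by simp
qed

text \<open>Stands in for polar coordinates. Lebesgue measure is infinite, so the finite case is
  applied to the measure with Maxwellian density and to \<open>F / M\<close>; the Maxwellian is
  radial and positive, hence cancels on both sides.\<close>

lemma nn_integral_lborel_spherical_average:
  fixes F :: "'a::euclidean_space \<Rightarrow> ennreal"
  assumes [measurable]: "F \<in> borel_measurable borel"
  shows "emeasure usphere (UNIV :: 'a set) * (\<integral>\<^sup>+z. F z \<partial>lborel) =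
    (\<integral>\<^sup>+(z::'a). \<integral>\<^sup>+x. F (norm z *\<^sub>R x) \<partial>usphere \<partial>lborel)"
proof -
  define M :: "'a \<Rightarrow> ennreal" where "M v = ennreal (maxwellian v)" for v
  have [measurable]: "M \<in> borel_measurable borel" by (simp add: M_def[abs_def])
  have M: "M v \<noteq> 0" "M v \<noteq> top" for v
    using maxwellian_pos[of v] by (simp_all add: M_def)
  define \<mu> where "\<mu> = density lborel M"
  have Mn: "M v = M w" if "norm v = norm w" for v w
    using that by (simp add: M_def maxwellian_def)
  have canc: "M z * (x / M z) = x" for x z
    using M[of z] by (rule ennreal_mult_divide_cancel(2))
  have "emeasure usphere (UNIV :: 'a set) * (\<integral>\<^sup>+z. F z / M z \<partial>\<mu>) =
    (\<integral>\<^sup>+z. \<integral>\<^sup>+x. F (norm z *\<^sub>R x) / M (norm z *\<^sub>R x) \<partial>usphere \<partial>\<mu>)"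
  proof (rule rotation_invariant_spherical_average)
    show "sets \<mu> = sets borel" by (simp add: \<mu>_def)
    show "finite_measure \<mu>"
      using nn_integral_maxwellian[where 'a='a]
      by (intro finite_measureI) (simp add: \<mu>_def emeasure_density M_def)
    show "AE z in \<mu>. z \<noteq> 0"
      unfolding \<mu>_def by (subst AE_density) (use AE_lborel_singleton[of 0] in \<open>auto elim!: eventually_mono\<close>)
    fix f :: "'a \<Rightarrow> 'a" and F :: "'a \<Rightarrow> ennreal"
    assume f: "orthogonal_transformation f" and [measurable]: "F \<in> borel_measurable borel"
    note [measurable] = borel_measurable_orthogonal[OF f]
    have "M (f z) = M z" for z
      using f by (intro Mn) (simp add: orthogonal_transformation_norm)
    then show "(\<integral>\<^sup>+z. F (f z) \<partial>\<mu>) = (\<integral>\<^sup>+z. F z \<partial>\<mu>)"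
      using nn_integral_lborel_orthogonal[OF f, of "\<lambda>z. M z * F z"]
      by (simp add: \<mu>_def nn_integral_density)
  qed measurable
  moreover have "(\<integral>\<^sup>+z. F z / M z \<partial>\<mu>) = (\<integral>\<^sup>+z. F z \<partial>lborel)"
    by (simp add: \<mu>_def nn_integral_density canc)
  moreover have "(\<integral>\<^sup>+z. \<integral>\<^sup>+x. F (norm z *\<^sub>R x) / M (norm z *\<^sub>R x) \<partial>usphere \<partial>\<mu>) =
      (\<integral>\<^sup>+(z::'a). \<integral>\<^sup>+x. F (norm z *\<^sub>R x) \<partial>usphere \<partial>lborel)"
  proof -
    have "(\<integral>\<^sup>+z. \<integral>\<^sup>+x. F (norm z *\<^sub>R x) / M (norm z *\<^sub>R x) \<partial>usphere \<partial>\<mu>) =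
        (\<integral>\<^sup>+z. \<integral>\<^sup>+x. F (norm z *\<^sub>R x) / M z \<partial>usphere \<partial>\<mu>)" (is "?A = _")
      by (intro nn_integral_cong nn_integral_usphere_cong arg_cong2[where f="(/)"] Mn) simp_all
    also have "\<dots> = (\<integral>\<^sup>+z. (\<integral>\<^sup>+x. F (norm z *\<^sub>R x) \<partial>usphere) / M z \<partial>\<mu>)"
      by (intro nn_integral_cong nn_integral_divide) measurable
    also have "\<dots> = (\<integral>\<^sup>+z. M z * ((\<integral>\<^sup>+x. F (norm z *\<^sub>R x) \<partial>usphere) / M z) \<partial>lborel)"
      unfolding \<mu>_def by (rule nn_integral_density) measurable
    also have "\<dots> = (\<integral>\<^sup>+(z::'a). \<integral>\<^sup>+x. F (norm z *\<^sub>R x) \<partial>usphere \<partial>lborel)"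
      unfolding canc ..
    finally show ?thesis .
  qed
  ultimately show ?thesis by simp
qed

text \<open>Resampling the direction of \<open>u\<close> makes it a uniform \<open>y\<close>
  independent of \<open>norm u\<close>; then \<open>x\<close> and \<open>y\<close> play symmetric
  roles and Fubini exchanges them. With the centre of mass fixed, this is the exchange of pre- and
  post-collisional directions.\<close>

lemma nn_integral_swap_direction:
  fixes G :: "'a::euclidean_space \<Rightarrow> 'a \<Rightarrow> ennreal"
  assumes [measurable]: "(\<lambda>(u, x). G u x) \<in> borel_measurable (borel \<Otimes>\<^sub>M borel)"
  shows "(\<integral>\<^sup>+u. \<integral>\<^sup>+x. G (norm u *\<^sub>R x) (sgn u) \<partial>usphere \<partial>lborel) =
    (\<integral>\<^sup>+u. \<integral>\<^sup>+x. G u x \<partial>usphere \<partial>lborel)"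
proof -
  interpret pair_sigma_finite "usphere :: 'a measure" "usphere :: 'a measure" ..
  define s where "s = emeasure (usphere :: 'a measure) UNIV"
  have s: "s \<noteq> 0" "s \<noteq> top"
    unfolding s_def by (rule emeasure_usphere_neq)+
  have "s * (\<integral>\<^sup>+u. \<integral>\<^sup>+x. G (norm u *\<^sub>R x) (sgn u) \<partial>usphere \<partial>lborel) =
      (\<integral>\<^sup>+(u::'a). \<integral>\<^sup>+y. \<integral>\<^sup>+x. G (norm (norm u *\<^sub>R y) *\<^sub>R x) (sgn (norm u *\<^sub>R y)) \<partial>usphere \<partial>usphere \<partial>lborel)"
    unfolding s_def
    by (rule nn_integral_lborel_spherical_average[of "\<lambda>u. \<integral>\<^sup>+x. G (norm u *\<^sub>R x) (sgn u) \<partial>usphere"])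
       measurable
  also have "\<dots> = (\<integral>\<^sup>+(u::'a). \<integral>\<^sup>+y. \<integral>\<^sup>+x. G (norm u *\<^sub>R x) y \<partial>usphere \<partial>usphere \<partial>lborel)"
  proof (rule nn_integral_lborel_cong_except[of 0])
    fix u :: 'a assume u: "u \<noteq> 0"
    show "(\<integral>\<^sup>+y. \<integral>\<^sup>+x. G (norm (norm u *\<^sub>R y) *\<^sub>R x) (sgn (norm u *\<^sub>R y)) \<partial>usphere \<partial>usphere) =
        (\<integral>\<^sup>+y. \<integral>\<^sup>+x. G (norm u *\<^sub>R x) y \<partial>usphere \<partial>usphere)"
      by (rule nn_integral_usphere_cong)
         (use u in \<open>auto simp: sgn_scaleR\<close>, simp add: sgn_div_norm)
  qed
  also have "\<dots> = (\<integral>\<^sup>+(u::'a). \<integral>\<^sup>+x. \<integral>\<^sup>+y. G (norm u *\<^sub>R x) y \<partial>usphere \<partial>usphere \<partial>lborel)"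
    by (intro nn_integral_cong Fubini'[symmetric]) measurable
  also have "\<dots> = s * (\<integral>\<^sup>+u. \<integral>\<^sup>+x. G u x \<partial>usphere \<partial>lborel)"
    unfolding s_def
    by (rule nn_integral_lborel_spherical_average[of "\<lambda>u. \<integral>\<^sup>+y. G u y \<partial>usphere", symmetric])
       measurable
  finally show ?thesis
    by (subst (asm) ennreal_mult_cancel_left) (use s in auto)
qed

subsection \<open>Riesz potentials and Gaussian moments\<close>

lemma norm_powr_nonpos_le_1:
  fixes x :: "'a::real_normed_vector"
  assumes "\<gamma> \<le> 0" "1 \<le> norm x"
  shows "norm x powr \<gamma> \<le> 1"
  using powr_mono2'[of "\<gamma>" 1 "norm x"] assms by simp

lemma ball_in_sets_borel [measurable]: "ball x r \<in> sets borel"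
  by simp

text \<open>A dyadic decomposition: on the shell between \<open>r (Suc n)\<close> and
  \<open>r n\<close> the integrand is at most \<open>r (Suc n) powr \<gamma>\<close>. The resulting
  geometric series has ratio \<open>q\<close>, which is below 1 because \<open>\<gamma>\<close>
  exceeds minus the dimension.\<close>

lemma nn_integral_riesz_ball_finite:
  assumes "- real DIM('a::euclidean_space) < \<gamma>" "\<gamma> \<le> 0"
  shows "(\<integral>\<^sup>+x. ennreal (norm (x::'a) powr \<gamma>) * indicator (ball 0 1) x \<partial>lborel) < \<infinity>"
proof -
  define r :: "nat \<Rightarrow> real" where "r n = (1/2) ^ n" for n
  define q where "q = 2 powr (- (real DIM('a) + \<gamma>))"
  define V where "V = unit_ball_vol (real DIM('a))"
  have V: "V \<ge> 0" by (simp add: V_def)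
  have rp: "r n > 0" for n by (simp add: r_def)
  have q: "0 < q" "q < 1"
    using assms by (auto simp: q_def powr_less_one)
  have "(\<integral>\<^sup>+x. ennreal (norm (x::'a) powr \<gamma>) * indicator (ball 0 1) x \<partial>lborel) \<le>
      (\<integral>\<^sup>+x. (\<Sum>n. ennreal (r (Suc n) powr \<gamma>) * indicator (ball 0 (r n)) (x::'a)) \<partial>lborel)"
  proof (rule nn_integral_lborel_mono_except[of 0])
    fix x :: 'a assume x: "x \<noteq> 0"
    show "ennreal (norm x powr \<gamma>) * indicator (ball 0 1) x \<le>
        (\<Sum>n. ennreal (r (Suc n) powr \<gamma>) * indicator (ball 0 (r n)) x)"
    proof (cases "norm x < 1")
      case True
      have "r \<longlonglongrightarrow> 0" unfolding r_def by (intro LIMSEQ_realpow_zero) auto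
      then have "\<forall>\<^sub>F n in sequentially. r n < norm x"
        using x by (intro order_tendstoD(2)) auto
      then obtain N where N: "r N < norm x"
        by (auto simp: eventually_sequentially)
      \<comment> \<open>The least such index is positive since \<open>norm x < 1\<close>; its
        predecessor \<open>n\<close> names the shell that contains \<open>x\<close>.\<close>
      define m where "m = (LEAST n. r n \<le> norm x)"
      have m: "r m \<le> norm x"
        unfolding m_def by (rule LeastI[of _ N]) (use N in simp)
      have "m \<noteq> 0"
      proof
        assume "m = 0"
        with m True show False by (simp add: r_def)
      qed
      then obtain n where n: "m = Suc n" using not0_implies_Suc by blast
      have "\<not> r n \<le> norm x"
        using not_less_Least[of n "\<lambda>n. r n \<le> norm x"] n by (simp add: m_def)
      then have "ennreal (norm x powr \<gamma>) * indicator (ball 0 1) x \<le>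
          ennreal (r (Suc n) powr \<gamma>) * indicator (ball 0 (r n)) x"
        using m n True powr_mono2'[of \<gamma> "r (Suc n)" "norm x"] assms rp[of "Suc n"]
        by (simp add: ennreal_leI)
      also have "\<dots> \<le> (\<Sum>n. ennreal (r (Suc n) powr \<gamma>) * indicator (ball 0 (r n)) x)"
        using sum_le_suminf[of "\<lambda>n. ennreal (r (Suc n) powr \<gamma>) * indicator (ball 0 (r n)) x" "{n}"]
        by (simp del: sum_indicator_mult sum_mult_indicator)
      finally show ?thesis .
    qed simp
  qed
  also have "\<dots> = (\<Sum>n. ennreal (r (Suc n) powr \<gamma>) * emeasure lborel (ball (0::'a) (r n)))"
    by (simp add: nn_integral_suminf nn_integral_cmult)
  also have "\<dots> = (\<Sum>n. ennreal (2 powr (- \<gamma>) * V * q ^ n))"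
  proof (rule arg_cong[where f=suminf], rule ext)
    fix n
    have "r (Suc n) powr \<gamma> * r n ^ DIM('a) = 2 powr (- \<gamma>) * q ^ n"
    proof -
      have "r (Suc n) powr \<gamma> = 2 powr (- real (Suc n) * \<gamma>)"
        by (simp only: r_def power_one_over powr_realpow[symmetric] powr_minus_divide[symmetric] powr_powr zero_less_numeral)
      moreover have "r n ^ DIM('a) = 2 powr (- real n * real DIM('a))"
      proof -
        have "r n ^ DIM('a) = r n powr real DIM('a)" using rp[of n] by (simp add: powr_realpow)
        also have "\<dots> = 2 powr (- real n * real DIM('a))"
          by (simp only: r_def power_one_over powr_realpow[symmetric] powr_minus_divide[symmetric] powr_powr zero_less_numeral)
        finally show ?thesis .
      qed
      moreover have "q ^ n = 2 powr (- (real DIM('a) + \<gamma>) * real n)"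
        unfolding q_def by (subst powr_realpow[symmetric]) (simp_all only: powr_powr, simp)
      ultimately show ?thesis
        by (simp add: powr_add[symmetric] algebra_simps)
    qed
    then show "ennreal (r (Suc n) powr \<gamma>) * emeasure lborel (ball (0::'a) (r n)) =
        ennreal (2 powr (- \<gamma>) * V * q ^ n)"
      using rp[of n] by (simp add: emeasure_ball V_def ennreal_mult'[symmetric] mult_ac)
  qed
  also have "\<dots> < \<infinity>"
  proof -
    have "summable (\<lambda>n. 2 powr (- \<gamma>) * V * q ^ n)"
      using q by (intro summable_mult summable_geometric) auto
    then have "(\<Sum>n. ennreal (2 powr (- \<gamma>) * V * q ^ n)) = ennreal (\<Sum>n. 2 powr (- \<gamma>) * V * q ^ n)"
      using q V by (intro suminf_ennreal2) auto
    then show ?thesis by simp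
  qed
  finally show ?thesis .
qed

text \<open>Within distance 1 the singularity is integrable and is paired with the sup bound
  \<open>C\<close>; farther away the power is at most 1, which leaves the mass of \<open>g\<close>.
  The bound does not depend on \<open>v\<close>.\<close>

lemma nn_integral_riesz_convolution_le:
  fixes v :: "'a::euclidean_space"
  assumes [measurable]: "g \<in> borel_measurable borel" and g: "\<And>w. g w \<le> C" and "\<gamma> \<le> 0"
  shows "(\<integral>\<^sup>+w. ennreal (norm (v - w) powr \<gamma>) * g w \<partial>lborel) \<le>
    C * (\<integral>\<^sup>+x. ennreal (norm (x::'a) powr \<gamma>) * indicator (ball 0 1) x \<partial>lborel) + (\<integral>\<^sup>+w. g w \<partial>lborel)"
proof -
  have "ennreal (norm (v - w) powr \<gamma>) * g w \<le>
      C * (ennreal (norm (v - w) powr \<gamma>) * indicator (ball 0 1) (v - w)) + g w" for w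
  proof (cases "norm (v - w) < 1")
    case True
    then have "ennreal (norm (v - w) powr \<gamma>) * g w \<le>
      C * (ennreal (norm (v - w) powr \<gamma>) * indicator (ball 0 1) (v - w))"
      using mult_left_mono[OF g, of "ennreal (norm (v - w) powr \<gamma>)" w] by (simp add: mult.commute)
    then show ?thesis by (rule order_trans) simp
  next
    case False
    then have "ennreal (norm (v - w) powr \<gamma>) \<le> 1"
      using norm_powr_nonpos_le_1[of \<gamma> "v - w"] assms by (simp add: ennreal_leI)
    then have "ennreal (norm (v - w) powr \<gamma>) * g w \<le> 1 * g w" by (rule mult_right_mono) simp
    then show ?thesis by (simp add: add_increasing)
  qed
  then have "(\<integral>\<^sup>+w. ennreal (norm (v - w) powr \<gamma>) * g w \<partial>lborel) \<le>
    (\<integral>\<^sup>+w. C * (ennreal (norm (v - w) powr \<gamma>) * indicator (ball 0 1) (v - w)) + g w \<partial>lborel)"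
    by (rule nn_integral_mono)
  also have "\<dots> = C * (\<integral>\<^sup>+w. ennreal (norm (v - w) powr \<gamma>) * indicator (ball 0 1) (v - w) \<partial>lborel)
      + (\<integral>\<^sup>+w. g w \<partial>lborel)"
    by (subst nn_integral_add) (measurable, simp add: nn_integral_cmult)
  also have "(\<integral>\<^sup>+w. ennreal (norm (v - w) powr \<gamma>) * indicator (ball 0 1) (v - w) \<partial>lborel) =
      (\<integral>\<^sup>+x. ennreal (norm (x::'a) powr \<gamma>) * indicator (ball 0 1) x \<partial>lborel)"
    by (rule nn_integral_lborel_shift(2)[of "\<lambda>x. ennreal (norm x powr \<gamma>) * indicator (ball 0 1) x"]) measurable
  finally show ?thesis .
qed

lemma maxwellian_le_1: "maxwellian (v::'a::euclidean_space) \<le> 1"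
proof -
  have "(2 * pi) powr (- real DIM('a) / 2) \<le> (2 * pi) powr 0"
    using pi_gt3 by (intro powr_mono) auto
  then have "(2 * pi) powr (- real DIM('a) / 2) \<le> 1" by simp
  then show ?thesis
    unfolding maxwellian_def by (intro mult_le_one) auto
qed

text \<open>Half of the Gaussian exponent is spent on the polynomial, the other half survives in the
  argument divided by \<open>sqrt 2\<close>. The weight \<open>1 + 2 * norm w\<close> is the one
  that \<open>norm_post_le\<close> produces.\<close>

lemma maxwellian_poly_le:
  assumes "k > 0"
  obtains C where "C > 0"
    "\<And>w::'a::euclidean_space. (1 + 2 * norm w) powr k * maxwellian w \<le> C * maxwellian (w /\<^sub>R sqrt 2)"
proof -
  \<comment> \<open>\<open>exp (k * ln k)\<close> comes from \<open>ln t \<le> t - 1\<close> at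
    \<open>t = (1 + 2 * r) / k\<close>. The 5 is 1 plus the 4 obtained by completing the square in
    \<open>2 * r - r ^ 2 / 4\<close>.\<close>
  define C where "C = exp (k * ln k) * exp (5::real)"
  have "(1 + 2 * norm w) powr k * maxwellian w \<le> C * maxwellian (w /\<^sub>R sqrt 2)" for w :: 'a
  proof -
    define r where "r = norm w"
    have r: "r \<ge> 0" by (simp add: r_def)
    have "ln ((1 + 2 * r) / k) \<le> (1 + 2 * r) / k - 1"
      using r assms by (intro ln_le_minus_one) auto
    then have "k * ln (1 + 2 * r) \<le> 1 + 2 * r + k * ln k"
      using r assms by (simp add: ln_div field_simps)
    moreover have "2 * r - r\<^sup>2 / 2 \<le> 4 - r\<^sup>2 / 4"
      using zero_le_power2[of "r / 2 - 2"] by (simp add: power2_eq_square field_simps)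
    ultimately have "k * ln (1 + 2 * r) - r\<^sup>2 / 2 \<le> k * ln k + 5 - r\<^sup>2 / 4"
      by linarith
    then have "exp (k * ln (1 + 2 * r)) * exp (- (r\<^sup>2) / 2) \<le> C * exp (- (r\<^sup>2) / 4)"
      unfolding C_def mult_exp_exp by simp
    then have "(1 + 2 * r) powr k * exp (- (r\<^sup>2) / 2) \<le> C * exp (- (r\<^sup>2) / 4)"
      using r by (simp add: powr_def)
    then have "(2 * pi) powr (- real DIM('a) / 2) * ((1 + 2 * r) powr k * exp (- (r\<^sup>2) / 2)) \<le>
        (2 * pi) powr (- real DIM('a) / 2) * (C * exp (- (r\<^sup>2) / 4))"
      by (rule mult_left_mono) simp
    then show ?thesis
      by (simp add: maxwellian_def r_def power_mult_distrib power_inverse mult_ac)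
  qed
  then show ?thesis by (intro that[of C]) (simp_all add: C_def)
qed

lemma nn_integral_maxwellian_scaled_finite:
  "(\<integral>\<^sup>+w. ennreal (maxwellian ((w::'a::euclidean_space) /\<^sub>R sqrt 2)) \<partial>lborel) < \<infinity>"
  by (subst nn_integral_lborel_scale[of _ "sqrt 2"])
     (simp_all add: nn_integral_maxwellian ennreal_mult_less_top)

lemma nn_integral_maxwellian_poly_finite:
  assumes "k > 0"
  shows "(\<integral>\<^sup>+w. ennreal ((1 + 2 * norm w) powr k * maxwellian (w::'a::euclidean_space)) \<partial>lborel) < \<infinity>"
proof -
  obtain C where C: "C > 0" "\<And>w::'a. (1 + 2 * norm w) powr k * maxwellian w \<le> C * maxwellian (w /\<^sub>R sqrt 2)"
    using maxwellian_poly_le[OF assms, where 'a='a] by blast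
  have "(\<integral>\<^sup>+w. ennreal ((1 + 2 * norm w) powr k * maxwellian (w::'a)) \<partial>lborel) \<le>
    (\<integral>\<^sup>+w. ennreal C * ennreal (maxwellian ((w::'a) /\<^sub>R sqrt 2)) \<partial>lborel)"
    using C by (intro nn_integral_mono) (simp add: ennreal_mult'[symmetric] ennreal_leI)
  also have "\<dots> < \<infinity>"
    using nn_integral_maxwellian_scaled_finite[where 'a='a] by (simp add: nn_integral_cmult ennreal_mult_less_top)
  finally show ?thesis .
qed

section \<open>Velocity weights and the length of post-collisional velocities\<close>

lemma borel_measurable_bracket [measurable]: "bracket \<in> borel_measurable borel"
  unfolding bracket_def[abs_def] by measurable

lemma bracket_ge_1: "1 \<le> bracket v"
  by (simp add: bracket_def)

lemma bracket_neq_0 [simp]: "bracket v \<noteq> 0"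
  using bracket_ge_1[of v] by linarith

lemma norm_le_bracket: "norm v \<le> bracket v"
  unfolding bracket_def by (rule real_le_rsqrt) simp

lemma bracket_le: "bracket v \<le> 1 + norm v"
  unfolding bracket_def by (rule real_le_lsqrt) (auto simp: power2_sum)

text \<open>A small \<open>\<eta>\<close> brings the coefficient of \<open>x powr k\<close> close to
  1 at the price of a large one for \<open>y\<close>. The split at \<open>y = \<eta> * x\<close>
  works for \<open>k\<close> below 1 as well.\<close>

lemma powr_add_le:
  fixes x y \<eta> k :: real
  assumes "0 \<le> x" "0 \<le> y" "\<eta> > 0" "k > 0"
  shows "(x + y) powr k \<le> (1 + \<eta>) powr k * x powr k + (1 + 1 / \<eta>) powr k * y powr k"
proof (cases "y \<le> \<eta> * x")
  case True
  then have "(x + y) powr k \<le> ((1 + \<eta>) * x) powr k"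
    using assms by (intro powr_mono2) (auto simp: algebra_simps)
  then show ?thesis using assms by (simp add: powr_mult add_increasing2)
next
  case False
  then have "x \<le> y / \<eta>" using assms by (simp add: field_simps)
  then have "(x + y) powr k \<le> ((1 + 1 / \<eta>) * y) powr k"
    using assms by (intro powr_mono2) (auto simp: algebra_simps)
  then show ?thesis using assms by (simp add: powr_mult add_increasing)
qed

text \<open>The factor is \<open>cos (\<theta> / 2)\<close>: the sum of \<open>v - w\<close> and its
  scattered image has length \<open>2 * norm (v - w) * cos (\<theta> / 2)\<close>, and
  \<open>post v w \<omega>\<close> is \<open>w\<close> plus half of this sum.\<close>

lemma norm_post_le:
  fixes v w \<omega> :: "'a::euclidean_space"
  assumes "norm \<omega> = 1"
  shows "norm (post v w \<omega>) \<le> sqrt ((1 + sgn (v - w) \<bullet> \<omega>) / 2) * norm v + 2 * norm w"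
proof -
  define u where "u = v - w"
  define c where "c = sqrt ((1 + sgn u \<bullet> \<omega>) / 2)"
  have ab: "\<bar>sgn u \<bullet> \<omega>\<bar> \<le> 1"
    using Cauchy_Schwarz_ineq2[of "sgn u" \<omega>] assms by (auto simp: norm_sgn split: if_splits)
  then have c: "0 \<le> c" "c \<le> 1" by (auto simp: c_def)
  have u: "u = norm u *\<^sub>R sgn u" by (cases "u = 0") (simp_all add: sgn_div_norm)
  have un: "u \<bullet> u = (norm u)\<^sup>2" and oo: "\<omega> \<bullet> \<omega> = 1"
    using assms by (simp_all add: dot_square_norm)
  have c2: "c\<^sup>2 = (1 + sgn u \<bullet> \<omega>) / 2"
    using ab by (simp add: c_def)
  have uo: "u \<bullet> \<omega> = norm u * (sgn u \<bullet> \<omega>)" by (subst u) simp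
  have "(norm (u + norm u *\<^sub>R \<omega>))\<^sup>2 = (u + norm u *\<^sub>R \<omega>) \<bullet> (u + norm u *\<^sub>R \<omega>)"
    by (rule power2_norm_eq_inner)
  also have "\<dots> = 2 * (norm u)\<^sup>2 + 2 * norm u * (u \<bullet> \<omega>)"
    by (simp add: inner_add_left inner_add_right un oo inner_commute[of \<omega> u] power2_eq_square algebra_simps)
  also have "\<dots> = 4 * (norm u)\<^sup>2 * c\<^sup>2"
    unfolding uo c2 by (simp add: power2_eq_square algebra_simps)
  also have "\<dots> = (2 * norm u * c)\<^sup>2"
    by (simp add: power_mult_distrib)
  finally have "norm (u + norm u *\<^sub>R \<omega>) = 2 * norm u * c"
    using c by (simp add: power2_eq_iff_nonneg)
  moreover have "post v w \<omega> = w + (1/2) *\<^sub>R (u + norm u *\<^sub>R \<omega>)"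
  proof -
    have "(v + w) /\<^sub>R 2 = w + (1/2) *\<^sub>R u"
      by (rule euclidean_eqI) (simp add: u_def inner_simps field_simps)
    then show ?thesis by (simp add: post_def u_def scaleR_add_right)
  qed
  ultimately have "norm (post v w \<omega>) \<le> norm w + norm u * c"
    using norm_triangle_ineq[of w "(1/2) *\<^sub>R (u + norm u *\<^sub>R \<omega>)"] by simp
  also have "\<dots> \<le> norm w + (norm v + norm w) * c"
    using c norm_triangle_ineq4[of v w] by (intro add_left_mono mult_right_mono) (auto simp: u_def)
  also have "\<dots> \<le> c * norm v + 2 * norm w"
    using c mult_left_le[of c "norm w"] by (simp add: algebra_simps)
  finally show ?thesis by (simp add: c_def u_def)
qed

subsection \<open>The gain operator and its adjoint\<close>

locale soft_kernel =
  fixes \<gamma> :: real and b :: "real \<Rightarrow> real" and ty :: "'a::euclidean_space itself"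
  assumes gamma: "- real DIM('a) < \<gamma>" "\<gamma> < 0"
    and b_meas [measurable]: "b \<in> borel_measurable borel"
    and b_nonneg: "\<And>x. 0 \<le> b x"
    and b_even: "\<And>x. b (- x) = b x"
    and b_norm: "\<And>e::'a. norm e = 1 \<Longrightarrow> (\<integral>\<^sup>+\<omega>. ennreal (b (e \<bullet> \<omega>)) \<partial>usphere) = 1"
begin

definition kern :: "'a \<Rightarrow> 'a \<Rightarrow> 'a \<Rightarrow> ennreal" where
  "kern v w \<omega> = ennreal (norm (v - w) powr \<gamma> * b (sgn (v - w) \<bullet> \<omega>) * maxwellian w)"

text \<open>The adjoint of the gain operator; \<open>f \<mapsto> M * A (f / M)\<close> is the gain operator itself.\<close>

definition A :: "('a \<Rightarrow> ennreal) \<Rightarrow> 'a \<Rightarrow> ennreal" where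
  "A h v = (\<integral>\<^sup>+w. \<integral>\<^sup>+\<omega>. kern v w \<omega> * h (post v w \<omega>) \<partial>usphere \<partial>lborel)"

text \<open>The collision frequency, that is, the coefficient of the loss term.\<close>

definition sig :: "'a \<Rightarrow> ennreal" where
  "sig v = (\<integral>\<^sup>+w. ennreal (norm (v - w) powr \<gamma> * maxwellian w) \<partial>lborel)"

lemma measurable_kern [measurable]:
  assumes [measurable]: "f \<in> borel_measurable N" "g \<in> borel_measurable N" "h \<in> borel_measurable N"
  shows "(\<lambda>x. kern (f x) (g x) (h x)) \<in> borel_measurable N"
  unfolding kern_def by measurable

lemma measurable_post [measurable]:
  assumes [measurable]: "f \<in> borel_measurable N" "g \<in> borel_measurable N" "h \<in> borel_measurable N"
  shows "(\<lambda>x. post (f x :: 'a) (g x) (h x)) \<in> borel_measurable N"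
  unfolding post_def by measurable

lemma measurable_A [measurable]:
  assumes [measurable]: "h \<in> borel_measurable borel"
  shows "A h \<in> borel_measurable borel"
  unfolding A_def[abs_def] by measurable

lemma measurable_sig [measurable]: "sig \<in> borel_measurable borel"
  unfolding sig_def[abs_def] by measurable

lemma kern_eq: "kern v w \<omega> = ennreal (norm (v - w) powr \<gamma> * maxwellian w) * ennreal (b (sgn (v - w) \<bullet> \<omega>))"
  unfolding kern_def
  by (simp add: ennreal_mult'[symmetric] b_nonneg maxwellian_pos less_imp_le mult_ac)

lemma integral_kern:
  "(\<integral>\<^sup>+\<omega>. kern v w \<omega> \<partial>usphere) = ennreal (norm (v - w) powr \<gamma> * maxwellian w)"
proof (cases "v = w")
  case False
  then show ?thesis
    using b_norm[of "sgn (v - w)"] by (simp add: kern_eq nn_integral_cmult norm_sgn)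
qed (simp add: kern_def)

lemma A_one: "A (\<lambda>_. 1) v = sig v"
  by (simp add: A_def sig_def integral_kern)

section \<open>Angular averages of the even kernel\<close>

lemma nn_integral_b_symmetrize:
  fixes e :: 'a and F :: "real \<Rightarrow> ennreal"
  assumes [measurable]: "F \<in> borel_measurable borel"
  shows "2 * (\<integral>\<^sup>+\<omega>. ennreal (b (e \<bullet> \<omega>)) * F (e \<bullet> \<omega>) \<partial>usphere) =
    (\<integral>\<^sup>+\<omega>. ennreal (b (e \<bullet> \<omega>)) * (F (e \<bullet> \<omega>) + F (- (e \<bullet> \<omega>))) \<partial>usphere)"
proof -
  have "orthogonal_transformation (uminus :: 'a \<Rightarrow> 'a)"
    by (simp add: orthogonal_transformation_def linear_iff)
  from nn_integral_usphere_orthogonal[OF this, of "\<lambda>\<omega>. ennreal (b (e \<bullet> \<omega>)) * F (e \<bullet> \<omega>)"]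
  have "(\<integral>\<^sup>+\<omega>. ennreal (b (e \<bullet> \<omega>)) * F (- (e \<bullet> \<omega>)) \<partial>usphere) =
      (\<integral>\<^sup>+\<omega>. ennreal (b (e \<bullet> \<omega>)) * F (e \<bullet> \<omega>) \<partial>usphere)"
    by (simp add: b_even)
  then show ?thesis
    by (simp add: distrib_left nn_integral_add mult_2)
qed

lemma AE_usphere_inner_le: "AE \<omega> in usphere. \<bar>e \<bullet> \<omega>\<bar> \<le> 1" if "norm (e::'a) = 1"
  using AE_usphere[where 'a='a] by eventually_elim (metis Cauchy_Schwarz_ineq2 mult_1 that)

text \<open>Since \<open>b\<close> is even, the two closed hemispheres carry equal mass, and they
  cover the sphere. The shared equator makes this an inequality.\<close>

lemma nn_integral_b_half_le:
  assumes e: "norm (e::'a) = 1"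
  shows "1 / 2 \<le> (\<integral>\<^sup>+\<omega>. ennreal (b (e \<bullet> \<omega>)) * indicator {..0} (e \<bullet> \<omega>) \<partial>usphere)"
proof -
  have "1 = (\<integral>\<^sup>+\<omega>. ennreal (b (e \<bullet> \<omega>)) \<partial>usphere)"
    using b_norm[OF e] by simp
  also have "\<dots> \<le> (\<integral>\<^sup>+\<omega>. ennreal (b (e \<bullet> \<omega>)) * (indicator {..0} (e \<bullet> \<omega>) + indicator {..0} (- (e \<bullet> \<omega>))) \<partial>usphere)"
  proof (rule nn_integral_mono)
    fix \<omega>
    have "(1::ennreal) \<le> indicator {..0} (e \<bullet> \<omega>) + indicator {..0} (- (e \<bullet> \<omega>))"
      by (auto simp: indicator_def)
    from mult_left_mono[OF this, of "ennreal (b (e \<bullet> \<omega>))"]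
    show "ennreal (b (e \<bullet> \<omega>)) \<le> ennreal (b (e \<bullet> \<omega>)) * (indicator {..0} (e \<bullet> \<omega>) + indicator {..0} (- (e \<bullet> \<omega>)))"
      by simp
  qed
  also have "\<dots> = 2 * (\<integral>\<^sup>+\<omega>. ennreal (b (e \<bullet> \<omega>)) * indicator {..0} (e \<bullet> \<omega>) \<partial>usphere)"
    by (rule nn_integral_b_symmetrize[symmetric]) measurable
  finally show ?thesis
    by (subst divide_le_posI_ennreal) auto
qed

text \<open>Of the angles \<open>\<theta>\<close> and \<open>\<pi> - \<theta>\<close>, one has the
  cosine of its half at most \<open>sqrt (1/2)\<close> and the other at most 1. The average is
  therefore strictly below 1, which is the source of the drift.\<close>

lemma nn_integral_b_cos_half_le:
  assumes e: "norm (e::'a) = 1" and k: "k > 0"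
  shows "(\<integral>\<^sup>+\<omega>. ennreal (b (e \<bullet> \<omega>)) * ennreal (sqrt ((1 + e \<bullet> \<omega>) / 2) powr k) \<partial>usphere)
    \<le> ennreal ((1 + (1/2) powr (k/2)) / 2)"
proof -
  define F where "F x = sqrt ((1 + x) / 2) powr k" for x
  have F: "F x + F (- x) \<le> 1 + (1/2) powr (k/2)" if "\<bar>x\<bar> \<le> 1" for x
  proof -
    have le1: "F y \<le> 1" if "\<bar>y\<bar> \<le> 1" for y
      using that k unfolding F_def by (intro powr_le1) auto
    have le2: "F y \<le> (1/2) powr (k/2)" if "\<bar>y\<bar> \<le> 1" "y \<le> 0" for y
    proof -
      have "F y \<le> sqrt (1/2) powr k"
        using that k unfolding F_def by (intro powr_mono2 real_sqrt_le_mono) auto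
      also have "\<dots> = (1/2) powr (k/2)"
        by (subst powr_half_sqrt[symmetric]) (simp_all add: powr_powr)
      finally show ?thesis .
    qed
    show ?thesis
      using le1[of x] le1[of "-x"] le2[of x] le2[of "-x"] that by (cases "x \<le> 0") auto
  qed
  have [measurable]: "F \<in> borel_measurable borel" unfolding F_def by measurable
  have Fn: "F x \<ge> 0" for x by (simp add: F_def)
  have "2 * (\<integral>\<^sup>+\<omega>. ennreal (b (e \<bullet> \<omega>)) * ennreal (F (e \<bullet> \<omega>)) \<partial>usphere) =
      (\<integral>\<^sup>+\<omega>. ennreal (b (e \<bullet> \<omega>)) * (ennreal (F (e \<bullet> \<omega>)) + ennreal (F (- (e \<bullet> \<omega>)))) \<partial>usphere)"
    by (rule nn_integral_b_symmetrize) measurable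
  also have "\<dots> \<le> (\<integral>\<^sup>+\<omega>. ennreal (b (e \<bullet> \<omega>)) * ennreal (1 + (1/2) powr (k/2)) \<partial>usphere)"
  proof (rule nn_integral_mono_AE, rule AE_mp[OF AE_usphere_inner_le[OF e]], rule AE_I2, rule impI)
    fix \<omega> assume "\<bar>e \<bullet> \<omega>\<bar> \<le> 1"
    then show "ennreal (b (e \<bullet> \<omega>)) * (ennreal (F (e \<bullet> \<omega>)) + ennreal (F (- (e \<bullet> \<omega>)))) \<le>
        ennreal (b (e \<bullet> \<omega>)) * ennreal (1 + (1/2) powr (k/2))"
      using F[of "e \<bullet> \<omega>"] Fn by (intro mult_left_mono) (auto simp: ennreal_plus[symmetric] simp del: ennreal_plus intro: ennreal_leI)
  qed
  also have "\<dots> = ennreal (1 + (1/2) powr (k/2))"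
    using b_norm[OF e] by (simp add: nn_integral_multc)
  finally have "2 * (\<integral>\<^sup>+\<omega>. ennreal (b (e \<bullet> \<omega>)) * ennreal (F (e \<bullet> \<omega>)) \<partial>usphere) \<le>
      ennreal (1 + (1/2) powr (k/2))" .
  also have "\<dots> = 2 * ennreal ((1 + (1/2) powr (k/2)) / 2)"
  proof -
    have "ennreal y = 2 * ennreal (y / 2)" if "y \<ge> 0" for y
      using ennreal_mult[of 2 "y / 2"] that by simp
    from this[of "1 + (1/2) powr (k/2)"] show ?thesis by (simp del: ennreal_plus)
  qed
  finally show ?thesis
    unfolding F_def by (subst (asm) ennreal_mult_le_mult_iff) auto
qed


text \<open>Detailed balance. In the coordinates \<open>x = (v + w) / 2\<close> and
  \<open>u = v - w\<close>, the product of Maxwellians depends on \<open>norm x\<close> and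
  \<open>norm u\<close> alone and the kernel is symmetric in \<open>sgn u\<close> and
  \<open>\<omega>\<close>; exchanging these two directions exchanges \<open>\<phi>\<close> and
  \<open>h\<close>.\<close>

lemma A_reversible:
  assumes [measurable]: "\<phi> \<in> borel_measurable borel" "h \<in> borel_measurable borel"
  shows "(\<integral>\<^sup>+v. ennreal (maxwellian v) * \<phi> v * A h v \<partial>lborel) =
    (\<integral>\<^sup>+v. ennreal (maxwellian v) * h v * A \<phi> v \<partial>lborel)"
proof -
  define G where "G \<phi> h x u \<omega> =
      ennreal (norm u powr \<gamma> * b (sgn u \<bullet> \<omega>) * (maxwellian (x + u /\<^sub>R 2) * maxwellian (x - u /\<^sub>R 2))) *
        (\<phi> (x + u /\<^sub>R 2) * h (x + (norm u / 2) *\<^sub>R \<omega>))"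
    for \<phi> h :: "'a \<Rightarrow> ennreal" and x u \<omega> :: 'a
  define J where "J \<phi> h = (\<integral>\<^sup>+x. \<integral>\<^sup>+u. \<integral>\<^sup>+\<omega>. G \<phi> h x u \<omega> \<partial>usphere \<partial>lborel \<partial>lborel)"
    for \<phi> h :: "'a \<Rightarrow> ennreal"
  have GM [measurable]: "(\<lambda>y. G \<phi> h (f1 y) (f2 y) (f3 y)) \<in> borel_measurable N"
    if [measurable]: "\<phi> \<in> borel_measurable borel" "h \<in> borel_measurable borel"
      "f1 \<in> borel_measurable N" "f2 \<in> borel_measurable N" "f3 \<in> borel_measurable N"
    for \<phi> h f1 f2 f3 and N :: "'x measure"
    unfolding G_def by measurable
  have eq: "(\<integral>\<^sup>+v. ennreal (maxwellian v) * \<phi> v * A h v \<partial>lborel) = J \<phi> h"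
    if [measurable]: "\<phi> \<in> borel_measurable borel" "h \<in> borel_measurable borel" for \<phi> h
  proof -
    define F where "F v w = (\<integral>\<^sup>+\<omega>. ennreal (maxwellian v) * \<phi> v * (kern v w \<omega> * h (post v w \<omega>)) \<partial>usphere)" for v w
    have [measurable]: "(\<lambda>y. F (f1 y) (f2 y)) \<in> borel_measurable N"
      if [measurable]: "f1 \<in> borel_measurable N" "f2 \<in> borel_measurable N"
      for f1 f2 and N :: "'x measure"
      unfolding F_def by measurable
    have "(\<integral>\<^sup>+v. ennreal (maxwellian v) * \<phi> v * A h v \<partial>lborel) = (\<integral>\<^sup>+v. \<integral>\<^sup>+w. F v w \<partial>lborel \<partial>lborel)"
      unfolding A_def F_def by (simp add: nn_integral_cmult)
    also have "\<dots> = (\<integral>\<^sup>+v. \<integral>\<^sup>+u. F v (v - u) \<partial>lborel \<partial>lborel)"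
      by (intro nn_integral_cong nn_integral_lborel_shift(2)[symmetric]) measurable
    also have "\<dots> = (\<integral>\<^sup>+u. \<integral>\<^sup>+v. F v (v - u) \<partial>lborel \<partial>lborel)"
      by (rule lborel_pair.Fubini') measurable
    also have "\<dots> = (\<integral>\<^sup>+u. \<integral>\<^sup>+x. F (u /\<^sub>R 2 + x) (u /\<^sub>R 2 + x - u) \<partial>lborel \<partial>lborel)"
      by (intro nn_integral_cong nn_integral_lborel_shift(1)[of "\<lambda>v. F v (v - u)" "u /\<^sub>R 2" for u, symmetric]) measurable
    also have "\<dots> = (\<integral>\<^sup>+x. \<integral>\<^sup>+u. F (u /\<^sub>R 2 + x) (u /\<^sub>R 2 + x - u) \<partial>lborel \<partial>lborel)"
      by (rule lborel_pair.Fubini'[symmetric]) measurable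
    also have "\<dots> = J \<phi> h"
      unfolding J_def
    proof (intro nn_integral_cong)
      fix x u :: 'a
      define v where "v = u /\<^sub>R 2 + x"
      have 1: "v - (v - u) = u" "v = x + u /\<^sub>R 2" by (simp_all add: v_def)
      have 2: "v - u = x - u /\<^sub>R 2"
        by (rule euclidean_eqI) (simp add: v_def inner_simps field_simps)
      have 3: "post v (v - u) \<omega> = x + (norm u / 2) *\<^sub>R \<omega>" for \<omega>
      proof -
        have "(v + (v - u)) /\<^sub>R 2 = x"
          by (rule euclidean_eqI) (simp add: v_def inner_simps field_simps)
        then show ?thesis by (simp add: post_def)
      qed
      have "ennreal (maxwellian v) * \<phi> v * (kern v (v - u) \<omega> * h (post v (v - u) \<omega>)) = G \<phi> h x u \<omega>" for \<omega>
        unfolding kern_def G_def 3 unfolding 1(1) unfolding 2 unfolding 1(2)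
        by (simp add: ennreal_mult' b_nonneg maxwellian_pos less_imp_le mult_ac)
      then show "F (u /\<^sub>R 2 + x) (u /\<^sub>R 2 + x - u) = (\<integral>\<^sup>+\<omega>. G \<phi> h x u \<omega> \<partial>usphere)"
        unfolding F_def v_def by simp
    qed
    finally show ?thesis .
  qed
  have "J \<phi> h = J h \<phi>"
    unfolding J_def
  proof (rule nn_integral_cong)
    fix x :: 'a
    have "(\<integral>\<^sup>+u. \<integral>\<^sup>+\<omega>. G \<phi> h x u \<omega> \<partial>usphere \<partial>lborel) =
        (\<integral>\<^sup>+u. \<integral>\<^sup>+\<omega>. G \<phi> h x (norm u *\<^sub>R \<omega>) (sgn u) \<partial>usphere \<partial>lborel)"
      by (rule nn_integral_swap_direction[symmetric]) measurable
    also have "\<dots> = (\<integral>\<^sup>+u. \<integral>\<^sup>+\<omega>. G h \<phi> x u \<omega> \<partial>usphere \<partial>lborel)"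
    proof (rule nn_integral_lborel_cong_except[of 0])
      fix u :: 'a assume u: "u \<noteq> 0"
      show "(\<integral>\<^sup>+\<omega>. G \<phi> h x (norm u *\<^sub>R \<omega>) (sgn u) \<partial>usphere) = (\<integral>\<^sup>+\<omega>. G h \<phi> x u \<omega> \<partial>usphere)"
      proof (rule nn_integral_usphere_cong)
        fix \<omega> :: 'a assume o: "norm \<omega> = 1"
        have s: "sgn (norm u *\<^sub>R \<omega>) = \<omega>" "norm (norm u *\<^sub>R \<omega>) = norm u"
          using u o by (simp_all add: sgn_div_norm)
        have s2: "(norm u / 2) *\<^sub>R sgn u = u /\<^sub>R 2" "(norm u *\<^sub>R \<omega>) /\<^sub>R 2 = (norm u / 2) *\<^sub>R \<omega>"
          using u by (simp_all add: sgn_div_norm field_simps)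
        have mm: "maxwellian (x + y) * maxwellian (x - y) =
            (2 * pi) powr (- real DIM('a) / 2) * (2 * pi) powr (- real DIM('a) / 2) * exp (- ((norm x)\<^sup>2 + (norm y)\<^sup>2))" for y :: 'a
        proof -
          have "- (norm (x + y))\<^sup>2 / 2 + - (norm (x - y))\<^sup>2 / 2 = - ((norm x)\<^sup>2 + (norm y)\<^sup>2)"
            by (simp add: power2_norm_eq_inner inner_simps inner_commute field_simps)
          then have "exp (- (norm (x + y))\<^sup>2 / 2) * exp (- (norm (x - y))\<^sup>2 / 2) = exp (- ((norm x)\<^sup>2 + (norm y)\<^sup>2))"
            by (simp only: mult_exp_exp)
          then show ?thesis by (simp add: maxwellian_def mult_ac)
        qed
        have "maxwellian (x + (norm u / 2) *\<^sub>R \<omega>) * maxwellian (x - (norm u / 2) *\<^sub>R \<omega>) =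
            maxwellian (x + u /\<^sub>R 2) * maxwellian (x - u /\<^sub>R 2)"
          unfolding mm using o by simp
        then show "G \<phi> h x (norm u *\<^sub>R \<omega>) (sgn u) = G h \<phi> x u \<omega>"
          unfolding G_def s s2 by (simp add: inner_commute mult.commute)
      qed
    qed
    finally show "(\<integral>\<^sup>+u. \<integral>\<^sup>+\<omega>. G \<phi> h x u \<omega> \<partial>usphere \<partial>lborel) =
        (\<integral>\<^sup>+u. \<integral>\<^sup>+\<omega>. G h \<phi> x u \<omega> \<partial>usphere \<partial>lborel)" .
  qed
  then show ?thesis by (simp add: eq)
qed

section \<open>Collision frequency, drift condition and lower bound of the adjoint\<close>

lemma sig_bounded: obtains S where "S > 0" "\<And>v. sig v \<le> ennreal S"
proof -
  let ?I = "(\<integral>\<^sup>+x. ennreal (norm (x::'a) powr \<gamma>) * indicator (ball 0 1) x \<partial>lborel)"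
  have "?I < \<infinity>"
    using nn_integral_riesz_ball_finite[of \<gamma>, where 'a='a] gamma by simp
  then obtain c where c: "?I = ennreal c" "c \<ge> 0"
    using less_top_ennreal[of ?I] by auto
  have "sig v \<le> ennreal (c + 1)" for v
  proof -
    have "sig v = (\<integral>\<^sup>+w. ennreal (norm (v - w) powr \<gamma>) * ennreal (maxwellian w) \<partial>lborel)"
      by (simp add: sig_def ennreal_mult' maxwellian_pos less_imp_le)
    also have "\<dots> \<le> 1 * ?I + (\<integral>\<^sup>+w. ennreal (maxwellian (w::'a)) \<partial>lborel)"
      using gamma by (intro nn_integral_riesz_convolution_le) (auto simp: maxwellian_le_1)
    finally show ?thesis
      using c by (simp add: nn_integral_maxwellian)
  qed
  then show ?thesis using c by (intro that[of "c + 1"]) auto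
qed

text \<open>Velocities \<open>w\<close> in the unit ball suffice: there
  \<open>norm (v - w) \<le> 2 * bracket v\<close> and the Maxwellian is at least
  \<open>m\<close>.\<close>

lemma sig_lower: obtains c where "c > 0" "\<And>v. ennreal (c * bracket v powr \<gamma>) \<le> sig v"
proof -
  define m where "m = (2 * pi) powr (- real DIM('a) / 2) * exp (- 1 / 2)"
  define V where "V = unit_ball_vol (real DIM('a))"
  define c where "c = 2 powr \<gamma> * m * V"
  have c: "c > 0" "m > 0" "V > 0" by (simp_all add: c_def m_def V_def)
  have "ennreal (c * bracket v powr \<gamma>) \<le> sig v" for v
  proof -
    have "ennreal (c * bracket v powr \<gamma>) = ennreal ((2 * bracket v) powr \<gamma> * m) * ennreal V"
      using c bracket_ge_1[of v] by (simp add: c_def ennreal_mult'[symmetric] powr_mult mult_ac)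
    also have "ennreal V = emeasure lborel (ball (0::'a) 1)"
      by (simp add: emeasure_ball V_def)
    also have "ennreal ((2 * bracket v) powr \<gamma> * m) * \<dots> =
        (\<integral>\<^sup>+w. ennreal ((2 * bracket v) powr \<gamma> * m) * indicator (ball 0 1) (w::'a) \<partial>lborel)"
      by (simp add: nn_integral_cmult)
    also have "\<dots> \<le> sig v"
      unfolding sig_def
    \<comment> \<open>At \<open>w = v\<close> the power with exponent \<open>\<gamma>\<close> is 0
      by convention, so the pointwise bound can fail there.\<close>
    proof (rule nn_integral_lborel_mono_except[of v])
      fix w :: 'a assume w: "w \<noteq> v"
      show "ennreal ((2 * bracket v) powr \<gamma> * m) * indicator (ball 0 1) w \<le> ennreal (norm (v - w) powr \<gamma> * maxwellian w)"
      proof (cases "norm w < 1")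
        case True
        have "norm (v - w) \<le> norm v + norm w" by (rule norm_triangle_ineq4)
        also have "\<dots> \<le> 2 * bracket v"
          using True norm_le_bracket[of v] bracket_ge_1[of v] by linarith
        finally have 1: "(2 * bracket v) powr \<gamma> \<le> norm (v - w) powr \<gamma>"
          using gamma w by (intro powr_mono2') auto
        have 2: "m \<le> maxwellian w"
          using True by (simp add: m_def maxwellian_def power_le_one)
        show ?thesis
          using mult_mono[OF 1 2] c True by (simp add: ennreal_leI)
      qed simp
    qed
    finally show ?thesis .
  qed
  with c show ?thesis by (intro that)
qed

text \<open>The part of the post-collisional weight that carries \<open>bracket v\<close> contracts
  by the angular average, so it recovers only the fraction \<open>1 - \<delta>\<close> of the loss
  \<open>sig v * bracket v powr k\<close>. The part that carries \<open>w\<close> is a Riesz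
  convolution of a polynomially weighted Gaussian, bounded uniformly in \<open>v\<close>.\<close>

lemma A_bracket_le:
  assumes k: "k > 0"
  obtains \<delta> C where "\<delta> > 0" "\<delta> < 1" "C > 0"
    "\<And>v. A (\<lambda>x. ennreal (bracket x powr k)) v \<le> ennreal ((1 - \<delta>) * bracket v powr k) * sig v + ennreal C"
proof -
  define \<kappa> where "\<kappa> = (1 + (1/2) powr (k/2)) / (2::real)"
  have half: "(1/2) powr (k/2) < (1::real)" "(1/2) powr (k/2) > (0::real)"
    using k powr_less_mono2[of "k/2" "1/2" 1] by auto
  have \<kappa>: "0 < \<kappa>" "\<kappa> < 1" using half by (auto simp: \<kappa>_def add_pos_pos)
  \<comment> \<open>Chosen so that \<open>(1 + \<eta>) powr k * \<kappa> = sqrt \<kappa>\<close>: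
    splitting the sum costs a square root of the contraction factor, and
    \<open>\<delta> = 1 - sqrt \<kappa>\<close> remains.\<close>
  define \<eta> where "\<eta> = \<kappa> powr (- (1 / (2 * k))) - 1"
  have "1 powr (- (1 / (2 * k))) < \<kappa> powr (- (1 / (2 * k)))"
    using \<kappa> k by (intro powr_less_mono2_neg) auto
  then have \<eta>: "\<eta> > 0" by (simp add: \<eta>_def)
  have \<eta>\<kappa>: "(1 + \<eta>) powr k * \<kappa> = sqrt \<kappa>"
  proof -
    have "(1 + \<eta>) powr k = \<kappa> powr (- (1/2))"
      using k by (simp add: \<eta>_def powr_powr)
    then have "(1 + \<eta>) powr k * \<kappa> = \<kappa> powr (- (1/2)) * \<kappa> powr 1" using \<kappa> by simp
    also have "\<dots> = \<kappa> powr (1/2)" by (simp only: powr_add[symmetric]) simp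
    finally show ?thesis using \<kappa> by (simp add: powr_half_sqrt)
  qed
  define D where "D = (1 + 1 / \<eta>) powr k"
  have D: "D > 0" using add_pos_pos[of 1 "1 / \<eta>"] \<eta> by (simp add: D_def)
  obtain C1 where C1: "C1 > 0" "\<And>w::'a. (1 + 2 * norm w) powr k * maxwellian w \<le> C1 * maxwellian (w /\<^sub>R sqrt 2)"
    using maxwellian_poly_le[OF k, where 'a='a] by blast
  let ?I = "(\<integral>\<^sup>+x. ennreal (norm (x::'a) powr \<gamma>) * indicator (ball 0 1) x \<partial>lborel)"
  define g where "g w = ennreal ((1 + 2 * norm w) powr k * maxwellian w)" for w :: 'a
  have [measurable]: "g \<in> borel_measurable borel" unfolding g_def[abs_def] by measurable
  have gC: "g w \<le> ennreal C1" for w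
  proof -
    have "C1 * maxwellian (w /\<^sub>R sqrt 2) \<le> C1 * 1"
      using C1 maxwellian_le_1 by (intro mult_left_mono) auto
    then show ?thesis unfolding g_def using C1(2)[of w] by (intro ennreal_leI) simp
  qed
  define E where "E = ennreal C1 * ?I + (\<integral>\<^sup>+w. g w \<partial>lborel)"
  have "E < \<infinity>"
    unfolding E_def g_def
    using nn_integral_maxwellian_poly_finite[OF k, where 'a='a]
      nn_integral_riesz_ball_finite[of \<gamma>, where 'a='a] gamma
    by (simp add: ennreal_mult_less_top)
  then obtain E' where E': "E = ennreal E'" "E' \<ge> 0"
    by (metis ennreal_cases infinity_ennreal_def less_irrefl)
  have main: "A (\<lambda>x. ennreal (bracket x powr k)) v \<le> ennreal (sqrt \<kappa> * bracket v powr k) * sig v + ennreal (D * E' + 1)" for v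
  proof -
    have bd: "(\<integral>\<^sup>+\<omega>. kern v w \<omega> * ennreal (bracket (post v w \<omega>) powr k) \<partial>usphere) \<le>
        ennreal (sqrt \<kappa> * bracket v powr k) * ennreal (norm (v - w) powr \<gamma> * maxwellian w) +
        ennreal D * (ennreal (norm (v - w) powr \<gamma>) * g w)" for w
    proof (cases "v = w")
      case False
      define e where "e = sgn (v - w)"
      have e: "norm e = 1" using False by (simp add: e_def norm_sgn)
      define K where "K = ennreal (norm (v - w) powr \<gamma> * maxwellian w)"
      define B where "B \<omega> = ennreal (b (e \<bullet> \<omega>))" for \<omega>
      define c where "c \<omega> = sqrt ((1 + e \<bullet> \<omega>) / 2)" for \<omega>
      have [measurable]: "B \<in> borel_measurable borel" "c \<in> borel_measurable borel"
        unfolding B_def[abs_def] c_def[abs_def] by measurable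
      have pt: "ennreal (bracket (post v w \<omega>) powr k) \<le>
          ennreal ((1 + \<eta>) powr k * bracket v powr k) * ennreal (c \<omega> powr k) + ennreal (D * (1 + 2 * norm w) powr k)"
        if o: "norm \<omega> = 1" for \<omega>
      proof -
        have "\<bar>e \<bullet> \<omega>\<bar> \<le> 1" using Cauchy_Schwarz_ineq2[of e \<omega>] e o by simp
        then have c0: "0 \<le> c \<omega>" by (simp add: c_def)
        have "bracket (post v w \<omega>) \<le> 1 + norm (post v w \<omega>)" by (rule bracket_le)
        also have "\<dots> \<le> c \<omega> * norm v + (1 + 2 * norm w)"
          using norm_post_le[OF o, of v w] by (simp add: c_def e_def)
        also have "\<dots> \<le> c \<omega> * bracket v + (1 + 2 * norm w)"
          using c0 norm_le_bracket[of v] by (simp add: mult_left_mono)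
        finally have "bracket (post v w \<omega>) powr k \<le> (c \<omega> * bracket v + (1 + 2 * norm w)) powr k"
          using k bracket_ge_1[of "post v w \<omega>"] by (intro powr_mono2) auto
        also have "\<dots> \<le> (1 + \<eta>) powr k * (c \<omega> * bracket v) powr k + D * (1 + 2 * norm w) powr k"
          unfolding D_def using c0 \<eta> k bracket_ge_1[of v] by (intro powr_add_le) auto
        also have "(c \<omega> * bracket v) powr k = c \<omega> powr k * bracket v powr k"
          by (rule powr_mult)
        finally have "bracket (post v w \<omega>) powr k \<le>
            (1 + \<eta>) powr k * bracket v powr k * c \<omega> powr k + D * (1 + 2 * norm w) powr k"
          by (simp add: mult_ac)
        then have "ennreal (bracket (post v w \<omega>) powr k) \<le>
            ennreal ((1 + \<eta>) powr k * bracket v powr k * c \<omega> powr k + D * (1 + 2 * norm w) powr k)"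
          by (rule ennreal_leI)
        then show ?thesis
          using D by (simp add: ennreal_mult'[symmetric] ennreal_plus[symmetric] del: ennreal_plus)
      qed
      have "(\<integral>\<^sup>+\<omega>. kern v w \<omega> * ennreal (bracket (post v w \<omega>) powr k) \<partial>usphere) \<le>
        (\<integral>\<^sup>+\<omega>. K * (ennreal ((1 + \<eta>) powr k * bracket v powr k) * (B \<omega> * ennreal (c \<omega> powr k)) +
           ennreal (D * (1 + 2 * norm w) powr k) * B \<omega>) \<partial>usphere)"
      proof (rule nn_integral_usphere_mono)
        fix \<omega> :: 'a assume o: "norm \<omega> = 1"
        have "kern v w \<omega> * ennreal (bracket (post v w \<omega>) powr k) \<le> K * B \<omega> *
          (ennreal ((1 + \<eta>) powr k * bracket v powr k) * ennreal (c \<omega> powr k) + ennreal (D * (1 + 2 * norm w) powr k))"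
          unfolding kern_eq K_def B_def e_def[symmetric] by (intro mult_left_mono pt o) simp
        then show "kern v w \<omega> * ennreal (bracket (post v w \<omega>) powr k) \<le>
          K * (ennreal ((1 + \<eta>) powr k * bracket v powr k) * (B \<omega> * ennreal (c \<omega> powr k)) +
           ennreal (D * (1 + 2 * norm w) powr k) * B \<omega>)"
          by (simp add: distrib_left mult_ac)
      qed
      also have "\<dots> = K * (ennreal ((1 + \<eta>) powr k * bracket v powr k) * (\<integral>\<^sup>+\<omega>. B \<omega> * ennreal (c \<omega> powr k) \<partial>usphere) +
           ennreal (D * (1 + 2 * norm w) powr k) * (\<integral>\<^sup>+\<omega>. B \<omega> \<partial>usphere))"
        by (subst nn_integral_cmult, measurable, subst nn_integral_add, measurable) (simp add: nn_integral_cmult)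
      also have "\<dots> \<le> K * (ennreal ((1 + \<eta>) powr k * bracket v powr k) * ennreal \<kappa> +
           ennreal (D * (1 + 2 * norm w) powr k) * 1)"
        using nn_integral_b_cos_half_le[OF e k] b_norm[OF e]
        by (intro mult_left_mono add_mono) (simp_all add: B_def c_def \<kappa>_def)
      also have "ennreal ((1 + \<eta>) powr k * bracket v powr k) * ennreal \<kappa> = ennreal (sqrt \<kappa> * bracket v powr k)"
        using \<kappa> \<eta>\<kappa> by (simp add: ennreal_mult'[symmetric] mult_ac)
      also have "K * (ennreal (sqrt \<kappa> * bracket v powr k) + ennreal (D * (1 + 2 * norm w) powr k) * 1) =
          ennreal (sqrt \<kappa> * bracket v powr k) * ennreal (norm (v - w) powr \<gamma> * maxwellian w) +
          ennreal D * (ennreal (norm (v - w) powr \<gamma>) * g w)"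
        using D maxwellian_pos[of w]
        by (simp add: K_def g_def distrib_left ennreal_mult'[symmetric] mult_ac)
      finally show ?thesis .
    qed (simp add: kern_def)
    have "A (\<lambda>x. ennreal (bracket x powr k)) v \<le>
        (\<integral>\<^sup>+w. ennreal (sqrt \<kappa> * bracket v powr k) * ennreal (norm (v - w) powr \<gamma> * maxwellian w) +
          ennreal D * (ennreal (norm (v - w) powr \<gamma>) * g w) \<partial>lborel)"
      unfolding A_def by (rule nn_integral_mono) (rule bd)
    also have "\<dots> = ennreal (sqrt \<kappa> * bracket v powr k) * sig v +
        ennreal D * (\<integral>\<^sup>+w. ennreal (norm (v - w) powr \<gamma>) * g w \<partial>lborel)"
      unfolding sig_def by (subst nn_integral_add, measurable) (simp add: nn_integral_cmult)
    also have "\<dots> \<le> ennreal (sqrt \<kappa> * bracket v powr k) * sig v + ennreal D * E"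
      unfolding E_def using gamma
      by (intro add_left_mono mult_left_mono nn_integral_riesz_convolution_le gC) auto
    also have "\<dots> \<le> ennreal (sqrt \<kappa> * bracket v powr k) * sig v + ennreal (D * E' + 1)"
      using D E' by (intro add_left_mono) (simp add: ennreal_mult'[symmetric] ennreal_leI)
    finally show ?thesis .
  qed
  have "sqrt \<kappa> < 1" "sqrt \<kappa> > 0" using \<kappa> by auto
  then show ?thesis
    using main D E' by (intro that[of "1 - sqrt \<kappa>" "D * E' + 1"]) (auto simp: add_nonneg_pos)
qed


text \<open>
  For fixed \<open>u\<close> the increment \<open>(\<bar>u\<bar>\<omega> - u) / 2\<close> has a singular law; only after integration over \<open>u\<close>
  is there a density, and rotation invariance makes it computable for every kernel \<open>b\<close>. Only
  the half \<open>cos \<theta> \<le> 0\<close> of the kernel is used, where the increment is at least \<open>\<bar>u\<bar> / sqrt 2\<close> long.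
\<close>

lemma nn_integral_increment_ge:
  fixes \<phi> :: "'a \<Rightarrow> ennreal"
  assumes [measurable]: "\<phi> \<in> borel_measurable borel" and T: "T > 0"
  shows "(\<integral>\<^sup>+y. indicator (cball 0 (T / sqrt 2)) y * \<phi> y \<partial>lborel) / 2 \<le>
    (\<integral>\<^sup>+u. \<integral>\<^sup>+\<omega>. indicator (cball 0 T) u * (ennreal (b (sgn u \<bullet> \<omega>)) * indicator {..0} (sgn u \<bullet> \<omega>)) *
        \<phi> ((1/2) *\<^sub>R (norm u *\<^sub>R \<omega> - u)) \<partial>usphere \<partial>lborel)"
proof -
  interpret us: pair_sigma_finite "usphere :: 'a measure" "usphere :: 'a measure" ..
  interpret lu: pair_sigma_finite "lborel :: 'a measure" "usphere :: 'a measure" ..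
  define s where "s = emeasure (usphere :: 'a measure) UNIV"
  have s: "s \<noteq> 0" "s \<noteq> top"
    unfolding s_def by (rule emeasure_usphere_neq)+
  have cball_borel [measurable]: "cball (0::'a) r \<in> sets borel" for r by simp
  define B where "B x = ennreal (b x) * indicator {..0} x" for x
  define I where "I = (indicator (cball 0 T) :: 'a \<Rightarrow> ennreal)"
  define D where "D u \<omega> = I u * B (sgn u \<bullet> \<omega>)" for u \<omega>
  define z :: "'a \<Rightarrow> 'a \<Rightarrow> 'a" where "z u \<omega> = (1/2) *\<^sub>R (norm u *\<^sub>R \<omega> - u)" for u \<omega>
  \<comment> \<open>This is \<open>sin (\<theta> / 2)\<close>, the ratio of the length of the
    increment to that of \<open>u\<close>. It is at least \<open>1 / sqrt 2\<close> for
    \<open>c \<le> 0\<close>.\<close>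
  define q where "q c = sqrt ((1 - c) / 2)" for c :: real
  have [measurable]: "B \<in> borel_measurable borel" unfolding B_def by measurable
  have [measurable]: "I \<in> borel_measurable borel" unfolding I_def by measurable
  have [measurable]: "q \<in> borel_measurable borel" unfolding q_def by measurable
  have Dm [measurable]: "(\<lambda>x. D (f x) (g x)) \<in> borel_measurable N"
    if [measurable]: "f \<in> borel_measurable N" "g \<in> borel_measurable N" for f g and N :: "'x measure"
    unfolding D_def by measurable
  have zm [measurable]: "(\<lambda>x. z (f x) (g x)) \<in> borel_measurable N"
    if [measurable]: "f \<in> borel_measurable N" "g \<in> borel_measurable N" for f g and N :: "'x measure"
    unfolding z_def by measurable
  have normz: "norm (z u \<omega>) = norm u * q (sgn u \<bullet> \<omega>)" if o: "norm \<omega> = 1" for u \<omega>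
  proof -
    have ab: "\<bar>sgn u \<bullet> \<omega>\<bar> \<le> 1"
      using Cauchy_Schwarz_ineq2[of "sgn u" \<omega>] o by (auto simp: norm_sgn split: if_splits)
    have u: "u = norm u *\<^sub>R sgn u" by (cases "u = 0") (simp_all add: sgn_div_norm)
    have un: "u \<bullet> u = (norm u)\<^sup>2" and oo: "\<omega> \<bullet> \<omega> = 1"
      using o by (simp_all add: dot_square_norm)
    have uo: "u \<bullet> \<omega> = norm u * (sgn u \<bullet> \<omega>)" by (subst u) simp
    have q2: "(q (sgn u \<bullet> \<omega>))\<^sup>2 = (1 - sgn u \<bullet> \<omega>) / 2" and q0: "0 \<le> q (sgn u \<bullet> \<omega>)"
      using ab by (auto simp: q_def)
    have "(norm (z u \<omega>))\<^sup>2 = z u \<omega> \<bullet> z u \<omega>"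
      by (rule power2_norm_eq_inner)
    also have "\<dots> = ((norm u)\<^sup>2 - norm u * (u \<bullet> \<omega>)) / 2"
      by (simp add: z_def inner_diff_left inner_diff_right un oo inner_commute[of \<omega> u] power2_eq_square algebra_simps)
    also have "\<dots> = (norm u)\<^sup>2 * (q (sgn u \<bullet> \<omega>))\<^sup>2"
      unfolding uo q2 by (simp add: power2_eq_square algebra_simps)
    also have "\<dots> = (norm u * q (sgn u \<bullet> \<omega>))\<^sup>2"
      by (simp add: power_mult_distrib)
    finally show ?thesis
      using q0 by (simp add: power2_eq_iff_nonneg)
  qed
  \<comment> \<open>The law of the increment under the weight \<open>D\<close>. It is finite and
    rotation invariant, so its direction may be resampled, although for fixed \<open>u\<close> the
    increment is confined to a sphere through 0.\<close>
  define \<mu> where "\<mu> = distr (density (lborel \<Otimes>\<^sub>M usphere) (\<lambda>(u, \<omega>). D u \<omega>)) borel (\<lambda>(u, \<omega>). z u \<omega>)"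
  have int_mu: "(\<integral>\<^sup>+y. F y \<partial>\<mu>) = (\<integral>\<^sup>+u. \<integral>\<^sup>+\<omega>. D u \<omega> * F (z u \<omega>) \<partial>usphere \<partial>lborel)"
    if [measurable]: "F \<in> borel_measurable borel" for F :: "'a \<Rightarrow> ennreal"
  proof -
    have m: "(\<lambda>(u, \<omega>). D u \<omega> * F (z u \<omega>)) \<in> borel_measurable (lborel \<Otimes>\<^sub>M usphere)"
      by measurable
    have "(\<integral>\<^sup>+y. F y \<partial>\<mu>) = (\<integral>\<^sup>+p. F (case p of (u, \<omega>) \<Rightarrow> z u \<omega>) \<partial>density (lborel \<Otimes>\<^sub>M usphere) (\<lambda>(u, \<omega>). D u \<omega>))"
      unfolding \<mu>_def by (rule nn_integral_distr) measurable
    also have "\<dots> = (\<integral>\<^sup>+p. (case p of (u, \<omega>) \<Rightarrow> D u \<omega>) * F (case p of (u, \<omega>) \<Rightarrow> z u \<omega>) \<partial>(lborel \<Otimes>\<^sub>M usphere))"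
      by (rule nn_integral_density) measurable
    also have "\<dots> = (\<integral>\<^sup>+u. \<integral>\<^sup>+\<omega>. D u \<omega> * F (z u \<omega>) \<partial>usphere \<partial>lborel)"
      using usphere.nn_integral_fst[OF m] by (simp add: case_prod_beta')
    finally show ?thesis .
  qed
  have avg: "s * (\<integral>\<^sup>+y. \<phi> y \<partial>\<mu>) = (\<integral>\<^sup>+y. \<integral>\<^sup>+x. \<phi> (norm y *\<^sub>R x) \<partial>usphere \<partial>\<mu>)"
    unfolding s_def
  proof (rule rotation_invariant_spherical_average)
    show "sets \<mu> = sets borel" by (simp add: \<mu>_def)
    have "(\<integral>\<^sup>+y. 1 \<partial>\<mu>) \<le> (\<integral>\<^sup>+u. I u \<partial>lborel)"
    proof -
      have "(\<integral>\<^sup>+\<omega>. D u \<omega> \<partial>usphere) \<le> I u" if "u \<noteq> 0" for u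
      proof -
        have "(\<integral>\<^sup>+\<omega>. D u \<omega> \<partial>usphere) \<le> (\<integral>\<^sup>+\<omega>. I u * ennreal (b (sgn u \<bullet> \<omega>)) \<partial>usphere)"
          by (intro nn_integral_mono) (auto simp: D_def B_def indicator_def)
        also have "\<dots> = I u"
          using b_norm[of "sgn u"] that by (simp add: nn_integral_cmult norm_sgn)
        finally show ?thesis .
      qed
      note le = this
      have "(\<integral>\<^sup>+y. 1 \<partial>\<mu>) = (\<integral>\<^sup>+u. \<integral>\<^sup>+\<omega>. D u \<omega> * 1 \<partial>usphere \<partial>lborel)"
        by (rule int_mu) measurable
      also have "\<dots> \<le> (\<integral>\<^sup>+u. I u \<partial>lborel)"
        by (rule nn_integral_lborel_mono_except[of 0])
           (use le in simp)
      finally show ?thesis .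
    qed
    also have "\<dots> < \<infinity>"
      using emeasure_lborel_cball_finite[of "0::'a" T] by (simp add: I_def)
    finally show "finite_measure \<mu>"
      by (intro finite_measureI) simp
    have "(\<integral>\<^sup>+y. indicator {0} y \<partial>\<mu>) = (\<integral>\<^sup>+u. \<integral>\<^sup>+\<omega>. D u \<omega> * indicator {0} (z u \<omega>) \<partial>usphere \<partial>(lborel :: 'a measure))"
      by (rule int_mu) measurable
    also have "\<dots> = (\<integral>\<^sup>+u. \<integral>\<^sup>+\<omega>. 0 \<partial>(usphere :: 'a measure) \<partial>(lborel :: 'a measure))"
    proof (rule nn_integral_lborel_cong_except[of 0])
      fix u :: 'a assume u: "u \<noteq> 0"
      show "(\<integral>\<^sup>+\<omega>. D u \<omega> * indicator {0} (z u \<omega>) \<partial>usphere) = (\<integral>\<^sup>+\<omega>. 0 \<partial>(usphere :: 'a measure))"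
      proof (rule nn_integral_usphere_cong)
        fix \<omega> :: 'a assume o: "norm \<omega> = 1"
        show "D u \<omega> * indicator {0} (z u \<omega>) = 0"
        proof (cases "z u \<omega> = 0")
          case True
          then have "q (sgn u \<bullet> \<omega>) = 0" using normz[OF o, of u] u by simp
          then have "sgn u \<bullet> \<omega> = 1" by (simp add: q_def)
          then show ?thesis by (simp add: D_def B_def)
        qed simp
      qed
    qed
    finally have "emeasure \<mu> {0} = 0"
      by (simp add: \<mu>_def)
    then show "AE y in \<mu>. y \<noteq> 0"
      by (intro AE_I[of _ _ "{0}"]) (auto simp: \<mu>_def)
    fix f :: "'a \<Rightarrow> 'a" and F :: "'a \<Rightarrow> ennreal"
    assume f: "orthogonal_transformation f" and [measurable]: "F \<in> borel_measurable borel"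
    note [measurable] = borel_measurable_orthogonal[OF f]
    have lin: "linear f" using f by (simp add: orthogonal_transformation_linear)
    have sg: "sgn (f x) = f (sgn x)" for x
      using f by (simp add: sgn_div_norm orthogonal_transformation_norm linear_scale[OF lin])
    have fz: "f (z u \<omega>) = z (f u) (f \<omega>)" for u \<omega>
      using f by (simp add: z_def orthogonal_transformation_norm linear_scale[OF lin] linear_diff[OF lin])
    have fD: "D u \<omega> = D (f u) (f \<omega>)" for u \<omega>
      using f by (simp add: D_def I_def sg orthogonal_transformation_norm indicator_def) (simp add: orthogonal_transformation_def)
    have "(\<integral>\<^sup>+y. F (f y) \<partial>\<mu>) = (\<integral>\<^sup>+u. \<integral>\<^sup>+\<omega>. D (f u) (f \<omega>) * F (z (f u) (f \<omega>)) \<partial>usphere \<partial>lborel)"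
      by (simp add: int_mu fz flip: fD)
    also have "\<dots> = (\<integral>\<^sup>+u. \<integral>\<^sup>+\<omega>. D (f u) \<omega> * F (z (f u) \<omega>) \<partial>usphere \<partial>lborel)"
      by (intro nn_integral_cong nn_integral_usphere_orthogonal[OF f, of "\<lambda>\<omega>. D (f u) \<omega> * F (z (f u) \<omega>)" for u]) measurable
    also have "\<dots> = (\<integral>\<^sup>+u. \<integral>\<^sup>+\<omega>. D u \<omega> * F (z u \<omega>) \<partial>usphere \<partial>lborel)"
      by (rule nn_integral_lborel_orthogonal[OF f, of "\<lambda>u. \<integral>\<^sup>+\<omega>. D u \<omega> * F (z u \<omega>) \<partial>usphere"]) measurable
    finally show "(\<integral>\<^sup>+y. F (f y) \<partial>\<mu>) = (\<integral>\<^sup>+y. F y \<partial>\<mu>)"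
      by (simp add: int_mu)
  qed measurable
  define \<Psi> where "\<Psi> r c = (\<integral>\<^sup>+x. \<phi> ((r * q c) *\<^sub>R x) \<partial>(usphere :: 'a measure))" for r c
  have \<Psi>m [measurable]: "(\<lambda>x. \<Psi> (f x) (g x)) \<in> borel_measurable N"
    if [measurable]: "f \<in> borel_measurable N" "g \<in> borel_measurable N" for f g and N :: "'x measure"
    unfolding \<Psi>_def by measurable
  have sJ: "s * (\<integral>\<^sup>+y. \<phi> y \<partial>\<mu>) = (\<integral>\<^sup>+u. \<integral>\<^sup>+\<omega>. D u \<omega> * \<Psi> (norm u) (sgn u \<bullet> \<omega>) \<partial>usphere \<partial>lborel)"
  proof -
    have "s * (\<integral>\<^sup>+y. \<phi> y \<partial>\<mu>) = (\<integral>\<^sup>+u. \<integral>\<^sup>+\<omega>. D u \<omega> * (\<integral>\<^sup>+x. \<phi> (norm (z u \<omega>) *\<^sub>R x) \<partial>usphere) \<partial>usphere \<partial>lborel)"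
      unfolding avg by (rule int_mu) measurable
    also have "\<dots> = (\<integral>\<^sup>+u. \<integral>\<^sup>+\<omega>. D u \<omega> * \<Psi> (norm u) (sgn u \<bullet> \<omega>) \<partial>usphere \<partial>lborel)"
      by (intro nn_integral_cong nn_integral_usphere_cong)
         (simp add: \<Psi>_def normz)
    finally show ?thesis .
  qed
  define W where "W = (\<integral>\<^sup>+y. indicator (cball 0 (T / sqrt 2)) y * \<phi> y \<partial>lborel)"
  \<comment> \<open>At a fixed angle the increment has length \<open>r * norm u\<close> with
    \<open>r = q c\<close>. Scaling by \<open>r\<close> maps the ball of radius \<open>T\<close>
    onto that of radius \<open>T * r\<close>, which contains the ball of \<open>W\<close>, and the
    factor \<open>r ^ DIM('a)\<close> is at most 1.\<close>
  have inner: "s * W \<le> (\<integral>\<^sup>+(u::'a). I u * \<Psi> (norm u) c \<partial>lborel)" if c: "-1 \<le> c" "c \<le> 0" for c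
  proof -
    define r where "r = q c"
    have r: "1 / sqrt 2 \<le> r" "r \<le> 1" "r > 0"
    proof -
      have "sqrt (1/2) \<le> r" "r \<le> sqrt 1"
        unfolding r_def q_def using c by (intro real_sqrt_le_mono; simp)+
      moreover have "sqrt (1/2) = 1 / sqrt 2" by (simp add: real_sqrt_divide)
      ultimately show "1 / sqrt 2 \<le> r" "r \<le> 1" by auto
      then show "r > 0" using less_le_trans[of 0 "1 / sqrt 2" r] by simp
    qed
    have "W \<le> (\<integral>\<^sup>+y. indicator (cball 0 (T * r)) y * \<phi> y \<partial>lborel)"
    proof -
      have "T / sqrt 2 \<le> T * r" using r T mult_left_mono[of "1 / sqrt 2" r T] by simp
      then have "cball (0::'a) (T / sqrt 2) \<subseteq> cball 0 (T * r)" by auto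
      then show ?thesis
        unfolding W_def by (intro nn_integral_mono mult_right_mono) (auto simp: indicator_def)
    qed
    also have "\<dots> = ennreal (r ^ DIM('a)) * (\<integral>\<^sup>+y. indicator (cball 0 (T * r)) (r *\<^sub>R y) * \<phi> (r *\<^sub>R y) \<partial>lborel)"
      using r by (intro nn_integral_lborel_scale) measurable
    also have "\<dots> \<le> 1 * (\<integral>\<^sup>+y. indicator (cball 0 (T * r)) (r *\<^sub>R y) * \<phi> (r *\<^sub>R y) \<partial>lborel)"
      using r by (intro mult_right_mono) (auto simp: power_le_one)
    also have "\<dots> = (\<integral>\<^sup>+y. I y * \<phi> (r *\<^sub>R y) \<partial>lborel)"
      unfolding I_def using r by (simp add: indicator_def mult.commute[of T] cong: nn_integral_cong)
    finally have "s * W \<le> s * (\<integral>\<^sup>+y. I y * \<phi> (r *\<^sub>R y) \<partial>lborel)"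
      by (rule mult_left_mono) (rule zero_le)
    also have "\<dots> = (\<integral>\<^sup>+(u::'a). \<integral>\<^sup>+x. I (norm u *\<^sub>R x) * \<phi> (r *\<^sub>R (norm u *\<^sub>R x)) \<partial>usphere \<partial>lborel)"
      unfolding s_def by (rule nn_integral_lborel_spherical_average) measurable
    also have "\<dots> = (\<integral>\<^sup>+(u::'a). I u * \<Psi> (norm u) c \<partial>lborel)"
    proof (rule nn_integral_cong)
      fix u :: 'a
      have "(\<integral>\<^sup>+x. I (norm u *\<^sub>R x) * \<phi> (r *\<^sub>R (norm u *\<^sub>R x)) \<partial>usphere) =
          (\<integral>\<^sup>+x. I u * \<phi> ((norm u * q c) *\<^sub>R x) \<partial>usphere)"
        by (rule nn_integral_usphere_cong)
           (simp add: r_def I_def indicator_def mult.commute)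
      then show "(\<integral>\<^sup>+x. I (norm u *\<^sub>R x) * \<phi> (r *\<^sub>R (norm u *\<^sub>R x)) \<partial>usphere) = I u * \<Psi> (norm u) c"
        unfolding \<Psi>_def by (simp add: nn_integral_cmult)
    qed
    finally show ?thesis .
  qed
  \<comment> \<open>One factor \<open>s\<close> resampled the direction of the increment. The second
    resamples that of \<open>u\<close>, so that the angle becomes independent of
    \<open>norm u\<close> and can be integrated last.\<close>
  have "s * (s * (\<integral>\<^sup>+y. \<phi> y \<partial>\<mu>)) =
      (\<integral>\<^sup>+(u::'a). \<integral>\<^sup>+v. \<integral>\<^sup>+\<omega>. D (norm u *\<^sub>R v) \<omega> * \<Psi> (norm (norm u *\<^sub>R v)) (sgn (norm u *\<^sub>R v) \<bullet> \<omega>) \<partial>usphere \<partial>usphere \<partial>lborel)"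
    unfolding sJ unfolding s_def
    by (rule nn_integral_lborel_spherical_average[of "\<lambda>u. \<integral>\<^sup>+\<omega>. D u \<omega> * \<Psi> (norm u) (sgn u \<bullet> \<omega>) \<partial>usphere"]) measurable
  also have "\<dots> = (\<integral>\<^sup>+(u::'a). \<integral>\<^sup>+v. \<integral>\<^sup>+\<omega>. I u * B (v \<bullet> \<omega>) * \<Psi> (norm u) (v \<bullet> \<omega>) \<partial>(usphere::'a measure) \<partial>usphere \<partial>lborel)"
  proof (rule nn_integral_lborel_cong_except[of 0])
    fix u :: 'a assume u: "u \<noteq> 0"
    show "(\<integral>\<^sup>+v. \<integral>\<^sup>+\<omega>. D (norm u *\<^sub>R v) \<omega> * \<Psi> (norm (norm u *\<^sub>R v)) (sgn (norm u *\<^sub>R v) \<bullet> \<omega>) \<partial>usphere \<partial>usphere) =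
      (\<integral>\<^sup>+v. \<integral>\<^sup>+\<omega>. I u * B (v \<bullet> \<omega>) * \<Psi> (norm u) (v \<bullet> \<omega>) \<partial>(usphere::'a measure) \<partial>usphere)"
    proof (rule nn_integral_usphere_cong)
      fix v :: 'a assume v: "norm v = 1"
      have e1: "sgn (norm u *\<^sub>R v) = v" and e2: "norm (norm u *\<^sub>R v) = norm u"
        and e3: "I (norm u *\<^sub>R v) = I u"
        using u v by (simp_all add: sgn_div_norm I_def indicator_def)
      show "(\<integral>\<^sup>+\<omega>. D (norm u *\<^sub>R v) \<omega> * \<Psi> (norm (norm u *\<^sub>R v)) (sgn (norm u *\<^sub>R v) \<bullet> \<omega>) \<partial>usphere) =
         (\<integral>\<^sup>+\<omega>. I u * B (v \<bullet> \<omega>) * \<Psi> (norm u) (v \<bullet> \<omega>) \<partial>usphere)"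
        unfolding D_def e1 e2 e3 ..
    qed
  qed
  also have "\<dots> = (\<integral>\<^sup>+v. \<integral>\<^sup>+(u::'a). \<integral>\<^sup>+\<omega>. I u * B (v \<bullet> \<omega>) * \<Psi> (norm u) (v \<bullet> \<omega>) \<partial>(usphere::'a measure) \<partial>lborel \<partial>usphere)"
    by (rule lu.Fubini'[symmetric]) measurable
  also have "\<dots> = (\<integral>\<^sup>+v. \<integral>\<^sup>+\<omega>. \<integral>\<^sup>+(u::'a). I u * B (v \<bullet> \<omega>) * \<Psi> (norm u) (v \<bullet> \<omega>) \<partial>lborel \<partial>(usphere::'a measure) \<partial>usphere)"
    by (intro nn_integral_cong lu.Fubini'[symmetric]) measurable
  also have "\<dots> = (\<integral>\<^sup>+v. \<integral>\<^sup>+\<omega>. B (v \<bullet> \<omega>) * (\<integral>\<^sup>+(u::'a). I u * \<Psi> (norm u) (v \<bullet> \<omega>) \<partial>lborel) \<partial>(usphere::'a measure) \<partial>usphere)"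
    by (intro nn_integral_cong, subst nn_integral_cmult[symmetric]) (measurable, simp add: mult_ac)
  finally have s2: "s * (s * (\<integral>\<^sup>+y. \<phi> y \<partial>\<mu>)) = \<dots>" .
  \<comment> \<open>The \<open>1 / 2\<close> is the lower bound for the mass of \<open>b\<close> on
    \<open>cos \<theta> \<le> 0\<close>.\<close>
  have "s * (s * (W / 2)) = (\<integral>\<^sup>+(v::'a). 1 / 2 * (s * W) \<partial>usphere)"
    by (simp add: s_def divide_ennreal_def mult_ac)
  also have "\<dots> \<le> (\<integral>\<^sup>+v. \<integral>\<^sup>+\<omega>. B (v \<bullet> \<omega>) * (s * W) \<partial>(usphere::'a measure) \<partial>usphere)"
  proof (rule nn_integral_usphere_mono)
    fix v :: 'a assume v: "norm v = 1"
    have "1 / 2 \<le> (\<integral>\<^sup>+\<omega>. B (v \<bullet> \<omega>) \<partial>(usphere::'a measure))"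
      using nn_integral_b_half_le[OF v] by (simp add: B_def)
    from mult_right_mono[OF this, of "s * W"]
    show "1 / 2 * (s * W) \<le> (\<integral>\<^sup>+\<omega>. B (v \<bullet> \<omega>) * (s * W) \<partial>(usphere::'a measure))"
      by (simp add: nn_integral_multc)
  qed
  also have "\<dots> \<le> s * (s * (\<integral>\<^sup>+y. \<phi> y \<partial>\<mu>))"
    unfolding s2
  proof (rule nn_integral_usphere_mono)
    fix v :: 'a assume v: "norm v = 1"
    show "(\<integral>\<^sup>+\<omega>. B (v \<bullet> \<omega>) * (s * W) \<partial>(usphere::'a measure)) \<le>
        (\<integral>\<^sup>+\<omega>. B (v \<bullet> \<omega>) * (\<integral>\<^sup>+(u::'a). I u * \<Psi> (norm u) (v \<bullet> \<omega>) \<partial>lborel) \<partial>(usphere::'a measure))"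
    proof (rule nn_integral_mono_AE, rule AE_mp[OF AE_usphere_inner_le[OF v]], rule AE_I2, rule impI)
      fix \<omega> assume o: "\<bar>v \<bullet> \<omega>\<bar> \<le> 1"
      show "B (v \<bullet> \<omega>) * (s * W) \<le> B (v \<bullet> \<omega>) * (\<integral>\<^sup>+(u::'a). I u * \<Psi> (norm u) (v \<bullet> \<omega>) \<partial>lborel)"
      proof (cases "v \<bullet> \<omega> \<le> 0")
        case True
        then show ?thesis using o by (intro mult_left_mono inner) auto
      qed (simp add: B_def)
    qed
  qed
  finally have "W / 2 \<le> (\<integral>\<^sup>+y. \<phi> y \<partial>\<mu>)"
    using s by (simp add: ennreal_mult_le_mult_iff)
  also have "\<dots> = (\<integral>\<^sup>+u. \<integral>\<^sup>+\<omega>. D u \<omega> * \<phi> (z u \<omega>) \<partial>usphere \<partial>lborel)"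
    by (rule int_mu) measurable
  finally show ?thesis
    by (simp only: W_def D_def I_def B_def z_def)
qed

text \<open>A local Doeblin condition: from every point of the ball one collision reaches the whole
  ball with a uniform density.\<close>

lemma A_minorization:
  assumes R: "R > 0"
  obtains c where "c > 0"
    "\<And>h v. h \<in> borel_measurable borel \<Longrightarrow> norm v \<le> R \<Longrightarrow>
      ennreal c * (\<integral>\<^sup>+y. indicator (cball 0 R) y * h y \<partial>lborel) \<le> A h v"
proof -
  \<comment> \<open>With \<open>T / sqrt 2 = 2 * R\<close>, the ball reached around any
    \<open>v\<close> in \<open>cball 0 R\<close> contains \<open>cball 0 R\<close>. The constant
    \<open>m\<close> bounds \<open>norm u powr \<gamma> * maxwellian (v - u)\<close> from below for
    \<open>0 < norm u \<le> T\<close>.\<close>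
  define T where "T = 2 * R * sqrt 2"
  define m where "m = T powr \<gamma> * ((2 * pi) powr (- real DIM('a) / 2) * exp (- (R + T)\<^sup>2 / 2))"
  have T: "T > 0" "T / sqrt 2 = 2 * R" using R by (simp_all add: T_def)
  have m: "m > 0" using T by (simp add: m_def)
  have "ennreal (m / 2) * (\<integral>\<^sup>+y. indicator (cball 0 R) y * h y \<partial>lborel) \<le> A h v"
    if [measurable]: "h \<in> borel_measurable borel" and v: "norm v \<le> R" for h v
  proof -
    have cball_borel [measurable]: "cball x r \<in> sets borel" for r and x :: 'a by simp
    define F where "F w = (\<integral>\<^sup>+\<omega>. kern v w \<omega> * h (post v w \<omega>) \<partial>usphere)" for w
    have [measurable]: "F \<in> borel_measurable borel" unfolding F_def by measurable
    have "(\<integral>\<^sup>+y. indicator (cball 0 R) y * h y \<partial>lborel) \<le>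
        (\<integral>\<^sup>+y. indicator (cball 0 (T / sqrt 2)) (- v + y) * h y \<partial>lborel)"
    proof (intro nn_integral_mono mult_right_mono)
      fix y :: 'a
      show "indicator (cball 0 R) y \<le> (indicator (cball 0 (T / sqrt 2)) (- v + y) :: ennreal)"
        using v norm_triangle_ineq4[of y v] T by (auto simp: indicator_def)
    qed simp
    also have "\<dots> = (\<integral>\<^sup>+y. indicator (cball 0 (T / sqrt 2)) y * h (v + y) \<partial>lborel)"
    proof -
      have "(\<lambda>y. indicator (cball 0 (T / sqrt 2)) (- v + y) * h y) \<in> borel_measurable borel"
        by measurable
      from nn_integral_lborel_shift(1)[OF this, of v] show ?thesis
        by (simp only: minus_add_cancel)
    qed
    finally have "ennreal (m / 2) * (\<integral>\<^sup>+y. indicator (cball 0 R) y * h y \<partial>lborel) \<le>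
        ennreal (m / 2) * (\<integral>\<^sup>+y. indicator (cball 0 (T / sqrt 2)) y * h (v + y) \<partial>lborel)"
      by (rule mult_left_mono) simp
    also have "\<dots> = ennreal m * ((\<integral>\<^sup>+y. indicator (cball 0 (T / sqrt 2)) y * h (v + y) \<partial>lborel) / 2)"
      using m by (simp add: divide_ennreal[symmetric] divide_ennreal_def mult_ac)
    also have "\<dots> \<le> ennreal m * (\<integral>\<^sup>+u. \<integral>\<^sup>+\<omega>. indicator (cball 0 T) u *
        (ennreal (b (sgn u \<bullet> \<omega>)) * indicator {..0} (sgn u \<bullet> \<omega>)) *
        h (v + (1/2) *\<^sub>R (norm u *\<^sub>R \<omega> - u)) \<partial>usphere \<partial>lborel)"
      by (intro mult_left_mono nn_integral_increment_ge T) auto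
    also have "\<dots> = (\<integral>\<^sup>+u. \<integral>\<^sup>+\<omega>. ennreal m * (indicator (cball 0 T) u *
        (ennreal (b (sgn u \<bullet> \<omega>)) * indicator {..0} (sgn u \<bullet> \<omega>)) *
        h (v + (1/2) *\<^sub>R (norm u *\<^sub>R \<omega> - u))) \<partial>usphere \<partial>lborel)"
      by (simp add: nn_integral_cmult)
    also have "\<dots> \<le> (\<integral>\<^sup>+u. F (v - u) \<partial>lborel)"
    proof (rule nn_integral_lborel_mono_except[of 0])
      fix u :: 'a assume u: "u \<noteq> 0"
      show "(\<integral>\<^sup>+\<omega>. ennreal m * (indicator (cball 0 T) u *
        (ennreal (b (sgn u \<bullet> \<omega>)) * indicator {..0} (sgn u \<bullet> \<omega>)) *
        h (v + (1/2) *\<^sub>R (norm u *\<^sub>R \<omega> - u))) \<partial>usphere) \<le> F (v - u)"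
        unfolding F_def
      proof (rule nn_integral_mono)
        fix \<omega> :: 'a
        have p: "post v (v - u) \<omega> = v + (1/2) *\<^sub>R (norm u *\<^sub>R \<omega> - u)"
          by (rule euclidean_eqI) (simp add: post_def inner_simps field_simps)
        have "ennreal m * (indicator (cball 0 T) u *
          (ennreal (b (sgn u \<bullet> \<omega>)) * indicator {..0} (sgn u \<bullet> \<omega>))) \<le> kern v (v - u) \<omega>"
        proof (cases "norm u \<le> T")
          case True
          have 1: "T powr \<gamma> \<le> norm u powr \<gamma>"
            using True u gamma by (intro powr_mono2') auto
          have "norm (v - u) \<le> R + T"
            using norm_triangle_ineq4[of v u] v True by linarith
          then have 2: "(2 * pi) powr (- real DIM('a) / 2) * exp (- (R + T)\<^sup>2 / 2) \<le> maxwellian (v - u)"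
            unfolding maxwellian_def by (intro mult_left_mono) (auto intro!: power_mono)
          have "m * b (sgn u \<bullet> \<omega>) \<le> norm u powr \<gamma> * maxwellian (v - u) * b (sgn u \<bullet> \<omega>)"
            unfolding m_def by (intro mult_right_mono mult_mono 1 2 b_nonneg) auto
          then show ?thesis
            using True m b_nonneg unfolding kern_def
            by (auto simp: indicator_def ennreal_mult'[symmetric] mult_ac intro!: ennreal_leI)
        qed simp
        then show "ennreal m * (indicator (cball 0 T) u *
          (ennreal (b (sgn u \<bullet> \<omega>)) * indicator {..0} (sgn u \<bullet> \<omega>)) *
          h (v + (1/2) *\<^sub>R (norm u *\<^sub>R \<omega> - u))) \<le> kern v (v - u) \<omega> * h (post v (v - u) \<omega>)"
          unfolding p mult.assoc[symmetric] by (rule mult_right_mono) simp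
      qed
    qed
    also have "\<dots> = (\<integral>\<^sup>+w. F w \<partial>lborel)"
      by (rule nn_integral_lborel_shift(2)) measurable
    also have "\<dots> = A h v"
      by (simp add: A_def F_def)
    finally show ?thesis .
  qed
  then show ?thesis using m by (intro that[of "m / 2"]) auto
qed

end

subsection \<open>The Boltzmann operator on integrable functions\<close>

interpretation sphere_measure: finite_measure "sphere_measure :: 'a::euclidean_space measure"
proof (rule finite_measureI)
  have "emeasure (sphere_measure :: 'a measure) (space sphere_measure) = (\<integral>\<^sup>+x. 1 \<partial>(sphere_measure :: 'a measure))"
    by simp
  also have "\<dots> = (\<integral>\<^sup>+x. 1 \<partial>(usphere :: 'a measure))"
    by (rule nn_integral_usphere_eq[symmetric]) simp
  also have "\<dots> < \<infinity>"
    using emeasure_usphere_finite[of "UNIV :: 'a set"] by simp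
  finally show "emeasure (sphere_measure :: 'a measure) (space sphere_measure) \<noteq> \<infinity>" by simp
qed

lemma measurable_lborel_sphere_measure:
  fixes F :: "'a::euclidean_space \<times> 'a \<Rightarrow> 'b::topological_space"
  assumes "F \<in> borel_measurable (borel \<Otimes>\<^sub>M borel)"
  shows "F \<in> borel_measurable (lborel \<Otimes>\<^sub>M sphere_measure)"
proof -
  have "(\<lambda>p. (fst p, snd p)) \<in> lborel \<Otimes>\<^sub>M sphere_measure \<rightarrow>\<^sub>M (borel \<Otimes>\<^sub>M borel :: ('a \<times> 'a) measure)"
    by (intro measurable_Pair measurable_compose[OF measurable_fst] measurable_compose[OF measurable_snd]
        measurable_ident_sphere_measure) simp
  from measurable_compose[OF this assms] show ?thesis by simp
qed

lemma nn_integral_lborel_sphere_measure: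
  fixes F :: "'a::euclidean_space \<times> 'a \<Rightarrow> ennreal"
  assumes [measurable]: "F \<in> borel_measurable (borel \<Otimes>\<^sub>M borel)"
  shows "(\<integral>\<^sup>+p. F p \<partial>(lborel \<Otimes>\<^sub>M sphere_measure)) = (\<integral>\<^sup>+w. \<integral>\<^sup>+\<omega>. F (w, \<omega>) \<partial>usphere \<partial>lborel)"
proof -
  have "(\<integral>\<^sup>+p. F p \<partial>(lborel \<Otimes>\<^sub>M sphere_measure)) = (\<integral>\<^sup>+w. \<integral>\<^sup>+\<omega>. F (w, \<omega>) \<partial>sphere_measure \<partial>lborel)"
    by (rule sphere_measure.nn_integral_fst[symmetric]) (rule measurable_lborel_sphere_measure[OF assms])
  also have "\<dots> = (\<integral>\<^sup>+w. \<integral>\<^sup>+\<omega>. F (w, \<omega>) \<partial>usphere \<partial>lborel)"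
    by (intro nn_integral_cong nn_integral_usphere_eq[symmetric]) measurable
  finally show ?thesis .
qed

text \<open>Conservation of energy: both velocity pairs are the centre of mass plus and minus a
  vector, of the same length in both cases, and the parallelogram law applies.\<close>

lemma maxwellian_collision:
  fixes v w \<omega> :: "'a::euclidean_space"
  assumes "norm \<omega> = 1"
  shows "maxwellian (post v w \<omega>) * maxwellian (post_star v w \<omega>) = maxwellian v * maxwellian w"
proof -
  have par: "(norm (x + y))\<^sup>2 + (norm (x - y))\<^sup>2 = 2 * ((norm x)\<^sup>2 + (norm y)\<^sup>2)" for x y :: 'a
    by (simp add: power2_norm_eq_inner inner_simps inner_commute)
  define x where "x = (v + w) /\<^sub>R 2"
  define y where "y = (norm (v - w) / 2) *\<^sub>R \<omega>"
  define z where "z = (v - w) /\<^sub>R 2"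
  have "norm y = norm z" using assms by (simp add: y_def z_def)
  moreover have vw: "v = x + z" "w = x - z"
    by (rule euclidean_eqI, simp add: x_def z_def inner_simps field_simps)+
  ultimately have e: "(norm (x + y))\<^sup>2 + (norm (x - y))\<^sup>2 = (norm v)\<^sup>2 + (norm w)\<^sup>2"
    unfolding vw par by simp
  have "exp (- (norm (x + y))\<^sup>2 / 2) * exp (- (norm (x - y))\<^sup>2 / 2) =
      exp (- ((norm (x + y))\<^sup>2 + (norm (x - y))\<^sup>2) / 2)"
    unfolding mult_exp_exp by (simp add: field_simps)
  also have "\<dots> = exp (- (norm v)\<^sup>2 / 2) * exp (- (norm w)\<^sup>2 / 2)"
    unfolding e mult_exp_exp by (simp add: field_simps)
  finally show ?thesis
    unfolding maxwellian_def post_def post_star_def x_def[symmetric] y_def[symmetric]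
    by (simp add: mult_ac)
qed

lemma integral_eq_enn2real_nn_integral:
  fixes f :: "'a \<Rightarrow> real"
  assumes [measurable]: "f \<in> borel_measurable M" and "\<And>x. 0 \<le> f x" and "(\<integral>\<^sup>+x. ennreal (f x) \<partial>M) < \<infinity>"
  shows "integrable M f" "integral\<^sup>L M f = enn2real (\<integral>\<^sup>+x. ennreal (f x) \<partial>M)"
proof -
  show "integrable M f"
    using assms by (intro integrableI_nonneg) auto
  show "integral\<^sup>L M f = enn2real (\<integral>\<^sup>+x. ennreal (f x) \<partial>M)"
    using assms by (intro integral_eq_nn_integral) auto
qed

text \<open>Cosines never leave \<open>[-1, 1]\<close>. Hence \<open>b\<close> may be replaced by
  its extension by 0, which is Borel on the whole line.\<close>

lemma boltzmann_op_cong_kernel: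
  fixes f :: "'a::euclidean_space \<Rightarrow> real"
  assumes "\<And>x. x \<in> {-1..1} \<Longrightarrow> b x = b' x"
  shows "boltzmann_op \<gamma> b f = boltzmann_op \<gamma> b' f"
proof
  fix v :: 'a
  show "boltzmann_op \<gamma> b f v = boltzmann_op \<gamma> b' f v"
    unfolding boltzmann_op_def
  proof (rule Bochner_Integration.integral_cong[OF refl], clarify)
    fix w \<omega> :: 'a assume "(w, \<omega>) \<in> space (lborel \<Otimes>\<^sub>M sphere_measure)"
    then have "norm \<omega> = 1" by (simp add: space_pair_measure space_sphere_measure)
    then have "\<bar>sgn (v - w) \<bullet> \<omega>\<bar> \<le> 1"
      using Cauchy_Schwarz_ineq2[of "sgn (v - w)" \<omega>] by (auto simp: norm_sgn split: if_splits)
    then have "b (sgn (v - w) \<bullet> \<omega>) = b' (sgn (v - w) \<bullet> \<omega>)"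
      by (intro assms) auto
    then show "norm (v - w) powr \<gamma> * b (sgn (v - w) \<bullet> \<omega>) *
        (f (post v w \<omega>) * maxwellian (post_star v w \<omega>) - f v * maxwellian w) =
      norm (v - w) powr \<gamma> * b' (sgn (v - w) \<bullet> \<omega>) *
        (f (post v w \<omega>) * maxwellian (post_star v w \<omega>) - f v * maxwellian w)" by simp
  qed
qed

context soft_kernel
begin

definition M :: "'a \<Rightarrow> ennreal" where "M v = ennreal (maxwellian v)"

lemma measurable_M [measurable]: "M \<in> borel_measurable borel"
  unfolding M_def by measurable

lemma M_props: "M v \<noteq> 0" "M v \<noteq> top"
  using maxwellian_pos[of v] by (simp_all add: M_def)

lemma M_cancel: "M v * (x / M v) = x"
  by (rule ennreal_mult_divide_cancel(2)[OF M_props])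

definition gain :: "('a \<Rightarrow> ennreal) \<Rightarrow> 'a \<Rightarrow> ennreal" where
  "gain F v = M v * A (\<lambda>x. F x / M x) v"

lemma measurable_gain [measurable]:
  assumes [measurable]: "F \<in> borel_measurable borel"
  shows "gain F \<in> borel_measurable borel"
  unfolding gain_def[abs_def] by measurable

text \<open>Reversibility applied to \<open>F / M\<close>. Every weighted integral of the gain
  thereby becomes a pointwise question about \<open>A W\<close>.\<close>

lemma nn_integral_gain:
  assumes [measurable]: "F \<in> borel_measurable borel" "W \<in> borel_measurable borel"
  shows "(\<integral>\<^sup>+v. W v * gain F v \<partial>lborel) = (\<integral>\<^sup>+v. F v * A W v \<partial>lborel)"
proof -
  have "(\<integral>\<^sup>+v. W v * gain F v \<partial>lborel) = (\<integral>\<^sup>+v. ennreal (maxwellian v) * W v * A (\<lambda>x. F x / M x) v \<partial>lborel)"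
    by (simp add: gain_def M_def mult_ac)
  also have "\<dots> = (\<integral>\<^sup>+v. ennreal (maxwellian v) * (F v / M v) * A W v \<partial>lborel)"
    by (rule A_reversible) measurable
  also have "\<dots> = (\<integral>\<^sup>+v. F v * A W v \<partial>lborel)"
    using M_cancel by (simp add: M_def)
  finally show ?thesis .
qed

lemma gain_add:
  assumes [measurable]: "F \<in> borel_measurable borel" "G \<in> borel_measurable borel"
  shows "gain (\<lambda>x. F x + G x) v = gain F v + gain G v"
  unfolding gain_def A_def divide_ennreal_def distrib_right distrib_left
  by (subst nn_integral_add, measurable, subst nn_integral_add, measurable) (simp add: distrib_left)

text \<open>Reduces to the bound for \<open>A\<close>, since \<open>M \<le> 1\<close> makes
  \<open>F / M\<close> at least \<open>F\<close> and the outer factor \<open>M v\<close> is bounded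
  below on the ball.\<close>

lemma gain_minorization:
  assumes R: "R > 0"
  obtains c where "c > 0"
    "\<And>F v. F \<in> borel_measurable borel \<Longrightarrow> norm v \<le> R \<Longrightarrow>
      ennreal c * (\<integral>\<^sup>+y. indicator (cball 0 R) y * F y \<partial>lborel) \<le> gain F v"
proof -
  obtain c where c: "c > 0" "\<And>h v. h \<in> borel_measurable borel \<Longrightarrow> norm v \<le> R \<Longrightarrow>
      ennreal c * (\<integral>\<^sup>+y. indicator (cball 0 R) y * h y \<partial>lborel) \<le> A h v"
    using A_minorization[OF R] by blast
  define m where "m = (2 * pi) powr (- real DIM('a) / 2) * exp (- R\<^sup>2 / 2)"
  have m: "m > 0" by (simp add: m_def)
  have "ennreal (m * c) * (\<integral>\<^sup>+y. indicator (cball 0 R) y * F y \<partial>lborel) \<le> gain F v"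
    if [measurable]: "F \<in> borel_measurable borel" and v: "norm v \<le> R" for F v
  proof -
    have "F y \<le> F y / M y" for y
    proof -
      have "M y * (F y / M y) \<le> 1 * (F y / M y)"
        by (intro mult_right_mono) (auto simp: M_def maxwellian_le_1)
      then show ?thesis by (simp add: M_cancel)
    qed
    then have "(\<integral>\<^sup>+y. indicator (cball 0 R) y * F y \<partial>lborel) \<le>
        (\<integral>\<^sup>+y. indicator (cball 0 R) y * (F y / M y) \<partial>lborel)"
      by (intro nn_integral_mono mult_left_mono) auto
    then have "ennreal m * (ennreal c * (\<integral>\<^sup>+y. indicator (cball 0 R) y * F y \<partial>lborel)) \<le>
        ennreal m * (ennreal c * (\<integral>\<^sup>+y. indicator (cball 0 R) y * (F y / M y) \<partial>lborel))"
      by (intro mult_left_mono) auto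
    also have "\<dots> \<le> ennreal m * A (\<lambda>x. F x / M x) v"
      by (intro mult_left_mono c(2) v) auto
    also have "\<dots> \<le> gain F v"
      unfolding gain_def
    proof (rule mult_right_mono)
      have "m \<le> maxwellian v"
        unfolding m_def maxwellian_def using v by (intro mult_left_mono) (auto intro!: power_mono)
      then show "ennreal m \<le> M v" by (simp add: M_def ennreal_leI)
    qed simp
    finally show ?thesis
      using m c by (simp add: ennreal_mult mult.assoc)
  qed
  then show ?thesis using m c by (intro that[of "m * c"]) auto
qed

text \<open>By \<open>maxwellian_collision\<close>, dividing by the Maxwellian at
  \<open>post v w \<omega>\<close> leaves the one at \<open>post_star v w \<omega>\<close>, which is
  the form of the gain in \<open>boltzmann_op\<close>.\<close>

lemma gain_eq:
  assumes [measurable]: "F \<in> borel_measurable borel"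
  shows "gain F v = (\<integral>\<^sup>+w. \<integral>\<^sup>+\<omega>. ennreal (norm (v - w) powr \<gamma> * b (sgn (v - w) \<bullet> \<omega>) * maxwellian (post_star v w \<omega>)) *
      F (post v w \<omega>) \<partial>usphere \<partial>lborel)"
proof -
  have [measurable]: "(\<lambda>(w, \<omega>). kern v w \<omega> * (F (post v w \<omega>) / M (post v w \<omega>))) \<in> borel_measurable (borel \<Otimes>\<^sub>M borel)"
    by measurable
  have "gain F v = (\<integral>\<^sup>+w. \<integral>\<^sup>+\<omega>. M v * (kern v w \<omega> * (F (post v w \<omega>) / M (post v w \<omega>))) \<partial>usphere \<partial>lborel)"
    by (simp add: gain_def A_def nn_integral_cmult)
  also have "\<dots> = (\<integral>\<^sup>+w. \<integral>\<^sup>+\<omega>. ennreal (norm (v - w) powr \<gamma> * b (sgn (v - w) \<bullet> \<omega>) * maxwellian (post_star v w \<omega>)) *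
      F (post v w \<omega>) \<partial>usphere \<partial>lborel)"
  proof (rule nn_integral_cong, rule nn_integral_usphere_cong)
    fix w \<omega> :: 'a assume o: "norm \<omega> = 1"
    define B where "B = norm (v - w) powr \<gamma> * b (sgn (v - w) \<bullet> \<omega>)"
    have B: "B \<ge> 0" by (simp add: B_def b_nonneg)
    have c: "maxwellian v * maxwellian w = maxwellian (post_star v w \<omega>) * maxwellian (post v w \<omega>)"
      using maxwellian_collision[OF o, of v w] by (simp add: mult.commute)
    have "M v * kern v w \<omega> = ennreal (B * (maxwellian v * maxwellian w))"
      using B maxwellian_pos[of v] by (simp add: M_def kern_def B_def ennreal_mult'[symmetric] mult_ac)
    also have "\<dots> = ennreal (B * maxwellian (post_star v w \<omega>)) * M (post v w \<omega>)"
      using B maxwellian_pos[of "post_star v w \<omega>"]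
      unfolding c M_def by (simp add: ennreal_mult'[symmetric] mult.assoc)
    finally have "M v * kern v w \<omega> * (F (post v w \<omega>) / M (post v w \<omega>)) =
        ennreal (B * maxwellian (post_star v w \<omega>)) * (M (post v w \<omega>) * (F (post v w \<omega>) / M (post v w \<omega>)))"
      by (simp only: mult.assoc)
    then show "M v * (kern v w \<omega> * (F (post v w \<omega>) / M (post v w \<omega>))) =
        ennreal (norm (v - w) powr \<gamma> * b (sgn (v - w) \<bullet> \<omega>) * maxwellian (post_star v w \<omega>)) * F (post v w \<omega>)"
      by (simp only: M_cancel B_def mult.assoc)
  qed
  finally show ?thesis .
qed

text \<open>Finiteness of the gain of \<open>\<bar>f\<bar>\<close> at \<open>v\<close> is what
  allows the Bochner integral to be split; for integrable \<open>f\<close> it holds at almost every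
  \<open>v\<close>. The gains of the two signs are kept apart for the later cancellation
  argument.\<close>

lemma boltzmann_op_eq:
  fixes f :: "'a \<Rightarrow> real"
  assumes [measurable]: "f \<in> borel_measurable borel"
    and fin: "gain (\<lambda>x. ennreal \<bar>f x\<bar>) v < \<infinity>"
  shows "boltzmann_op \<gamma> b f v =
    enn2real (gain (\<lambda>x. ennreal (f x)) v) - enn2real (gain (\<lambda>x. ennreal (- f x)) v) - enn2real (sig v) * f v"
proof -
  let ?N = "lborel \<Otimes>\<^sub>M sphere_measure :: ('a \<times> 'a) measure"
  define B where "B p = norm (v - fst p) powr \<gamma> * b (sgn (v - fst p) \<bullet> snd p)" for p
  have B: "B p \<ge> 0" for p by (simp add: B_def b_nonneg)
  have [measurable]: "B \<in> borel_measurable (borel \<Otimes>\<^sub>M borel)"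
    unfolding B_def by measurable
  define P where "P g p = B p * maxwellian (post_star v (fst p) (snd p)) * g (post v (fst p) (snd p))"
    for g :: "'a \<Rightarrow> real" and p
  define S where "S p = B p * maxwellian (fst p)" for p
  have Pm: "P g \<in> borel_measurable (borel \<Otimes>\<^sub>M borel)" if [measurable]: "g \<in> borel_measurable borel" for g
    unfolding P_def post_star_def by measurable
  have Sm: "S \<in> borel_measurable (borel \<Otimes>\<^sub>M borel)" unfolding S_def by measurable
  have P: "integrable ?N (P g)" "integral\<^sup>L ?N (P g) = enn2real (gain (\<lambda>x. ennreal (g x)) v)"
    if g [measurable]: "g \<in> borel_measurable borel" and g0: "\<And>x. 0 \<le> g x"
      and gf: "gain (\<lambda>x. ennreal (g x)) v < \<infinity>" for g
  proof -
    have "(\<integral>\<^sup>+p. ennreal (P g p) \<partial>?N) = (\<integral>\<^sup>+w. \<integral>\<^sup>+\<omega>. ennreal (P g (w, \<omega>)) \<partial>usphere \<partial>lborel)"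
      using Pm[OF g] by (intro nn_integral_lborel_sphere_measure) measurable
    also have "\<dots> = gain (\<lambda>x. ennreal (g x)) v"
      by (subst gain_eq) (auto simp: P_def B_def ennreal_mult'' g0)
    finally have e: "(\<integral>\<^sup>+p. ennreal (P g p) \<partial>?N) = gain (\<lambda>x. ennreal (g x)) v" .
    have nn: "0 \<le> P g p" for p
      unfolding P_def by (intro mult_nonneg_nonneg B g0 less_imp_le[OF maxwellian_pos])
    show "integrable ?N (P g)" "integral\<^sup>L ?N (P g) = enn2real (gain (\<lambda>x. ennreal (g x)) v)"
      using integral_eq_enn2real_nn_integral[OF measurable_lborel_sphere_measure[OF Pm[OF g]] nn] gf e by auto
  qed
  have S: "integrable ?N S" "integral\<^sup>L ?N S = enn2real (sig v)"
  proof -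
    have "(\<integral>\<^sup>+p. ennreal (S p) \<partial>?N) = (\<integral>\<^sup>+w. \<integral>\<^sup>+\<omega>. ennreal (S (w, \<omega>)) \<partial>usphere \<partial>lborel)"
      using Sm by (intro nn_integral_lborel_sphere_measure) measurable
    also have "\<dots> = sig v"
      unfolding sig_def integral_kern[symmetric] unfolding kern_def by (simp add: S_def B_def)
    finally have e: "(\<integral>\<^sup>+p. ennreal (S p) \<partial>?N) = sig v" .
    have nn: "0 \<le> S p" for p
      unfolding S_def by (intro mult_nonneg_nonneg B less_imp_le[OF maxwellian_pos])
    obtain C where "sig v \<le> ennreal C" using sig_bounded by metis
    then have "sig v < \<infinity>" using le_less_trans by fastforce
    then show "integrable ?N S" "integral\<^sup>L ?N S = enn2real (sig v)"
      using integral_eq_enn2real_nn_integral[OF measurable_lborel_sphere_measure[OF Sm] nn] e by auto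
  qed
  have mono: "gain F v \<le> gain G v" if "\<And>x. F x \<le> G x" for F G
    unfolding gain_def A_def divide_ennreal_def
    by (intro mult_left_mono nn_integral_mono mult_right_mono that) auto
  define fp where "fp x = max 0 (f x)" for x
  define fm where "fm x = max 0 (- f x)" for x
  have [measurable]: "fp \<in> borel_measurable borel" "fm \<in> borel_measurable borel"
    unfolding fp_def fm_def by measurable
  have fpm: "f x = fp x - fm x" "fp x \<ge> 0" "fm x \<ge> 0" "fp x \<le> \<bar>f x\<bar>" "fm x \<le> \<bar>f x\<bar>"
      "ennreal (fp x) = ennreal (f x)" "ennreal (fm x) = ennreal (- f x)" for x
    by (auto simp: fp_def fm_def max_def ennreal_neg)
  have gp: "gain (\<lambda>x. ennreal (fp x)) v < \<infinity>" "gain (\<lambda>x. ennreal (fm x)) v < \<infinity>"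
    by (rule le_less_trans[OF mono fin], rule ennreal_leI, rule fpm)+
  have "boltzmann_op \<gamma> b f v = (\<integral>p. P fp p - P fm p - f v * S p \<partial>?N)"
    unfolding boltzmann_op_def
    by (rule arg_cong[where f="integral\<^sup>L ?N"], rule ext)
       (simp add: P_def S_def B_def case_prod_beta' fpm(1) algebra_simps)
  also have "\<dots> = integral\<^sup>L ?N (P fp) - integral\<^sup>L ?N (P fm) - f v * integral\<^sup>L ?N S"
    using P(1)[of fp] P(1)[of fm] S(1) fpm gp by simp
  also have "\<dots> = enn2real (gain (\<lambda>x. ennreal (fp x)) v) - enn2real (gain (\<lambda>x. ennreal (fm x)) v) - f v * enn2real (sig v)"
    using P(2)[of fp] P(2)[of fm] S(2) fpm(2,3) gp by simp
  finally show ?thesis by (simp add: fpm(6,7) mult.commute)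
qed

lemma boltzmann_op_maxwellian: "boltzmann_op \<gamma> b (maxwellian :: 'a \<Rightarrow> real) v = 0"
proof -
  have "boltzmann_op \<gamma> b (maxwellian :: 'a \<Rightarrow> real) v = (\<integral>p. 0 \<partial>(lborel \<Otimes>\<^sub>M sphere_measure :: ('a \<times> 'a) measure))"
    unfolding boltzmann_op_def
    by (rule Bochner_Integration.integral_cong[OF refl])
       (auto simp: space_pair_measure space_sphere_measure maxwellian_collision)
  then show ?thesis by simp
qed

lemma borel_measurable_boltzmann_op:
  assumes [measurable]: "f \<in> borel_measurable (borel :: 'a measure)"
  shows "boltzmann_op \<gamma> b f \<in> borel_measurable borel"
proof -
  have id [measurable]: "(\<lambda>p. snd p) \<in> borel \<Otimes>\<^sub>M sphere_measure \<rightarrow>\<^sub>M (borel :: 'a measure)"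
    by (rule measurable_compose[OF measurable_snd measurable_ident_sphere_measure])
  have [measurable]: "(\<lambda>p. snd (snd p)) \<in> borel \<Otimes>\<^sub>M (lborel \<Otimes>\<^sub>M sphere_measure) \<rightarrow>\<^sub>M (borel :: 'a measure)"
    by (rule measurable_compose[OF measurable_snd measurable_compose[OF measurable_snd measurable_ident_sphere_measure]])
  interpret ls: pair_sigma_finite "lborel :: 'a measure" "sphere_measure :: 'a measure" ..
  have sf: "sigma_finite_measure (lborel \<Otimes>\<^sub>M sphere_measure :: ('a \<times> 'a) measure)"
    by (rule ls.sigma_finite_measure_axioms)
  show ?thesis
    unfolding boltzmann_op_def[abs_def]
    by (rule sigma_finite_measure.borel_measurable_lebesgue_integral[OF sf])
       (unfold case_prod_beta' post_def post_star_def, measurable)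
qed

end

subsection \<open>Weighted spaces\<close>

lemma L1wD:
  assumes "f \<in> L1w s"
  shows "f \<in> borel_measurable borel" "integrable lborel (\<lambda>v. bracket v powr s * \<bar>f v\<bar>)"
  using assms by (auto simp: L1w_def)

lemma nn_integral_L1w:
  assumes "f \<in> L1w s"
  shows "(\<integral>\<^sup>+v. ennreal (bracket v powr s) * ennreal \<bar>f v\<bar> \<partial>lborel) = ennreal (norm_L1w s f)"
  using nn_integral_eq_integral[OF L1wD(2)[OF assms]]
  by (simp add: norm_L1w_def ennreal_mult'[symmetric])

lemma L1wI:
  assumes [measurable]: "f \<in> borel_measurable borel"
    and le: "(\<integral>\<^sup>+v. ennreal (bracket v powr s) * ennreal \<bar>f v\<bar> \<partial>lborel) \<le> ennreal c" and c: "0 \<le> c"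
  shows "f \<in> L1w s" "norm_L1w s f \<le> c"
proof -
  have e: "(\<integral>\<^sup>+v. ennreal (bracket v powr s * \<bar>f v\<bar>) \<partial>lborel) \<le> ennreal c"
    using le by (simp add: ennreal_mult'[symmetric])
  then have "integrable lborel (\<lambda>v. bracket v powr s * \<bar>f v\<bar>)"
    by (intro integrableI_nonneg) (auto intro: le_less_trans)
  then show "f \<in> L1w s" by (simp add: L1w_def)
  have "norm_L1w s f = enn2real (\<integral>\<^sup>+v. ennreal (bracket v powr s * \<bar>f v\<bar>) \<partial>lborel)"
    unfolding norm_L1w_def by (intro integral_eq_nn_integral) auto
  also have "\<dots> \<le> c" using e c by (intro enn2real_leI)
  finally show "norm_L1w s f \<le> c" .
qed

lemma L1w_mono:
  assumes "f \<in> L1w s" "k \<le> s"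
  shows "f \<in> L1w k" "norm_L1w k f \<le> norm_L1w s f"
proof -
  have 0: "0 \<le> norm_L1w s f" unfolding norm_L1w_def by (intro integral_nonneg_AE) auto
  have "(\<integral>\<^sup>+v. ennreal (bracket v powr k) * ennreal \<bar>f v\<bar> \<partial>lborel) \<le>
      (\<integral>\<^sup>+v. ennreal (bracket v powr s) * ennreal \<bar>f v\<bar> \<partial>lborel)"
    using assms(2) bracket_ge_1 by (intro nn_integral_mono mult_right_mono ennreal_leI powr_mono) auto
  also have "\<dots> = ennreal (norm_L1w s f)" by (rule nn_integral_L1w[OF assms(1)])
  finally show "f \<in> L1w k" "norm_L1w k f \<le> norm_L1w s f"
    using L1wI[OF L1wD(1)[OF assms(1)]] 0 by blast+
qed

lemma L1w_0: "f \<in> L1w 0 \<longleftrightarrow> f \<in> L1" "norm_L1w 0 f = norm_L1 f"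
proof -
  have "bracket v powr 0 = 1" for v :: 'a using bracket_ge_1[of v] by simp
  note [simp] = this
  show "f \<in> L1w 0 \<longleftrightarrow> f \<in> L1"
    unfolding L1w_def L1_def
    using borel_measurable_integrable[of lborel f] integrable_abs_iff[of f lborel] by auto
  show "norm_L1w 0 f = norm_L1 f"
    by (simp add: norm_L1w_def norm_L1_def)
qed

lemma L1_borel: "f \<in> L1 \<Longrightarrow> f \<in> borel_measurable borel"
  by (auto simp: L1_def dest: borel_measurable_integrable)

lemma nn_integral_norm_L1:
  assumes "f \<in> L1"
  shows "(\<integral>\<^sup>+v. ennreal \<bar>f v\<bar> \<partial>lborel) = ennreal (norm_L1 f)"
  using nn_integral_L1w[of f 0] assms by (simp add: L1w_0)

lemma L1I:
  assumes "f \<in> borel_measurable borel" "(\<integral>\<^sup>+v. ennreal \<bar>f v\<bar> \<partial>lborel) \<le> ennreal c" "0 \<le> c"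
  shows "f \<in> L1" "norm_L1 f \<le> c"
  using L1wI[of f 0 c] assms by (simp_all add: L1w_0)

lemma L1w_nonneg_imp_L1:
  assumes "f \<in> L1w s" "0 \<le> s"
  shows "f \<in> L1" "norm_L1 f \<le> norm_L1w s f"
  using L1w_mono[OF assms] by (simp_all add: L1w_0)

lemma norm_L1w_nonneg: "0 \<le> norm_L1w s f"
  unfolding norm_L1w_def by (intro integral_nonneg_AE) auto

lemma norm_L1_nonneg: "0 \<le> norm_L1 f"
  unfolding norm_L1_def by (intro integral_nonneg_AE) auto

text \<open>Splitting at \<open>bracket v = \<rho>\<close> and optimising over \<open>\<rho>\<close> replaces Hoelder's inequality.\<close>

lemma norm_L1w_interpolate:
  assumes f: "f \<in> L1w s" and "\<gamma> \<le> 0" "k \<le> s" "\<rho> > 0"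
  shows "\<rho> powr \<gamma> * (norm_L1w k f - \<rho> powr (k - s) * norm_L1w s f) \<le> norm_L1w (k + \<gamma>) f"
proof -
  have i: "integrable lborel (\<lambda>v. bracket v powr r * \<bar>f v\<bar>)" if "r \<le> s" for r
    by (rule L1wD(2)[OF L1w_mono(1)[OF f that]])
  have pt: "bracket v powr k \<le> \<rho> powr (- \<gamma>) * bracket v powr (k + \<gamma>) + \<rho> powr (k - s) * bracket v powr s" for v :: 'a
  proof (cases "bracket v \<le> \<rho>")
    case True
    have "bracket v powr k = bracket v powr (- \<gamma>) * bracket v powr (k + \<gamma>)"
      by (simp add: powr_add[symmetric])
    also have "\<dots> \<le> \<rho> powr (- \<gamma>) * bracket v powr (k + \<gamma>)"
      using True assms bracket_ge_1[of v] by (intro mult_right_mono powr_mono2) auto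
    finally show ?thesis by (simp add: add_increasing2)
  next
    case False
    have "bracket v powr k = bracket v powr (k - s) * bracket v powr s"
      by (simp add: powr_add[symmetric])
    also have "\<dots> \<le> \<rho> powr (k - s) * bracket v powr s"
      using False assms by (intro mult_right_mono powr_mono2') auto
    finally show ?thesis by (simp add: add_increasing)
  qed
  have "norm_L1w k f \<le> (\<integral>v. \<rho> powr (- \<gamma>) * (bracket v powr (k + \<gamma>) * \<bar>f v\<bar>) + \<rho> powr (k - s) * (bracket v powr s * \<bar>f v\<bar>) \<partial>lborel)"
    unfolding norm_L1w_def
  proof (rule integral_mono)
    fix v
    show "bracket v powr k * \<bar>f v\<bar> \<le> \<rho> powr (- \<gamma>) * (bracket v powr (k + \<gamma>) * \<bar>f v\<bar>) + \<rho> powr (k - s) * (bracket v powr s * \<bar>f v\<bar>)"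
      using mult_right_mono[OF pt[of v], of "\<bar>f v\<bar>"] by (simp add: algebra_simps)
  qed (use i[of k] i[of "k + \<gamma>"] i[of s] assms in auto)
  also have "\<dots> = \<rho> powr (- \<gamma>) * norm_L1w (k + \<gamma>) f + \<rho> powr (k - s) * norm_L1w s f"
    unfolding norm_L1w_def using i[of "k + \<gamma>"] i[of s] assms by simp
  finally have "\<rho> powr \<gamma> * (norm_L1w k f - \<rho> powr (k - s) * norm_L1w s f) \<le> \<rho> powr \<gamma> * (\<rho> powr (- \<gamma>) * norm_L1w (k + \<gamma>) f)"
    by (intro mult_left_mono) auto
  also have "\<dots> = norm_L1w (k + \<gamma>) f"
    using \<open>\<rho> > 0\<close> by (simp add: mult.assoc[symmetric] powr_add[symmetric])
  finally show ?thesis .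
qed

text \<open>Discrete form of \<open>y' = - a * y powr (1 + 1 / \<tau>)\<close>: as long as
  \<open>y\<close> is positive, \<open>y n powr (- (1 / \<tau>))\<close> grows by at least
  \<open>h * a / \<tau>\<close> per step. \<open>C\<close> depends on neither \<open>h\<close> nor
  \<open>y\<close>, which later lets the step size tend to 0.\<close>

lemma decay_of_nonlinear_recursion:
  fixes \<tau> a Y :: real
  assumes "\<tau> > 0" "a > 0" "Y > 0"
  shows "\<exists>C>0. \<forall>(h::real) (y :: nat \<Rightarrow> real) n. 0 \<le> h \<longrightarrow> (\<forall>n. 0 \<le> y n) \<longrightarrow> y 0 \<le> Y \<longrightarrow>
       (\<forall>n. y (Suc n) \<le> y n - h * (a * y n powr (1 + 1 / \<tau>))) \<longrightarrow> y n \<le> C * (1 + real n * h) powr (- \<tau>)"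
proof -
  \<comment> \<open>The smaller of the guaranteed initial value and the guaranteed slope of
    \<open>y n powr (- (1 / \<tau>))\<close>.\<close>
  define m where "m = min (Y powr (- (1 / \<tau>))) (a / \<tau>)"
  have m: "m > 0" using assms by (simp add: m_def)
  have main: "y n \<le> m powr (- \<tau>) * (1 + real n * h) powr (- \<tau>)"
    if h: "0 \<le> h" and y0: "\<And>n. 0 \<le> y n" and yY: "y 0 \<le> Y"
      and step: "\<And>n. y (Suc n) \<le> y n - h * (a * y n powr (1 + 1 / \<tau>))"
    for h :: real and y :: "nat \<Rightarrow> real" and n
  proof -
    have dec: "y (Suc n) \<le> y n" for n
      using step[of n] h assms y0[of n] by (smt (verit) mult_nonneg_nonneg powr_ge_zero)
    have claim: "m * (1 + real n * h) \<le> y n powr (- (1 / \<tau>))" if "y n > 0" for n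
      using that
    proof (induction n)
      case 0
      have "m \<le> Y powr (- (1 / \<tau>))" by (simp add: m_def)
      also have "\<dots> \<le> y 0 powr (- (1 / \<tau>))" using 0 yY assms by (intro powr_mono2') auto
      finally show ?case by simp
    next
      case (Suc n)
      have yn: "y n > 0" using Suc.prems dec[of n] by simp
      define x where "x = h * a * y n powr (1 / \<tau>)"
      have st: "y (Suc n) \<le> y n * (1 - x)"
        using step[of n] yn by (simp add: x_def powr_add algebra_simps)
      then have x1: "x < 1"
        using Suc.prems yn by (smt (verit) mult_nonneg_nonpos)
      \<comment> \<open>A Bernoulli-type inequality, from \<open>ln (1 - x) \<le> - x\<close>; it
        converts the multiplicative decrease of \<open>y\<close> into an additive increase of its
        negative power.\<close>
      have "1 + x / \<tau> \<le> exp (x / \<tau>)" by (rule exp_ge_add_one_self)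
      also have "\<dots> \<le> exp (- (1 / \<tau>) * ln (1 - x))"
        using ln_le_minus_one[of "1 - x"] x1 assms by (simp add: field_simps)
      also have "\<dots> = (1 - x) powr (- (1 / \<tau>))" using x1 by (simp add: powr_def)
      finally have e: "1 + x / \<tau> \<le> (1 - x) powr (- (1 / \<tau>))" .
      have "m * (1 + real (Suc n) * h) = m * (1 + real n * h) + h * m" by (simp add: algebra_simps)
      also have "\<dots> \<le> y n powr (- (1 / \<tau>)) + h * (a / \<tau>)"
        using Suc.IH[OF yn] h by (intro add_mono mult_left_mono) (auto simp: m_def)
      also have "\<dots> = y n powr (- (1 / \<tau>)) * (1 + x / \<tau>)"
      proof -
        have "y n powr (- (1 / \<tau>)) * y n powr (1 / \<tau>) = 1" using yn by (simp add: powr_add[symmetric])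
        then show ?thesis by (simp add: x_def algebra_simps)
      qed
      also have "\<dots> \<le> y n powr (- (1 / \<tau>)) * (1 - x) powr (- (1 / \<tau>))"
        using e by (intro mult_left_mono) auto
      also have "\<dots> = (y n * (1 - x)) powr (- (1 / \<tau>))" by (simp add: powr_mult)
      also have "\<dots> \<le> y (Suc n) powr (- (1 / \<tau>))"
        using Suc.prems st assms by (intro powr_mono2') auto
      finally show ?case .
    qed
    show ?thesis
    proof (cases "y n = 0")
      case False
      then have yn: "y n > 0" using y0[of n] by simp
      have pos: "m * (1 + real n * h) > 0" using m h by (simp add: add_pos_nonneg)
      have "y n = (y n powr (- (1 / \<tau>))) powr (- \<tau>)" using yn assms by (simp add: powr_powr)
      also have "\<dots> \<le> (m * (1 + real n * h)) powr (- \<tau>)"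
        using claim[OF yn] pos assms by (intro powr_mono2') auto
      also have "\<dots> = m powr (- \<tau>) * (1 + real n * h) powr (- \<tau>)" by (rule powr_mult)
      finally show ?thesis .
    qed simp
  qed
  show ?thesis using m main by (intro exI[of _ "m powr (- \<tau>)"]) auto
qed

context soft_kernel
begin

subsection \<open>Explicit Euler steps\<close>

definition euler :: "real \<Rightarrow> ('a \<Rightarrow> real) \<Rightarrow> 'a \<Rightarrow> real" where
  "euler h f v = f v + h * boltzmann_op \<gamma> b f v"

lemma borel_measurable_euler:
  assumes "f \<in> borel_measurable borel"
  shows "euler h f \<in> borel_measurable borel"
proof -
  note [measurable] = borel_measurable_boltzmann_op[OF assms] assms
  show ?thesis unfolding euler_def[abs_def] by measurable
qed

lemma nn_integral_gain_one:
  assumes "F \<in> borel_measurable borel"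
  shows "(\<integral>\<^sup>+v. gain F v \<partial>lborel) = (\<integral>\<^sup>+v. F v * sig v \<partial>lborel)"
  using nn_integral_gain[OF assms, of "\<lambda>_. 1"] by (simp add: A_one)

lemma AE_gain_finite:
  fixes f :: "'a \<Rightarrow> real"
  assumes "f \<in> L1"
  shows "AE v in lborel. gain (\<lambda>x. ennreal \<bar>f x\<bar>) v < \<infinity>"
proof -
  have [measurable]: "f \<in> borel_measurable borel" and "integrable lborel f"
    using assms by (auto simp: L1_def dest: borel_measurable_integrable)
  obtain S where S: "S > 0" "\<And>v. sig v \<le> ennreal S" using sig_bounded by metis
  have "(\<integral>\<^sup>+v. gain (\<lambda>x. ennreal \<bar>f x\<bar>) v \<partial>lborel) \<le> (\<integral>\<^sup>+v. ennreal \<bar>f v\<bar> * ennreal S \<partial>lborel)"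
    by (subst nn_integral_gain_one) (auto intro!: nn_integral_mono mult_left_mono S)
  also have "\<dots> < \<infinity>"
    using \<open>integrable lborel f\<close> by (simp add: nn_integral_multc ennreal_mult_less_top integrable_iff_bounded)
  finally have "(\<integral>\<^sup>+v. gain (\<lambda>x. ennreal \<bar>f x\<bar>) v \<partial>lborel) \<noteq> \<infinity>" by simp
  then have "AE v in lborel. gain (\<lambda>x. ennreal \<bar>f x\<bar>) v \<noteq> \<infinity>"
    by (intro nn_integral_PInf_AE) measurable
  then show ?thesis by eventually_elim (simp add: less_top)
qed

text \<open>Real representatives of all terms at once. That the gain of \<open>\<bar>f\<bar>\<close>
  is exactly \<open>kp + km\<close> is what later makes \<open>\<bar>kp - km\<bar>\<close> smaller
  by twice a common lower bound.\<close>

lemma AE_boltzmann_op_split: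
  fixes f :: "'a \<Rightarrow> real"
  assumes f: "f \<in> L1"
  shows "AE v in lborel. \<exists>kp km \<sigma>. 0 \<le> kp \<and> 0 \<le> km \<and> 0 \<le> \<sigma> \<and>
    gain (\<lambda>x. ennreal (f x)) v = ennreal kp \<and> gain (\<lambda>x. ennreal (- f x)) v = ennreal km \<and>
    gain (\<lambda>x. ennreal \<bar>f x\<bar>) v = ennreal (kp + km) \<and> sig v = ennreal \<sigma> \<and>
    boltzmann_op \<gamma> b f v = kp - km - \<sigma> * f v"
  using AE_gain_finite[OF f]
proof eventually_elim
  case (elim v)
  have fb [measurable]: "f \<in> borel_measurable borel"
    by (rule L1_borel[OF f])
  have "ennreal \<bar>x\<bar> = ennreal x + ennreal (- x)" for x :: real
    by (cases "x \<ge> 0") (auto simp: ennreal_neg)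
  then have g: "gain (\<lambda>x. ennreal \<bar>f x\<bar>) v = gain (\<lambda>x. ennreal (f x)) v + gain (\<lambda>x. ennreal (- f x)) v"
    by (simp add: gain_add)
  have "gain (\<lambda>x. ennreal (f x)) v < top" "gain (\<lambda>x. ennreal (- f x)) v < top"
    using elim g by auto
  moreover obtain S where "sig v \<le> ennreal S" using sig_bounded by metis
  then have "sig v < top" by (rule le_less_trans) simp
  ultimately show ?case
    unfolding boltzmann_op_eq[OF fb elim] g
    by (intro exI[of _ "enn2real (gain (\<lambda>x. ennreal (f x)) v)"]
        exI[of _ "enn2real (gain (\<lambda>x. ennreal (- f x)) v)"] exI[of _ "enn2real (sig v)"])
      (simp add: ennreal_plus)
qed

text \<open>The condition \<open>h * S \<le> 1\<close> keeps the factor \<open>1 - h * sig v\<close>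
  nonnegative. On the ball the gains of the positive and of the negative part are both at least
  \<open>c * m\<close>; this common part cancels, which saves \<open>2 * h * c * m\<close>.\<close>

lemma AE_euler_le:
  fixes f :: "'a \<Rightarrow> real"
  assumes f: "f \<in> L1" and S: "\<And>v. sig v \<le> ennreal S" "S \<ge> 0" and h: "0 \<le> h" "h * S \<le> 1"
    and c: "c \<ge> 0" "\<And>F v. F \<in> borel_measurable borel \<Longrightarrow> norm v \<le> R \<Longrightarrow>
      ennreal c * (\<integral>\<^sup>+y. indicator (cball 0 R) y * F y \<partial>lborel) \<le> gain F v"
    and m: "m \<ge> 0" "ennreal m \<le> (\<integral>\<^sup>+y. indicator (cball 0 R) y * ennreal (f y) \<partial>lborel)"
      "ennreal m \<le> (\<integral>\<^sup>+y. indicator (cball 0 R) y * ennreal (- f y) \<partial>lborel)"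
  shows "AE v in lborel. ennreal \<bar>euler h f v\<bar> + ennreal h * (sig v * ennreal \<bar>f v\<bar>) +
      ennreal (2 * h * c * m) * indicator (cball 0 R) v \<le>
      ennreal \<bar>f v\<bar> + ennreal h * gain (\<lambda>x. ennreal \<bar>f x\<bar>) v"
  using AE_boltzmann_op_split[OF f]
proof eventually_elim
  case (elim v)
  have [measurable]: "f \<in> borel_measurable borel"
    by (rule L1_borel[OF f])
  obtain kp km \<sigma> where kp: "gain (\<lambda>x. ennreal (f x)) v = ennreal kp" "kp \<ge> 0"
    and km: "gain (\<lambda>x. ennreal (- f x)) v = ennreal km" "km \<ge> 0"
    and g: "gain (\<lambda>x. ennreal \<bar>f x\<bar>) v = ennreal (kp + km)"
    and \<sigma>: "sig v = ennreal \<sigma>" "\<sigma> \<ge> 0"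
    and op: "boltzmann_op \<gamma> b f v = kp - km - \<sigma> * f v"
    using elim by blast
  have "\<sigma> \<le> S" using S(1)[of v] S(2) \<sigma> by simp
  then have h\<sigma>: "h * \<sigma> \<le> 1" using h mult_left_mono[of \<sigma> S h] by linarith
  define i where "i = (indicator (cball 0 R) v :: real)"
  have i: "c * m * i \<le> kp" "c * m * i \<le> km" "i \<ge> 0"
  proof -
    show "i \<ge> 0" by (simp add: i_def)
    show "c * m * i \<le> kp"
    proof (cases "norm v \<le> R")
      case True
      have "ennreal c * ennreal m \<le> ennreal c * (\<integral>\<^sup>+y. indicator (cball 0 R) y * ennreal (f y) \<partial>lborel)"
        by (rule mult_left_mono[OF m(2)]) simp
      also have "\<dots> \<le> ennreal kp"
        unfolding kp(1)[symmetric] by (rule c(2)[OF _ True]) measurable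
      finally show ?thesis using True c m kp by (simp add: i_def ennreal_mult'[symmetric])
    qed (use kp in \<open>simp add: i_def\<close>)
    show "c * m * i \<le> km"
    proof (cases "norm v \<le> R")
      case True
      have "ennreal c * ennreal m \<le> ennreal c * (\<integral>\<^sup>+y. indicator (cball 0 R) y * ennreal (- f y) \<partial>lborel)"
        by (rule mult_left_mono[OF m(3)]) simp
      also have "\<dots> \<le> ennreal km"
        unfolding km(1)[symmetric] by (rule c(2)[OF _ True]) measurable
      finally show ?thesis using True c m km by (simp add: i_def ennreal_mult'[symmetric])
    qed (use km in \<open>simp add: i_def\<close>)
  qed
  have "euler h f v = (1 - h * \<sigma>) * f v + h * (kp - km)"
    unfolding euler_def op by (simp add: algebra_simps)
  then have "\<bar>euler h f v\<bar> \<le> (1 - h * \<sigma>) * \<bar>f v\<bar> + h * \<bar>kp - km\<bar>"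
    using abs_triangle_ineq[of "(1 - h * \<sigma>) * f v" "h * (kp - km)"] h h\<sigma> by (simp add: abs_mult)
  also have "\<dots> \<le> (1 - h * \<sigma>) * \<bar>f v\<bar> + h * (kp + km - 2 * (c * m * i))"
    using i h by (intro add_left_mono mult_left_mono) (auto simp: abs_if)
  finally have real: "\<bar>euler h f v\<bar> + h * (\<sigma> * \<bar>f v\<bar>) + 2 * h * c * m * i \<le> \<bar>f v\<bar> + h * (kp + km)"
    by (simp add: algebra_simps)
  have ii: "indicator (cball 0 R) v = ennreal i" by (simp add: i_def indicator_def)
  have "ennreal \<bar>euler h f v\<bar> + ennreal h * (sig v * ennreal \<bar>f v\<bar>) + ennreal (2 * h * c * m) * indicator (cball 0 R) v =
      ennreal (\<bar>euler h f v\<bar> + h * (\<sigma> * \<bar>f v\<bar>) + 2 * h * c * m * i)"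
    using h \<sigma> c m i by (simp add: ii \<sigma>(1) ennreal_mult'[symmetric] ennreal_plus[symmetric] del: ennreal_plus)
  also have "\<dots> \<le> ennreal (\<bar>f v\<bar> + h * (kp + km))" using real by (rule ennreal_leI)
  also have "\<dots> = ennreal \<bar>f v\<bar> + ennreal h * gain (\<lambda>x. ennreal \<bar>f x\<bar>) v"
    using h kp km unfolding g
    by (simp add: ennreal_mult'[symmetric] ennreal_plus[symmetric] del: ennreal_plus)
  finally show ?case .
qed

text \<open>The pointwise bound integrated against \<open>W\<close>, with the gain moved to
  \<open>A W\<close> by duality. The choice \<open>W = 1\<close> yields contraction and coupling, a
  power of \<open>bracket\<close> yields the drift.\<close>

lemma nn_integral_euler_le:
  fixes f :: "'a \<Rightarrow> real"
  assumes f: "f \<in> L1" and S: "\<And>v. sig v \<le> ennreal S" "S \<ge> 0" and h: "0 \<le> h" "h * S \<le> 1"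
    and c: "c \<ge> 0" "\<And>F v. F \<in> borel_measurable borel \<Longrightarrow> norm v \<le> R \<Longrightarrow>
      ennreal c * (\<integral>\<^sup>+y. indicator (cball 0 R) y * F y \<partial>lborel) \<le> gain F v"
    and m: "m \<ge> 0" "ennreal m \<le> (\<integral>\<^sup>+y. indicator (cball 0 R) y * ennreal (f y) \<partial>lborel)"
      "ennreal m \<le> (\<integral>\<^sup>+y. indicator (cball 0 R) y * ennreal (- f y) \<partial>lborel)"
    and W [measurable]: "W \<in> borel_measurable borel"
  shows "(\<integral>\<^sup>+v. W v * ennreal \<bar>euler h f v\<bar> \<partial>lborel) + ennreal h * (\<integral>\<^sup>+v. W v * (sig v * ennreal \<bar>f v\<bar>) \<partial>lborel) +
      ennreal (2 * h * c * m) * (\<integral>\<^sup>+v. W v * indicator (cball 0 R) v \<partial>lborel) \<le>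
      (\<integral>\<^sup>+v. W v * ennreal \<bar>f v\<bar> \<partial>lborel) + ennreal h * (\<integral>\<^sup>+v. ennreal \<bar>f v\<bar> * A W v \<partial>lborel)"
proof -
  have fb [measurable]: "f \<in> borel_measurable borel"
    by (rule L1_borel[OF f])
  have [measurable]: "cball (0::'a) R \<in> sets borel" by simp
  note [measurable] = borel_measurable_euler[OF fb, of h]
  have "(\<integral>\<^sup>+v. W v * ennreal \<bar>euler h f v\<bar> \<partial>lborel) + ennreal h * (\<integral>\<^sup>+v. W v * (sig v * ennreal \<bar>f v\<bar>) \<partial>lborel) +
      ennreal (2 * h * c * m) * (\<integral>\<^sup>+v. W v * indicator (cball 0 R) v \<partial>lborel) =
      (\<integral>\<^sup>+v. W v * (ennreal \<bar>euler h f v\<bar> + ennreal h * (sig v * ennreal \<bar>f v\<bar>) +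
      ennreal (2 * h * c * m) * indicator (cball 0 R) v) \<partial>lborel)"
    by (simp add: nn_integral_cmult[symmetric] nn_integral_add[symmetric] distrib_left mult_ac)
  also have "\<dots> \<le> (\<integral>\<^sup>+v. W v * (ennreal \<bar>f v\<bar> + ennreal h * gain (\<lambda>x. ennreal \<bar>f x\<bar>) v) \<partial>lborel)"
    by (rule nn_integral_mono_AE) (use AE_euler_le[OF f S h c m] in \<open>auto elim!: eventually_mono intro: mult_left_mono\<close>)
  also have "\<dots> = (\<integral>\<^sup>+v. W v * ennreal \<bar>f v\<bar> \<partial>lborel) + ennreal h * (\<integral>\<^sup>+v. W v * gain (\<lambda>x. ennreal \<bar>f x\<bar>) v \<partial>lborel)"
    by (simp add: nn_integral_cmult[symmetric] nn_integral_add[symmetric] distrib_left mult_ac)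
  also have "(\<integral>\<^sup>+v. W v * gain (\<lambda>x. ennreal \<bar>f x\<bar>) v \<partial>lborel) = (\<integral>\<^sup>+v. ennreal \<bar>f v\<bar> * A W v \<partial>lborel)"
    by (rule nn_integral_gain) measurable
  finally show ?thesis .
qed


section \<open>Euler steps in plain and weighted norms\<close>

lemma boltzmann_op_L1:
  fixes f :: "'a \<Rightarrow> real"
  assumes S: "\<And>v. sig v \<le> ennreal S" "S \<ge> 0" and f: "f \<in> L1"
  shows "boltzmann_op \<gamma> b f \<in> L1" "norm_L1 (boltzmann_op \<gamma> b f) \<le> 2 * S * norm_L1 f"
proof -
  have fb [measurable]: "f \<in> borel_measurable borel"
    by (rule L1_borel[OF f])
  note [measurable] = borel_measurable_boltzmann_op[OF fb]
  note nf = nn_integral_norm_L1[OF f]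
  have "AE v in lborel. ennreal \<bar>boltzmann_op \<gamma> b f v\<bar> \<le> gain (\<lambda>x. ennreal \<bar>f x\<bar>) v + sig v * ennreal \<bar>f v\<bar>"
    using AE_boltzmann_op_split[OF f]
  proof eventually_elim
    case (elim v)
    then obtain kp km \<sigma> where pos: "kp \<ge> 0" "km \<ge> 0" "\<sigma> \<ge> 0"
      and g: "gain (\<lambda>x. ennreal \<bar>f x\<bar>) v = ennreal (kp + km)" and \<sigma>: "sig v = ennreal \<sigma>"
      and op: "boltzmann_op \<gamma> b f v = kp - km - \<sigma> * f v"
      by blast
    have "\<bar>boltzmann_op \<gamma> b f v\<bar> \<le> kp + km + \<bar>\<sigma> * f v\<bar>"
      unfolding op using pos by linarith
    also have "\<bar>\<sigma> * f v\<bar> = \<sigma> * \<bar>f v\<bar>" using pos by (simp add: abs_mult)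
    finally have "ennreal \<bar>boltzmann_op \<gamma> b f v\<bar> \<le> ennreal (kp + km + \<sigma> * \<bar>f v\<bar>)"
      by (rule ennreal_leI)
    then show ?case
      using pos unfolding g \<sigma>
      by (simp add: ennreal_mult'[symmetric] ennreal_plus[symmetric] del: ennreal_plus)
  qed
  then have "(\<integral>\<^sup>+v. ennreal \<bar>boltzmann_op \<gamma> b f v\<bar> \<partial>lborel) \<le>
      (\<integral>\<^sup>+v. gain (\<lambda>x. ennreal \<bar>f x\<bar>) v + sig v * ennreal \<bar>f v\<bar> \<partial>lborel)"
    by (rule nn_integral_mono_AE)
  also have "\<dots> = (\<integral>\<^sup>+v. ennreal \<bar>f v\<bar> * sig v \<partial>lborel) + (\<integral>\<^sup>+v. sig v * ennreal \<bar>f v\<bar> \<partial>lborel)"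
    by (simp add: nn_integral_add nn_integral_gain_one)
  also have "\<dots> \<le> (\<integral>\<^sup>+v. ennreal \<bar>f v\<bar> * ennreal S \<partial>lborel) + (\<integral>\<^sup>+v. ennreal S * ennreal \<bar>f v\<bar> \<partial>lborel)"
    by (intro add_mono nn_integral_mono mult_left_mono mult_right_mono S) auto
  also have "\<dots> = ennreal (norm_L1 f) * ennreal S + ennreal S * ennreal (norm_L1 f)"
    by (simp add: nn_integral_multc nn_integral_cmult nf)
  also have "\<dots> = ennreal (2 * S * norm_L1 f)"
    using S(2) norm_L1_nonneg[of f]
    by (simp add: ennreal_mult'[symmetric] ennreal_mult''[symmetric] ennreal_plus[symmetric] algebra_simps del: ennreal_plus)
  finally have e: "(\<integral>\<^sup>+v. ennreal \<bar>boltzmann_op \<gamma> b f v\<bar> \<partial>lborel) \<le> ennreal (2 * S * norm_L1 f)" .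
  then show "boltzmann_op \<gamma> b f \<in> L1" "norm_L1 (boltzmann_op \<gamma> b f) \<le> 2 * S * norm_L1 f"
    using L1I[OF borel_measurable_boltzmann_op[OF fb] e] S(2) norm_L1_nonneg[of f] by simp_all
qed

lemma euler_contraction:
  assumes S: "\<And>v. sig v \<le> ennreal S" "S \<ge> 0" and h: "0 \<le> h" "h * S \<le> 1" and f: "f \<in> L1"
  shows "euler h f \<in> L1" "norm_L1 (euler h f) \<le> norm_L1 f"
proof -
  have fb [measurable]: "f \<in> borel_measurable borel"
    by (rule L1_borel[OF f])
  note nf = nn_integral_norm_L1[OF f]
  let ?I = "\<integral>\<^sup>+v. sig v * ennreal \<bar>f v\<bar> \<partial>lborel"
  have "?I \<le> (\<integral>\<^sup>+v. ennreal S * ennreal \<bar>f v\<bar> \<partial>lborel)"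
    by (intro nn_integral_mono mult_right_mono S) auto
  also have "\<dots> < top"
    by (simp add: nn_integral_cmult nf ennreal_mult_less_top)
  \<comment> \<open>Finiteness lets the loss be cancelled against the gain; for the weight 1 the two
    agree because \<open>A\<close> maps 1 to \<open>sig\<close>.\<close>
  finally have I: "ennreal h * ?I \<noteq> top" by (simp add: ennreal_mult_eq_top_iff less_top)
  have "(\<integral>\<^sup>+v. ennreal \<bar>euler h f v\<bar> \<partial>lborel) + ennreal h * ?I \<le> ennreal (norm_L1 f) + ennreal h * ?I"
    using nn_integral_euler_le[OF f S h, of 0 1 0 "\<lambda>_. 1"] by (simp add: A_one nf mult.commute)
  then have e: "(\<integral>\<^sup>+v. ennreal \<bar>euler h f v\<bar> \<partial>lborel) \<le> ennreal (norm_L1 f)"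
    using I by (simp add: add.commute[of _ "ennreal h * ?I"] ennreal_add_left_cancel_le)
  then show "euler h f \<in> L1" "norm_L1 (euler h f) \<le> norm_L1 f"
    using L1I[OF borel_measurable_euler[OF fb] e norm_L1_nonneg] by simp_all
qed

text \<open>
  The Lyapunov functional is \<open>\<parallel>f\<parallel>\<^sub>k + \<Lambda> \<parallel>f\<parallel>\<^sub>1\<close>: the coupling of \<open>f\<^sup>+\<close> and \<open>f\<^sup>-\<close> inside a fixed
  large ball, weighted by \<open>\<Lambda>\<close>, absorbs the lower-order term of the drift estimate.
\<close>

lemma euler_lyapunov:
  assumes S: "\<And>v. sig v \<le> ennreal S" "S \<ge> 0" and k: "k > - \<gamma>"
  obtains \<Lambda> a where "\<Lambda> \<ge> 0" "a > 0"
    "\<And>f h. f \<in> L1w k \<Longrightarrow> (\<integral>v. f v \<partial>lborel) = 0 \<Longrightarrow> 0 \<le> h \<Longrightarrow> h * S \<le> 1 \<Longrightarrow>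
      euler h f \<in> L1w k \<and>
      norm_L1w k (euler h f) + \<Lambda> * norm_L1 (euler h f) + h * (a * norm_L1w (k + \<gamma>) f) \<le>
      norm_L1w k f + \<Lambda> * norm_L1 f"
proof -
  have k0: "k > 0" using k gamma by simp
  \<comment> \<open>The weight left after the loss of \<open>\<bar>\<gamma>\<bar>\<close> powers.
    The assumption on \<open>k\<close> makes it positive, so that the mass outside a large ball is
    small relative to this norm.\<close>
  define r where "r = k + \<gamma>"
  have r: "r > 0" "r \<le> k" using k gamma by (simp_all add: r_def)
  obtain \<delta> C where \<delta>: "\<delta> > 0" "\<delta> < 1" and C: "C > 0"
    and lyap: "\<And>v. A (\<lambda>x. ennreal (bracket x powr k)) v \<le> ennreal ((1 - \<delta>) * bracket v powr k) * sig v + ennreal C"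
    using A_bracket_le[OF k0] by blast
  obtain c0 where c0: "c0 > 0" "\<And>v. ennreal (c0 * bracket v powr \<gamma>) \<le> sig v"
    using sig_lower by blast
  define e where "e = \<delta> * c0"
  have e: "e > 0" using \<delta> c0 by (simp add: e_def)
  \<comment> \<open>With \<open>R powr r = 4 * C / e\<close>, the mass tail
    \<open>nr / R powr r\<close> costs \<open>2 * C * nr / R powr r = e / 2 * nr\<close>, half of
    the dissipation.\<close>
  define R where "R = (4 * C / e) powr (1 / r)"
  have R: "R > 0" using C e by (simp add: R_def)
  have Rr: "R powr r = 4 * C / e" using C e r by (simp add: R_def powr_powr)
  obtain c where c: "c > 0" "\<And>F v. F \<in> borel_measurable borel \<Longrightarrow> norm v \<le> R \<Longrightarrow>
      ennreal c * (\<integral>\<^sup>+y. indicator (cball 0 R) y * F y \<partial>lborel) \<le> gain F v"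
    using gain_minorization[OF R] by blast
  define V where "V = measure lborel (cball (0::'a) R)"
  have V: "emeasure lborel (cball (0::'a) R) = ennreal V" "V > 0"
  proof -
    show "emeasure lborel (cball (0::'a) R) = ennreal V"
      using emeasure_lborel_cball_finite[of "0::'a" R] by (simp add: V_def emeasure_eq_ennreal_measure)
    show "V > 0" using R by (simp add: V_def content_cball)
  qed
  \<comment> \<open>With this weight the coupling saves
    \<open>\<Lambda> * (2 * h * c * m * V) = h * (2 * C * m)\<close>, enough for the term
    \<open>C * n1\<close> of the drift.\<close>
  define \<Lambda> where "\<Lambda> = C / (c * V)"
  have \<Lambda>: "\<Lambda> > 0" using C c V by (simp add: \<Lambda>_def)
  have cbm [measurable]: "cball (0::'a) R \<in> sets borel" by simp
  have main: "euler h f \<in> L1w k \<and>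
      norm_L1w k (euler h f) + \<Lambda> * norm_L1 (euler h f) + h * (e / 2 * norm_L1w (k + \<gamma>) f) \<le>
      norm_L1w k f + \<Lambda> * norm_L1 f"
    if f: "f \<in> L1w k" and f0: "(\<integral>v. f v \<partial>lborel) = 0" and h: "0 \<le> h" "h * S \<le> 1" for f h
  proof -
    have fb [measurable]: "f \<in> borel_measurable borel" by (rule L1wD(1)[OF f])
    have fL: "f \<in> L1" using L1w_nonneg_imp_L1[OF f] k0 by simp
    have fr: "f \<in> L1w r" using L1w_mono[OF f] r by simp
    define n1 where "n1 = norm_L1 f"
    define nk where "nk = norm_L1w k f"
    define nr where "nr = norm_L1w r f"
    have nn: "n1 \<ge> 0" "nk \<ge> 0" "nr \<ge> 0"
      by (simp_all add: n1_def nk_def nr_def norm_L1_nonneg norm_L1w_nonneg)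
    have In1: "(\<integral>\<^sup>+v. ennreal \<bar>f v\<bar> \<partial>lborel) = ennreal n1"
      unfolding n1_def by (rule nn_integral_norm_L1[OF fL])
    have Ink: "(\<integral>\<^sup>+v. ennreal (bracket v powr k) * ennreal \<bar>f v\<bar> \<partial>lborel) = ennreal nk"
      unfolding nk_def by (rule nn_integral_L1w[OF f])
    have Inr: "(\<integral>\<^sup>+v. ennreal (bracket v powr r) * ennreal \<bar>f v\<bar> \<partial>lborel) = ennreal nr"
      unfolding nr_def by (rule nn_integral_L1w[OF fr])
    \<comment> \<open>Zero integral gives the positive and negative parts of \<open>f\<close> mass
      \<open>n1 / 2\<close> each; Chebyshev bounds what lies outside the ball by
      \<open>nr / R powr r\<close>. The maximum with 0 covers the case where the tail
      dominates.\<close>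
    define m where "m = max 0 (n1 / 2 - nr / R powr r)"
    have half: "ennreal m \<le> (\<integral>\<^sup>+y. indicator (cball 0 R) y * ennreal (g y) \<partial>lborel)"
      if g: "g = f \<or> g = (\<lambda>v. - f v)" for g
    proof -
      have gb [measurable]: "g \<in> borel_measurable borel" using g by auto
      have fi: "integrable lborel f" using fL by (simp add: L1_def)
      have gi: "integrable lborel g" "integrable lborel (\<lambda>v. \<bar>g v\<bar>)" using g fi by auto
      have ga: "\<bar>g v\<bar> = \<bar>f v\<bar>" for v using g by auto
      have g0: "(\<integral>v. g v \<partial>lborel) = 0" using g f0 by auto
      have "(\<integral>v. max 0 (g v) \<partial>lborel) = (\<integral>v. (\<bar>g v\<bar> + g v) / 2 \<partial>lborel)"
        by (rule Bochner_Integration.integral_cong) (auto simp: max_def)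
      also have "\<dots> = n1 / 2"
        using gi g0 by (simp add: n1_def norm_L1_def ga)
      finally have e1: "(\<integral>v. max 0 (g v) \<partial>lborel) = n1 / 2" .
      have e2: "(\<integral>\<^sup>+v. ennreal (max 0 (g v)) \<partial>lborel) = ennreal (\<integral>v. max 0 (g v) \<partial>lborel)"
        using gi by (intro nn_integral_eq_integral) auto
      have e3: "ennreal (max 0 (g v)) = ennreal (g v)" for v
        by (simp add: max_def ennreal_neg)
      note Ig = e2[unfolded e3 e1]
      have "ennreal (n1 / 2) \<le> (\<integral>\<^sup>+v. indicator (cball 0 R) v * ennreal (g v) +
          ennreal (1 / R powr r) * (ennreal (bracket v powr r) * ennreal \<bar>f v\<bar>) \<partial>lborel)"
        unfolding Ig[symmetric]
      proof (rule nn_integral_mono)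
        fix v :: 'a
        show "ennreal (g v) \<le> indicator (cball 0 R) v * ennreal (g v) +
          ennreal (1 / R powr r) * (ennreal (bracket v powr r) * ennreal \<bar>f v\<bar>)"
        proof (cases "norm v \<le> R")
          case False
          then have "R \<le> bracket v" using norm_le_bracket[of v] by simp
          then have "R powr r \<le> bracket v powr r" using R r by (intro powr_mono2) auto
          then have "1 \<le> 1 / R powr r * bracket v powr r" using R by simp
          then have "g v \<le> 1 / R powr r * bracket v powr r * \<bar>f v\<bar>"
            using mult_right_mono[of 1 "1 / R powr r * bracket v powr r" "\<bar>f v\<bar>"] ga[of v] by linarith
          then have "ennreal (g v) \<le> ennreal (1 / R powr r) * (ennreal (bracket v powr r) * ennreal \<bar>f v\<bar>)"
            by (simp add: ennreal_mult'[symmetric] ennreal_leI)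
          then show ?thesis using False by simp
        qed simp
      qed
      also have "\<dots> = (\<integral>\<^sup>+v. indicator (cball 0 R) v * ennreal (g v) \<partial>lborel) + ennreal (1 / R powr r) * ennreal nr"
        by (simp add: nn_integral_add nn_integral_cmult Inr)
      also have "ennreal (1 / R powr r) * ennreal nr = ennreal (nr / R powr r)"
        by (simp add: ennreal_mult'[symmetric])
      finally have le: "ennreal (n1 / 2) \<le> (\<integral>\<^sup>+v. indicator (cball 0 R) v * ennreal (g v) \<partial>lborel) + ennreal (nr / R powr r)" .
      have "ennreal (n1 / 2) - ennreal (nr / R powr r) \<le> (\<integral>\<^sup>+v. indicator (cball 0 R) v * ennreal (g v) \<partial>lborel)"
        using le by (simp add: ennreal_minus_le_iff add.commute)
      moreover have "ennreal m = ennreal (n1 / 2) - ennreal (nr / R powr r)"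
        using nn by (simp add: m_def ennreal_minus max_def ennreal_neg)
      ultimately show ?thesis by simp
    qed
    have m0: "m \<ge> 0" by (simp add: m_def)
    note E = nn_integral_euler_le[OF fL S h less_imp_le[OF c(1)] c(2) m0 half half]
    have sigfin: "(\<integral>\<^sup>+v. sig v * F v \<partial>lborel) < top" if "(\<integral>\<^sup>+v. F v \<partial>lborel) < top"
        and [measurable]: "F \<in> borel_measurable borel" for F
    proof -
      have "(\<integral>\<^sup>+v. sig v * F v \<partial>lborel) \<le> (\<integral>\<^sup>+v. ennreal S * F v \<partial>lborel)"
        by (intro nn_integral_mono mult_right_mono S) auto
      then show ?thesis using that by (simp add: nn_integral_cmult ennreal_mult_less_top le_less_trans)
    qed
    note eL = euler_contraction[OF S h fL]
    define p1 where "p1 = norm_L1 (euler h f)"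
    have p1: "(\<integral>\<^sup>+v. ennreal \<bar>euler h f v\<bar> \<partial>lborel) = ennreal p1"
      unfolding p1_def by (rule nn_integral_norm_L1[OF eL(1)])
    have coupling: "p1 + 2 * h * c * m * V \<le> n1"
    proof -
      let ?I = "\<integral>\<^sup>+v. sig v * ennreal \<bar>f v\<bar> \<partial>lborel"
      have I: "ennreal h * ?I \<noteq> top"
        using sigfin[of "\<lambda>v. ennreal \<bar>f v\<bar>"] In1 by (simp add: ennreal_mult_eq_top_iff less_top)
      have "ennreal p1 + ennreal h * ?I + ennreal (2 * h * c * m) * ennreal V \<le> ennreal n1 + ennreal h * ?I"
        using E[of "\<lambda>_. 1"] by (simp add: A_one p1 In1 V mult.commute)
      then have "ennreal h * ?I + (ennreal p1 + ennreal (2 * h * c * m) * ennreal V) \<le> ennreal h * ?I + ennreal n1"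
        by (simp add: ac_simps)
      then have "ennreal p1 + ennreal (2 * h * c * m) * ennreal V \<le> ennreal n1"
        using I by (simp add: ennreal_add_left_cancel_le)
      then show ?thesis
        using nn h c m0 V norm_L1_nonneg[of "euler h f"]
        by (simp add: ennreal_mult'[symmetric] ennreal_plus[symmetric] p1_def del: ennreal_plus)
    qed
    have drift: "euler h f \<in> L1w k \<and> norm_L1w k (euler h f) + h * (e * nr) \<le> nk + h * (C * n1)"
    proof -
      let ?I = "\<integral>\<^sup>+v. ennreal (bracket v powr k) * (sig v * ennreal \<bar>f v\<bar>) \<partial>lborel"
      let ?X = "\<integral>\<^sup>+v. ennreal (bracket v powr k) * ennreal \<bar>euler h f v\<bar> \<partial>lborel"
      have "?I = (\<integral>\<^sup>+v. sig v * (ennreal (bracket v powr k) * ennreal \<bar>f v\<bar>) \<partial>lborel)"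
        by (simp add: mult_ac)
      also have "\<dots> < top" by (rule sigfin) (simp_all add: Ink)
      finally obtain I where I: "?I = ennreal I" "I \<ge> 0"
        using less_top_ennreal[of ?I] by auto
      have "?X + ennreal h * ?I \<le> ?X + ennreal h * ?I + ennreal (2 * h * c * m) *
          (\<integral>\<^sup>+v. ennreal (bracket v powr k) * indicator (cball 0 R) (v::'a) \<partial>lborel)"
        by simp
      also have "\<dots> \<le> ennreal nk + ennreal h * (\<integral>\<^sup>+v. ennreal \<bar>f v\<bar> * A (\<lambda>v. ennreal (bracket v powr k)) v \<partial>lborel)"
        using E[of "\<lambda>v. ennreal (bracket v powr k)"] by (simp add: Ink)
      also have "(\<integral>\<^sup>+v. ennreal \<bar>f v\<bar> * A (\<lambda>v. ennreal (bracket v powr k)) v \<partial>lborel) \<le>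
          (\<integral>\<^sup>+v. ennreal (1 - \<delta>) * (ennreal (bracket v powr k) * (sig v * ennreal \<bar>f v\<bar>)) + ennreal C * ennreal \<bar>f v\<bar> \<partial>lborel)"
      proof (rule nn_integral_mono)
        fix v :: 'a
        have "ennreal \<bar>f v\<bar> * A (\<lambda>v. ennreal (bracket v powr k)) v \<le>
            ennreal \<bar>f v\<bar> * (ennreal ((1 - \<delta>) * bracket v powr k) * sig v + ennreal C)"
          by (intro mult_left_mono lyap) auto
        also have "ennreal ((1 - \<delta>) * bracket v powr k) = ennreal (1 - \<delta>) * ennreal (bracket v powr k)"
          using \<delta> by (simp add: ennreal_mult')
        finally show "ennreal \<bar>f v\<bar> * A (\<lambda>v. ennreal (bracket v powr k)) v \<le>
            ennreal (1 - \<delta>) * (ennreal (bracket v powr k) * (sig v * ennreal \<bar>f v\<bar>)) + ennreal C * ennreal \<bar>f v\<bar>"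
          by (simp add: distrib_left mult_ac)
      qed
      also have "\<dots> = ennreal (1 - \<delta>) * ennreal I + ennreal C * ennreal n1"
        by (simp add: nn_integral_add nn_integral_cmult In1 I)
      finally have le: "?X + ennreal h * ennreal I \<le> ennreal nk + ennreal h * (ennreal (1 - \<delta>) * ennreal I + ennreal C * ennreal n1)"
        using I by (simp add: mult_left_mono add_left_mono)
      \<comment> \<open>The lower bound of \<open>sig\<close> turns the loss in the weight
        \<open>k\<close> into the norm of weight \<open>k + \<gamma>\<close>.\<close>
      have "ennreal (c0 * nr) = (\<integral>\<^sup>+v. ennreal c0 * (ennreal (bracket v powr r) * ennreal \<bar>f v\<bar>) \<partial>lborel)"
        using c0 nn by (simp add: nn_integral_cmult Inr ennreal_mult')
      also have "\<dots> \<le> ?I"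
      proof (rule nn_integral_mono)
        fix v :: 'a
        have "ennreal c0 * (ennreal (bracket v powr r) * ennreal \<bar>f v\<bar>) =
            ennreal (bracket v powr k) * (ennreal (c0 * bracket v powr \<gamma>) * ennreal \<bar>f v\<bar>)"
          using c0 by (simp add: ennreal_mult'[symmetric] r_def powr_add mult_ac)
        also have "\<dots> \<le> ennreal (bracket v powr k) * (sig v * ennreal \<bar>f v\<bar>)"
          by (intro mult_left_mono mult_right_mono c0) auto
        finally show "ennreal c0 * (ennreal (bracket v powr r) * ennreal \<bar>f v\<bar>) \<le>
            ennreal (bracket v powr k) * (sig v * ennreal \<bar>f v\<bar>)" .
      qed
      finally have In: "c0 * nr \<le> I" using I by simp
      have "?X \<le> ?X + ennreal h * ennreal I" by simp
      also note le
      also have "ennreal nk + ennreal h * (ennreal (1 - \<delta>) * ennreal I + ennreal C * ennreal n1) < top"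
        by (simp add: ennreal_mult_less_top)
      finally obtain X where X: "?X = ennreal X" "X \<ge> 0"
        using less_top_ennreal[of ?X] by auto
      have ek: "euler h f \<in> L1w k"
        by (rule L1wI(1)[where c = X]) (simp_all add: X borel_measurable_euler fb)
      then have Xn: "X = norm_L1w k (euler h f)"
        using nn_integral_L1w[OF ek] X norm_L1w_nonneg[of k "euler h f"] by (simp add: ennreal_inj)
      have "X + h * I \<le> nk + h * ((1 - \<delta>) * I + C * n1)"
        using le[unfolded X(1)] X(2) I(2) h nn \<delta> C
        by (simp add: ennreal_mult'[symmetric] ennreal_plus[symmetric] del: ennreal_plus)
      moreover have "h * (\<delta> * (c0 * nr)) \<le> h * (\<delta> * I)"
        using In h \<delta> by (intro mult_left_mono) auto
      ultimately have "X + h * (e * nr) \<le> nk + h * (C * n1)"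
        by (simp add: e_def algebra_simps)
      then show ?thesis using ek Xn by simp
    qed
    have "h * (C * n1 - e / 2 * nr) \<le> \<Lambda> * (2 * h * c * m * V)"
    proof -
      have "C * n1 - e / 2 * nr = 2 * C * (n1 / 2 - nr / R powr r)"
        using C e by (simp add: Rr field_simps)
      also have "\<dots> \<le> 2 * C * m" using C by (intro mult_left_mono) (auto simp: m_def)
      finally have "h * (C * n1 - e / 2 * nr) \<le> h * (2 * C * m)" using h by (intro mult_left_mono)
      also have "\<dots> = \<Lambda> * (2 * h * c * m * V)" using c V by (simp add: \<Lambda>_def field_simps)
      finally show ?thesis .
    qed
    moreover have "\<Lambda> * p1 + \<Lambda> * (2 * h * c * m * V) \<le> \<Lambda> * n1"
      using mult_left_mono[OF coupling, of \<Lambda>] \<Lambda> by (simp add: distrib_left)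
    ultimately show ?thesis
      using drift by (simp add: n1_def nk_def nr_def p1_def r_def algebra_simps)
  qed
  show ?thesis using main \<Lambda> e by (intro that[of \<Lambda> "e / 2"]) auto
qed

text \<open>The Lyapunov estimate is used for two weights. For \<open>s\<close> it only keeps the
  moment bounded along the iteration. For \<open>k\<close> its dissipation, interpolated with that
  bound, dominates a power of the functional itself, which is the scalar recursion with
  \<open>\<tau> = (s - k) / \<bar>\<gamma>\<bar>\<close>. The hypothesis \<open>mass\<close>
  preserves zero integral under \<open>euler\<close>.\<close>

lemma euler_decay:
  assumes S: "\<And>v. sig v \<le> ennreal S" "S \<ge> 0" and k: "- \<gamma> < k" "k < s"
    and mass: "\<And>f :: 'a \<Rightarrow> real. f \<in> L1 \<Longrightarrow> (\<integral>v. boltzmann_op \<gamma> b f v \<partial>lborel) = 0"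
    and X0: "X0 \<ge> 0"
  obtains C where "C > 0"
    "\<And>g h n. g \<in> L1w s \<Longrightarrow> (\<integral>v. g v \<partial>lborel) = 0 \<Longrightarrow> norm_L1w s g \<le> X0 \<Longrightarrow> 0 \<le> h \<Longrightarrow> h * S \<le> 1 \<Longrightarrow>
      norm_L1 ((euler h ^^ n) g) \<le> C * (1 + real n * h) powr (- ((s - k) / \<bar>\<gamma>\<bar>))"
proof -
  have k0: "k > 0" "s > 0" "- \<gamma> < s" using k gamma by simp_all
  obtain \<Lambda>k a where L: "\<Lambda>k \<ge> 0" "a > 0"
    "\<And>f h. f \<in> L1w k \<Longrightarrow> (\<integral>v. f v \<partial>lborel) = 0 \<Longrightarrow> 0 \<le> h \<Longrightarrow> h * S \<le> 1 \<Longrightarrow>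
      euler h f \<in> L1w k \<and>
      norm_L1w k (euler h f) + \<Lambda>k * norm_L1 (euler h f) + h * (a * norm_L1w (k + \<gamma>) f) \<le>
      norm_L1w k f + \<Lambda>k * norm_L1 f"
    using euler_lyapunov[OF S k(1)] by blast
  obtain \<Lambda>s as where Ls: "\<Lambda>s \<ge> 0" "as > 0"
    "\<And>f h. f \<in> L1w s \<Longrightarrow> (\<integral>v. f v \<partial>lborel) = 0 \<Longrightarrow> 0 \<le> h \<Longrightarrow> h * S \<le> 1 \<Longrightarrow>
      euler h f \<in> L1w s \<and>
      norm_L1w s (euler h f) + \<Lambda>s * norm_L1 (euler h f) + h * (as * norm_L1w (s + \<gamma>) f) \<le>
      norm_L1w s f + \<Lambda>s * norm_L1 f"
    using euler_lyapunov[OF S k0(3)] by blast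
  define \<tau> where "\<tau> = (s - k) / \<bar>\<gamma>\<bar>"
  have \<tau>: "\<tau> > 0" unfolding \<tau>_def using k gamma by (intro divide_pos_pos) auto
  \<comment> \<open>Bounds the functional of weight \<open>s\<close> along the iteration, since
    initially the plain norm is at most the weighted one. The added 1 makes it positive.\<close>
  define X where "X = (1 + \<Lambda>s) * X0 + 1"
  have X: "X > 0" using Ls X0 by (simp add: X_def add_nonneg_pos)
  define K where "K = 1 + \<Lambda>k"
  have K: "K \<ge> 1" using L by (simp add: K_def)
  define a' where "a' = a * (1 / (2 * K)) * (1 / (2 * K * X)) powr (1 / \<tau>)"
  have a': "a' > 0" using L K X by (simp add: a'_def)
  have "K * X > 0" using K X by simp
  from decay_of_nonlinear_recursion[OF \<tau> a' this]
  obtain C where C: "C > 0"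
    "\<forall>(h::real) (y :: nat \<Rightarrow> real) n. 0 \<le> h \<longrightarrow> (\<forall>n. 0 \<le> y n) \<longrightarrow> y 0 \<le> K * X \<longrightarrow>
       (\<forall>n. y (Suc n) \<le> y n - h * (a' * y n powr (1 + 1 / \<tau>))) \<longrightarrow> y n \<le> C * (1 + real n * h) powr (- \<tau>)"
    by (elim exE conjE)
  have main: "norm_L1 ((euler h ^^ n) g) \<le> C * (1 + real n * h) powr (- \<tau>)"
    if g: "g \<in> L1w s" "(\<integral>v. g v \<partial>lborel) = 0" "norm_L1w s g \<le> X0" and h: "0 \<le> h" "h * S \<le> 1" for g h n
  proof -
    define G where "G n = (euler h ^^ n) g" for n
    have G0: "G 0 = g" and GS: "G (Suc n) = euler h (G n)" for n by (simp_all add: G_def)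
    have inv: "G n \<in> L1w s \<and> (\<integral>v. G n v \<partial>lborel) = 0 \<and> norm_L1w s (G n) + \<Lambda>s * norm_L1 (G n) \<le> X" for n
    proof (induction n)
      case 0
      have "norm_L1 g \<le> X0" using L1w_nonneg_imp_L1(2)[OF g(1)] k0 g(3) by simp
      then have "norm_L1w s g + \<Lambda>s * norm_L1 g \<le> X0 + \<Lambda>s * X0"
        using g(3) Ls(1) by (intro add_mono mult_left_mono) auto
      then show ?case using g by (simp add: G0 X_def algebra_simps)
    next
      case (Suc n)
      then have Gs: "G n \<in> L1w s" and Gm: "(\<integral>v. G n v \<partial>lborel) = 0" by auto
      have GL: "G n \<in> L1" using L1w_nonneg_imp_L1(1)[OF Gs] k0 by simp
      have "(\<integral>v. euler h (G n) v \<partial>lborel) = (\<integral>v. G n v \<partial>lborel) + h * (\<integral>v. boltzmann_op \<gamma> b (G n) v \<partial>lborel)"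
        unfolding euler_def using GL boltzmann_op_L1(1)[OF S GL] by (simp add: L1_def)
      then have "(\<integral>v. euler h (G n) v \<partial>lborel) = 0" using mass[OF GL] Gm by simp
      moreover have "0 \<le> h * (as * norm_L1w (s + \<gamma>) (G n))"
        using h Ls norm_L1w_nonneg by (intro mult_nonneg_nonneg) auto
      ultimately show ?case
        using Ls(3)[OF Gs Gm h] Suc by (auto simp: GS)
    qed
    define y where "y n = norm_L1w k (G n) + \<Lambda>k * norm_L1 (G n)" for n
    have Gk: "G n \<in> L1w k" for n
      by (rule L1w_mono(1)[of _ s]) (use inv[of n] k in auto)
    have GX: "norm_L1w s (G n) \<le> X" for n
      using inv[of n] mult_nonneg_nonneg[OF Ls(1) norm_L1_nonneg[of "G n"]] by linarith
    have y0: "0 \<le> y n" for n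
      using L(1) by (simp add: y_def norm_L1_nonneg norm_L1w_nonneg)
    have yK: "y n \<le> K * norm_L1w k (G n)" for n
      using L1w_nonneg_imp_L1(2)[OF Gk, of n] k0 L(1) mult_left_mono[of "norm_L1 (G n)" "norm_L1w k (G n)" \<Lambda>k]
      by (simp add: y_def K_def algebra_simps)
    have yX: "y 0 \<le> K * X"
    proof -
      have "norm_L1w k (G 0) \<le> X" using L1w_mono(2)[of "G 0" s k] inv[of 0] k GX[of 0] by simp
      then have "K * norm_L1w k (G 0) \<le> K * X" using K by (intro mult_left_mono) auto
      then show ?thesis using yK[of 0] by simp
    qed
    have step: "y (Suc n) \<le> y n - h * (a' * y n powr (1 + 1 / \<tau>))" for n
    proof -
      have "a' * y n powr (1 + 1 / \<tau>) \<le> a * norm_L1w (k + \<gamma>) (G n)"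
      proof (cases "y n = 0")
        case True
        then show ?thesis using L(2) norm_L1w_nonneg[of "k + \<gamma>" "G n"] by simp
      next
        case False
        then have yp: "y n > 0" using y0[of n] by simp
        \<comment> \<open>The cut-off \<open>\<rho>\<close> satisfies
          \<open>\<rho> powr (k - s) = z\<close>, so the subtracted moment term is at most
          \<open>z * X = y n / (2 * K)\<close>, half of the lower bound \<open>y n / K\<close> for
          the norm of weight \<open>k\<close>. This halving is the origin of the factors 2 in
          \<open>a'\<close>.\<close>
        define z where "z = y n / (2 * K * X)"
        have z: "z > 0" using yp K X by (simp add: z_def)
        define \<rho> where "\<rho> = z powr (- (1 / (s - k)))"
        have \<rho>: "\<rho> > 0" using z by (simp add: \<rho>_def)
        have r1: "\<rho> powr (k - s) = z"
        proof -
          have "- (1 / (s - k)) * (k - s) = 1" using k by (simp add: field_simps)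
          then show ?thesis unfolding \<rho>_def powr_powr using z by simp
        qed
        have r2: "\<rho> powr \<gamma> = z powr (1 / \<tau>)"
          using gamma by (simp add: \<rho>_def powr_powr \<tau>_def)
        have "y n / K \<le> norm_L1w k (G n)" using yK[of n] K by (simp add: field_simps)
        moreover have "z * norm_L1w s (G n) \<le> z * X" using z GX[of n] by (intro mult_left_mono) auto
        moreover have "z * X = y n / (2 * K)" using X by (simp add: z_def)
        moreover have "y n / K = 2 * (y n / (2 * K))" by simp
        ultimately have "y n / (2 * K) \<le> norm_L1w k (G n) - \<rho> powr (k - s) * norm_L1w s (G n)"
          unfolding r1 by linarith
        then have "z powr (1 / \<tau>) * (y n / (2 * K)) \<le>
            \<rho> powr \<gamma> * (norm_L1w k (G n) - \<rho> powr (k - s) * norm_L1w s (G n))"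
          unfolding r2 by (intro mult_left_mono) auto
        also have "\<dots> \<le> norm_L1w (k + \<gamma>) (G n)"
          using inv[of n] gamma k \<rho> by (intro norm_L1w_interpolate) auto
        finally have "a * (z powr (1 / \<tau>) * (y n / (2 * K))) \<le> a * norm_L1w (k + \<gamma>) (G n)"
          using L(2) by (intro mult_left_mono) auto
        moreover have "a' * y n powr (1 + 1 / \<tau>) = a * (z powr (1 / \<tau>) * (y n / (2 * K)))"
        proof -
          have "z powr (1 / \<tau>) = (1 / (2 * K * X)) powr (1 / \<tau>) * y n powr (1 / \<tau>)"
            unfolding z_def by (subst powr_mult[symmetric]) simp
          then show ?thesis using yp by (simp add: a'_def powr_add)
        qed
        ultimately show ?thesis by simp
      qed
      then have "h * (a' * y n powr (1 + 1 / \<tau>)) \<le> h * (a * norm_L1w (k + \<gamma>) (G n))"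
        using h by (intro mult_left_mono)
      then show ?thesis
        using L(3)[OF Gk _ h, of n] inv[of n] by (simp add: y_def GS)
    qed
    have "norm_L1 (G n) \<le> y n"
      using L1w_nonneg_imp_L1(2)[OF Gk, of n] k0 L(1) norm_L1_nonneg[of "G n"]
      by (simp add: y_def add_increasing2)
    also have "y n \<le> C * (1 + real n * h) powr (- \<tau>)"
      using C(2) h(1) y0 yX step by blast
    finally show ?thesis by (simp add: G_def)
  qed
  show ?thesis using main C(1) by (intro that[of C]) (auto simp: \<tau>_def)
qed

end

subsection \<open>Semigroups with everywhere defined generator\<close>

lemma L1_add: "f \<in> L1 \<Longrightarrow> g \<in> L1 \<Longrightarrow> (\<lambda>v. f v + g v) \<in> L1"
  and L1_diff: "f \<in> L1 \<Longrightarrow> g \<in> L1 \<Longrightarrow> (\<lambda>v. f v - g v) \<in> L1"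
  and L1_cmult: "f \<in> L1 \<Longrightarrow> (\<lambda>v. c * f v) \<in> L1"
  and L1_max: "f \<in> L1 \<Longrightarrow> (\<lambda>v. max 0 (f v)) \<in> L1"
  by (auto simp: L1_def)

lemmas L1_closure = L1_add L1_diff L1_cmult L1_max

lemma norm_L1_le_AE:
  assumes "f \<in> L1" "g \<in> L1" "AE v in lborel. \<bar>f v\<bar> \<le> g v"
  shows "norm_L1 f \<le> (\<integral>v. g v \<partial>lborel)"
  unfolding norm_L1_def using assms by (intro integral_mono_AE) (auto simp: L1_def)

lemma norm_L1_cong_AE:
  assumes "f \<in> L1" "g \<in> L1" "AE v in lborel. f v = g v"
  shows "norm_L1 f = norm_L1 g"
  unfolding norm_L1_def using assms by (intro integral_cong_AE) (auto dest: L1_borel)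

lemma norm_L1_add_le:
  assumes "f \<in> L1" "g \<in> L1" "h \<in> L1" "AE v in lborel. f v = g v + h v"
  shows "norm_L1 f \<le> norm_L1 g + norm_L1 h"
proof -
  have "norm_L1 f \<le> (\<integral>v. \<bar>g v\<bar> + \<bar>h v\<bar> \<partial>lborel)"
    using assms by (intro norm_L1_le_AE) (auto simp: L1_def elim!: eventually_mono)
  also have "\<dots> = norm_L1 g + norm_L1 h"
    using assms by (simp add: norm_L1_def L1_def)
  finally show ?thesis .
qed

lemma norm_L1_cmult: "norm_L1 (\<lambda>v. c * f v) = \<bar>c\<bar> * norm_L1 f"
  by (simp add: norm_L1_def abs_mult)

locale stochastic_semigroup =
  fixes U :: "real \<Rightarrow> ('a::euclidean_space \<Rightarrow> real) \<Rightarrow> 'a \<Rightarrow> real"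
    and L :: "('a \<Rightarrow> real) \<Rightarrow> 'a \<Rightarrow> real"
  assumes C0: "C0_semigroup_L1 U" and gen: "generates_L1 L U"
    and pos: "positive_L1 U" and mass: "mass_preserving_L1 U"
begin

lemma U_L1: "t \<ge> 0 \<Longrightarrow> f \<in> L1 \<Longrightarrow> U t f \<in> L1"
  using C0 by (auto simp: C0_semigroup_L1_def bounded_linear_L1_def)

lemma L_L1: "f \<in> L1 \<Longrightarrow> L f \<in> L1"
  using gen by (auto simp: generates_L1_def)

lemma U_add: "t \<ge> 0 \<Longrightarrow> f \<in> L1 \<Longrightarrow> g \<in> L1 \<Longrightarrow> AE v in lborel. U t (\<lambda>x. f x + g x) v = U t f v + U t g v"
  using C0 by (auto simp: C0_semigroup_L1_def bounded_linear_L1_def)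

lemma U_cmult: "t \<ge> 0 \<Longrightarrow> f \<in> L1 \<Longrightarrow> AE v in lborel. U t (\<lambda>x. c * f x) v = c * U t f v"
  using C0 by (auto simp: C0_semigroup_L1_def bounded_linear_L1_def)

lemma U_lincomb:
  assumes t: "t \<ge> 0" and f: "f \<in> L1" and g: "g \<in> L1"
  shows "AE v in lborel. U t (\<lambda>x. f x + c * g x) v = U t f v + c * U t g v"
  using U_add[OF t f L1_cmult[OF g, of c]] U_cmult[OF t g, of c]
  by eventually_elim simp

lemma U_diff:
  assumes t: "t \<ge> 0" and f: "f \<in> L1" and g: "g \<in> L1"
  shows "AE v in lborel. U t (\<lambda>x. f x - g x) v = U t f v - U t g v"
  using U_lincomb[OF t f g, of "-1"] by simp

lemma U_0: "f \<in> L1 \<Longrightarrow> AE v in lborel. U 0 f v = f v"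
  using C0 by (auto simp: C0_semigroup_L1_def)

lemma norm_L1_U_0:
  assumes f: "f \<in> L1"
  shows "norm_L1 (\<lambda>v. U 0 f v - f v) = 0"
proof -
  have "norm_L1 (\<lambda>v. U 0 f v - f v) = norm_L1 (\<lambda>v::'a. 0)"
    using f U_0[OF f] by (intro norm_L1_cong_AE L1_closure U_L1) (auto simp: L1_def elim!: eventually_mono)
  then show ?thesis by (simp add: norm_L1_def)
qed

lemma U_semigroup: "s \<ge> 0 \<Longrightarrow> t \<ge> 0 \<Longrightarrow> f \<in> L1 \<Longrightarrow> AE v in lborel. U (s + t) f v = U s (U t f) v"
  using C0 by (auto simp: C0_semigroup_L1_def)

lemma U_nonneg: "t \<ge> 0 \<Longrightarrow> f \<in> L1 \<Longrightarrow> AE v in lborel. 0 \<le> f v \<Longrightarrow> AE v in lborel. 0 \<le> U t f v"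
  using pos by (auto simp: positive_L1_def)

lemma U_mass: "t \<ge> 0 \<Longrightarrow> f \<in> L1 \<Longrightarrow> (\<integral>v. U t f v \<partial>lborel) = (\<integral>v. f v \<partial>lborel)"
  using mass by (auto simp: mass_preserving_L1_def)

text \<open>Positivity and conservation of mass, applied to the positive and negative parts, improve
  the unspecified operator bound to 1.\<close>

lemma U_contraction:
  assumes t: "t \<ge> 0" and f: "f \<in> L1"
  shows "norm_L1 (U t f) \<le> norm_L1 f"
proof -
  define p where "p v = max 0 (f v)" for v
  define m where "m v = max 0 (- f v)" for v
  have nf: "(\<lambda>v. - f v) \<in> L1" using f by (simp add: L1_def)
  have pm: "p \<in> L1" "m \<in> L1"
    using L1_max[OF f] L1_max[OF nf] by (simp_all add: p_def[abs_def] m_def[abs_def])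
  have fe: "f = (\<lambda>v. p v - m v)" by (auto simp: p_def m_def)
  have Up: "U t p \<in> L1" "U t m \<in> L1" using U_L1 t pm by auto
  have 1: "AE v in lborel. U t f v = U t p v - U t m v"
    using U_diff[OF t pm] by (simp add: fe)
  have 2: "AE v in lborel. 0 \<le> U t p v" "AE v in lborel. 0 \<le> U t m v"
    using U_nonneg[OF t pm(1)] U_nonneg[OF t pm(2)] by (simp_all add: p_def m_def)
  have "AE v in lborel. \<bar>U t f v\<bar> \<le> U t p v + U t m v"
    using 1 2(1) 2(2) by eventually_elim auto
  then have "norm_L1 (U t f) \<le> (\<integral>v. U t p v + U t m v \<partial>lborel)"
    by (intro norm_L1_le_AE U_L1 t f L1_closure Up)
  also have "\<dots> = (\<integral>v. p v \<partial>lborel) + (\<integral>v. m v \<partial>lborel)"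
    using Up U_mass[OF t] pm by (simp add: L1_def)
  also have "\<dots> = (\<integral>v. p v + m v \<partial>lborel)"
    using pm by (simp add: L1_def)
  also have "\<dots> = norm_L1 f"
    unfolding norm_L1_def by (rule Bochner_Integration.integral_cong) (auto simp: p_def m_def)
  finally show ?thesis .
qed

text \<open>First-order error of the semigroup at \<open>f\<close>. The generator property says only
  that it tends to 0; a rate is extracted below by subdividing the time interval.\<close>

definition defect :: "('a \<Rightarrow> real) \<Rightarrow> real \<Rightarrow> real" where
  "defect f h = norm_L1 (\<lambda>v. (U h f v - f v) / h - L f v)"

lemma defect_tendsto:
  assumes "f \<in> L1" "t > 0"
  shows "(\<lambda>n. defect f (t / real (Suc n))) \<longlonglongrightarrow> 0"
proof -
  have "(defect f \<longlongrightarrow> 0) (at_right 0)"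
    using gen assms by (simp add: generates_L1_def defect_def[abs_def])
  moreover have "filterlim (\<lambda>n. t / real (Suc n)) (at_right 0) sequentially"
  proof (rule tendsto_imp_filterlim_at_right)
    show "(\<lambda>n. t / real (Suc n)) \<longlonglongrightarrow> 0"
      using tendsto_mult[OF tendsto_const[of t] LIMSEQ_inverse_real_of_nat] by (simp add: divide_inverse)
    show "\<forall>\<^sub>F n in sequentially. 0 < t / real (Suc n)" using assms by simp
  qed
  ultimately show ?thesis by (rule filterlim_compose)
qed

lemma norm_L1_increment:
  assumes f: "f \<in> L1" and h: "h > 0"
  shows "norm_L1 (\<lambda>v. U h f v - f v - h * L f v) = h * defect f h"
proof -
  have "(\<lambda>v. U h f v - f v - h * L f v) = (\<lambda>v. h * ((U h f v - f v) / h - L f v))"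
    using h by (auto simp: field_simps)
  then show ?thesis using h by (simp only: norm_L1_cmult defect_def abs_of_pos)
qed

text \<open>Telescoping: each increment is \<open>U (real n * h)\<close> applied to the first one,
  so contraction bounds it by the size of the first.\<close>

lemma U_minus_id_steps:
  assumes f: "f \<in> L1" and h: "h > 0"
  shows "norm_L1 (\<lambda>v. U (real n * h) f v - f v) \<le> real n * (h * (norm_L1 (L f) + defect f h))"
proof (induction n)
  case 0
  show ?case by (simp add: norm_L1_U_0[OF f])
next
  case (Suc n)
  have nh: "real n * h \<ge> 0" "h \<ge> 0" using h by auto
  define d where "d v = U h f v - f v" for v
  have Uf: "U h f \<in> L1" "L f \<in> L1" using f nh by (auto intro: U_L1 L_L1)
  have d: "d \<in> L1" unfolding d_def[abs_def] by (intro L1_closure Uf f)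
  have Un: "U (real n * h) f \<in> L1" "U (real n * h) d \<in> L1" using nh f d by (auto intro: U_L1)
  have Us: "U (real (Suc n) * h) f \<in> L1" using f h by (intro U_L1) auto
  have dn: "norm_L1 d \<le> h * (norm_L1 (L f) + defect f h)"
  proof -
    have "norm_L1 d \<le> norm_L1 (\<lambda>v. U h f v - f v - h * L f v) + norm_L1 (\<lambda>v. h * L f v)"
      by (intro norm_L1_add_le d L1_closure Uf f) (simp add: d_def)
    then show ?thesis using h unfolding norm_L1_increment[OF f h] norm_L1_cmult by (simp add: algebra_simps)
  qed
  have e1: "AE v in lborel. U (real n * h + h) f v = U (real n * h) (U h f) v"
    by (rule U_semigroup[OF nh f])
  have e2: "AE v in lborel. U (real n * h) d v = U (real n * h) (U h f) v - U (real n * h) f v"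
    unfolding d_def[abs_def] by (rule U_diff[OF nh(1) Uf(1) f])
  have "AE v in lborel. U (real (Suc n) * h) f v - f v = U (real n * h) d v + (U (real n * h) f v - f v)"
    using e1 e2 by eventually_elim (simp add: algebra_simps)
  then have "norm_L1 (\<lambda>v. U (real (Suc n) * h) f v - f v) \<le> norm_L1 (U (real n * h) d) + norm_L1 (\<lambda>v. U (real n * h) f v - f v)"
    by (intro norm_L1_add_le L1_closure Us f Un)
  also have "\<dots> \<le> norm_L1 d + real n * (h * (norm_L1 (L f) + defect f h))"
    by (intro add_mono U_contraction nh d Suc.IH)
  finally show ?case using dn by (simp add: algebra_simps)
qed

text \<open>Subdividing a fixed \<open>t\<close> into ever more steps removes the defect.\<close>

lemma U_lipschitz:
  assumes f: "f \<in> L1" and t: "t \<ge> 0"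
  shows "norm_L1 (\<lambda>v. U t f v - f v) \<le> t * norm_L1 (L f)"
proof (cases "t = 0")
  case True
  then show ?thesis by (simp add: norm_L1_U_0[OF f])
next
  case False
  then have t: "t > 0" using t by simp
  have "(\<lambda>n. t * (norm_L1 (L f) + defect f (t / real (Suc n)))) \<longlonglongrightarrow> t * (norm_L1 (L f) + 0)"
    by (intro tendsto_intros defect_tendsto f t)
  moreover have "norm_L1 (\<lambda>v. U t f v - f v) \<le> t * (norm_L1 (L f) + defect f (t / real (Suc n)))" for n
    using U_minus_id_steps[OF f, of "t / real (Suc n)" "Suc n"] t by simp
  ultimately show ?thesis
    by (intro LIMSEQ_le_const[of _ _ "norm_L1 (\<lambda>v. U t f v - f v)"]) auto
qed

text \<open>The same telescoping one order higher: the step from \<open>real n * h\<close> also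
  compares \<open>U (real n * h) (L f)\<close> with \<open>L f\<close>, which by the Lipschitz bound
  costs \<open>real n * h * norm_L1 (L (L f))\<close>. Iterating \<open>L\<close> is allowed because
  it maps all of \<open>L1\<close> to itself.\<close>

lemma U_euler_steps:
  assumes f: "f \<in> L1" and h: "h > 0"
  shows "norm_L1 (\<lambda>v. U (real n * h) f v - f v - real n * h * L f v) \<le>
    real n * h * defect f h + (real n * h)\<^sup>2 * norm_L1 (L (L f))"
proof (induction n)
  case 0
  show ?case by (simp add: norm_L1_U_0[OF f])
next
  case (Suc n)
  have nh: "real n * h \<ge> 0" "h \<ge> 0" using h by auto
  have Lf: "L f \<in> L1" "L (L f) \<in> L1" using f by (auto intro: L_L1)
  define d where "d v = U h f v - f v - h * L f v" for v
  have Uf: "U h f \<in> L1" using f nh by (auto intro: U_L1)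
  have d: "d \<in> L1" unfolding d_def[abs_def] by (intro L1_closure Uf f Lf)
  have Un: "U (real n * h) f \<in> L1" "U (real n * h) d \<in> L1" "U (real n * h) (L f) \<in> L1"
    using nh f d Lf by (auto intro: U_L1)
  have Us: "U (real (Suc n) * h) f \<in> L1" using f h by (intro U_L1) auto
  have e1: "AE v in lborel. U (real n * h + h) f v = U (real n * h) (U h f) v"
    by (rule U_semigroup[OF nh f])
  have e2: "AE v in lborel. U (real n * h) (\<lambda>v. (U h f v - f v) + (- h) * L f v) v =
      U (real n * h) (\<lambda>v. U h f v - f v) v + (- h) * U (real n * h) (L f) v"
    by (intro U_lincomb nh L1_closure Uf f Lf)
  have e3: "AE v in lborel. U (real n * h) (\<lambda>v. U h f v - f v) v = U (real n * h) (U h f) v - U (real n * h) f v"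
    by (rule U_diff[OF nh(1) Uf f])
  have deq: "(\<lambda>v. (U h f v - f v) + (- h) * L f v) = d" by (auto simp: d_def)
  have "AE v in lborel. U (real (Suc n) * h) f v - f v - real (Suc n) * h * L f v =
      U (real n * h) d v + (h * (U (real n * h) (L f) v - L f v) + (U (real n * h) f v - f v - real n * h * L f v))"
    using e1 e2[unfolded deq] e3 by eventually_elim (simp add: algebra_simps)
  then have "norm_L1 (\<lambda>v. U (real (Suc n) * h) f v - f v - real (Suc n) * h * L f v) \<le>
      norm_L1 (U (real n * h) d) +
      norm_L1 (\<lambda>v. h * (U (real n * h) (L f) v - L f v) + (U (real n * h) f v - f v - real n * h * L f v))"
    by (intro norm_L1_add_le L1_closure Us f Un Lf)
  also have "\<dots> \<le> norm_L1 d + (norm_L1 (\<lambda>v. h * (U (real n * h) (L f) v - L f v)) +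
      norm_L1 (\<lambda>v. U (real n * h) f v - f v - real n * h * L f v))"
    by (intro add_mono U_contraction nh d norm_L1_add_le L1_closure Un Lf f) simp
  also have "\<dots> \<le> h * defect f h + (h * (real n * h * norm_L1 (L (L f))) +
      (real n * h * defect f h + (real n * h)\<^sup>2 * norm_L1 (L (L f))))"
  proof (intro add_mono Suc.IH)
    show "norm_L1 d \<le> h * defect f h"
      unfolding d_def[abs_def] norm_L1_increment[OF f h] by simp
    show "norm_L1 (\<lambda>v. h * (U (real n * h) (L f) v - L f v)) \<le> h * (real n * h * norm_L1 (L (L f)))"
      unfolding norm_L1_cmult using h U_lipschitz[OF Lf(1) nh(1)] by (simp add: mult_left_mono)
  qed
  also have "\<dots> \<le> real (Suc n) * h * defect f h + (real (Suc n) * h)\<^sup>2 * norm_L1 (L (L f))"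
  proof -
    \<comment> \<open>A crude bound for the sum of these costs, giving the constant 1 in place of
      the Taylor constant 1/2.\<close>
    have "h * (real n * h) + (real n * h)\<^sup>2 \<le> (real (Suc n) * h)\<^sup>2"
      using nh by (simp add: power2_eq_square algebra_simps)
    from mult_right_mono[OF this norm_L1_nonneg[of "L (L f)"]]
    show ?thesis by (simp add: algebra_simps)
  qed
  finally show ?case .
qed

lemma U_euler:
  assumes f: "f \<in> L1" and t: "t > 0"
  shows "norm_L1 (\<lambda>v. U t f v - f v - t * L f v) \<le> t\<^sup>2 * norm_L1 (L (L f))"
proof -
  have "(\<lambda>n. t * defect f (t / real (Suc n)) + t\<^sup>2 * norm_L1 (L (L f))) \<longlonglongrightarrow> t * 0 + t\<^sup>2 * norm_L1 (L (L f))"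
    by (intro tendsto_intros defect_tendsto f t)
  moreover have "norm_L1 (\<lambda>v. U t f v - f v - t * L f v) \<le> t * defect f (t / real (Suc n)) + t\<^sup>2 * norm_L1 (L (L f))" for n
    using U_euler_steps[OF f, of "t / real (Suc n)" "Suc n"] t by simp
  ultimately show ?thesis
    by (intro LIMSEQ_le_const[of _ _ "norm_L1 (\<lambda>v. U t f v - f v - t * L f v)"]) auto
qed

text \<open>The difference quotient has integral 0 by conservation of mass, so the integral of
  \<open>L f\<close> is bounded by every defect.\<close>

lemma integral_generator:
  assumes f: "f \<in> L1"
  shows "(\<integral>v. L f v \<partial>lborel) = 0"
proof -
  have "\<bar>\<integral>v. L f v \<partial>lborel\<bar> \<le> defect f (1 / real (Suc n))" for n
  proof -
    define h where "h = 1 / real (Suc n)"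
    have h: "h > 0" by (simp add: h_def)
    have Uf: "U h f \<in> L1" "L f \<in> L1" using f h by (auto intro: U_L1 L_L1)
    have "(\<integral>v. (U h f v - f v) / h - L f v \<partial>lborel) = - (\<integral>v. L f v \<partial>lborel)"
      using Uf f U_mass[of h f] h by (simp add: L1_def)
    then have "\<bar>\<integral>v. L f v \<partial>lborel\<bar> = \<bar>\<integral>v. (U h f v - f v) / h - L f v \<partial>lborel\<bar>" by simp
    also have "\<dots> \<le> defect f h"
      unfolding defect_def norm_L1_def by (rule integral_abs_bound)
    finally show ?thesis by (simp add: h_def)
  qed
  then have "\<bar>\<integral>v. L f v \<partial>lborel\<bar> \<le> 0"
    by (intro LIMSEQ_le_const[OF defect_tendsto[OF f, of 1]]) auto
  then show ?thesis by simp
qed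

lemma U_fixed:
  assumes f: "f \<in> L1" and L0: "\<And>v. L f v = 0" and t: "t \<ge> 0"
  shows "AE v in lborel. U t f v = f v"
proof -
  have "norm_L1 (L f) = 0" by (simp add: norm_L1_def L0)
  then have "norm_L1 (\<lambda>v. U t f v - f v) = 0"
    using U_lipschitz[OF f t] norm_L1_nonneg[of "\<lambda>v. U t f v - f v"] by simp
  moreover have "(\<lambda>v. U t f v - f v) \<in> L1" by (intro L1_closure U_L1 t f)
  ultimately have "AE v in lborel. \<bar>U t f v - f v\<bar> = 0"
    unfolding norm_L1_def by (subst (asm) integral_nonneg_eq_0_iff_AE) (auto simp: L1_def)
  then show ?thesis by eventually_elim simp
qed

end

text \<open>Convergence of the Euler scheme: the local error is \<open>h\<^sup>2 * K\<close>,
  contraction of \<open>U\<close> propagates it without growth, and over \<open>n\<close> steps with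
  \<open>real n * h = t\<close> it adds up to \<open>t\<^sup>2 * K / n\<close>. A bound for the
  iterates that depends on \<open>real n * h\<close> alone thus passes to the limit.\<close>

lemma (in soft_kernel) semigroup_decay:
  assumes U: "stochastic_semigroup U (boltzmann_op \<gamma> b)"
    and S: "\<And>v. sig v \<le> ennreal S" "S > 0" and g: "g \<in> L1" and t: "t > 0"
    and decay: "\<And>h n. 0 \<le> h \<Longrightarrow> h * S \<le> 1 \<Longrightarrow> norm_L1 ((euler h ^^ n) g) \<le> F (real n * h)"
  shows "norm_L1 (U t g) \<le> F t"
proof -
  interpret stochastic_semigroup U "boltzmann_op \<gamma> b" by (rule U)
  have S0: "S \<ge> 0" using S by simp
  \<comment> \<open>Two applications of the operator bound \<open>2 * S\<close>. The iterates never
    exceed \<open>norm_L1 g\<close>, so one \<open>K\<close> serves for all steps.\<close>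
  define K where "K = (2 * S)\<^sup>2 * norm_L1 g"
  have steps: "(euler h ^^ n) g \<in> L1 \<and> norm_L1 ((euler h ^^ n) g) \<le> norm_L1 g \<and>
      norm_L1 (\<lambda>v. U (real n * h) g v - (euler h ^^ n) g v) \<le> real n * (h\<^sup>2 * K)"
    if h: "h > 0" "h * S \<le> 1" for h n
  proof (induction n)
    case 0
    show ?case using g by (simp add: norm_L1_U_0)
  next
    case (Suc n)
    define G where "G = (euler h ^^ n) g"
    have h0: "h \<ge> 0" "real n * h \<ge> 0" using h by auto
    have G: "G \<in> L1" "norm_L1 G \<le> norm_L1 g" and IH: "norm_L1 (\<lambda>v. U (real n * h) g v - G v) \<le> real n * (h\<^sup>2 * K)"
      using Suc by (auto simp: G_def)
    note eG = euler_contraction[OF S(1) S0 h0(1) h(2) G(1)]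
    have Un: "U (real n * h) g \<in> L1" "U h G \<in> L1" "U (real (Suc n) * h) g \<in> L1"
      using g G h0 h by (auto intro!: U_L1)
    have d: "(\<lambda>v. U (real n * h) g v - G v) \<in> L1" by (intro L1_closure Un G)
    have e1: "AE v in lborel. U (h + real n * h) g v = U h (U (real n * h) g) v"
      by (rule U_semigroup[OF h0 g])
    have e2: "AE v in lborel. U h (\<lambda>v. U (real n * h) g v - G v) v = U h (U (real n * h) g) v - U h G v"
      by (rule U_diff[OF h0(1) Un(1) G(1)])
    have "AE v in lborel. U (real (Suc n) * h) g v - euler h G v =
        U h (\<lambda>v. U (real n * h) g v - G v) v + (U h G v - euler h G v)"
      using e1 e2 by eventually_elim (simp add: algebra_simps)
    then have "norm_L1 (\<lambda>v. U (real (Suc n) * h) g v - euler h G v) \<le>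
        norm_L1 (U h (\<lambda>v. U (real n * h) g v - G v)) + norm_L1 (\<lambda>v. U h G v - euler h G v)"
      by (intro norm_L1_add_le L1_closure Un eG U_L1 h0 d)
    also have "\<dots> \<le> real n * (h\<^sup>2 * K) + h\<^sup>2 * K"
    proof (rule add_mono)
      show "norm_L1 (U h (\<lambda>v. U (real n * h) g v - G v)) \<le> real n * (h\<^sup>2 * K)"
        using U_contraction[OF h0(1) d] IH by simp
      have "norm_L1 (\<lambda>v. U h G v - euler h G v) = norm_L1 (\<lambda>v. U h G v - G v - h * boltzmann_op \<gamma> b G v)"
        by (simp add: euler_def diff_diff_eq)
      also have "\<dots> \<le> h\<^sup>2 * norm_L1 (boltzmann_op \<gamma> b (boltzmann_op \<gamma> b G))"
        by (rule U_euler[OF G(1) h(1)])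
      also have "\<dots> \<le> h\<^sup>2 * K"
      proof (rule mult_left_mono)
        have "norm_L1 (boltzmann_op \<gamma> b (boltzmann_op \<gamma> b G)) \<le> 2 * S * norm_L1 (boltzmann_op \<gamma> b G)"
          by (rule boltzmann_op_L1(2)[OF S(1) S0 boltzmann_op_L1(1)[OF S(1) S0 G(1)]])
        also have "\<dots> \<le> 2 * S * (2 * S * norm_L1 g)"
        proof (rule mult_left_mono)
          show "norm_L1 (boltzmann_op \<gamma> b G) \<le> 2 * S * norm_L1 g"
            using boltzmann_op_L1(2)[OF S(1) S0 G(1)] mult_left_mono[OF G(2), of "2 * S"] S0 by simp
        qed (use S0 in simp)
        finally show "norm_L1 (boltzmann_op \<gamma> b (boltzmann_op \<gamma> b G)) \<le> K"
          by (simp add: K_def power2_eq_square mult_ac)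
      qed simp
      finally show "norm_L1 (\<lambda>v. U h G v - euler h G v) \<le> h\<^sup>2 * K" .
    qed
    finally have "norm_L1 (\<lambda>v. U (real (Suc n) * h) g v - euler h G v) \<le> real (Suc n) * (h\<^sup>2 * K)"
      by (simp add: algebra_simps)
    then show ?case using eG G by (simp add: G_def)
  qed
  have "(\<lambda>n. F t + t\<^sup>2 * K / real (Suc n)) \<longlonglongrightarrow> F t + 0"
    using LIMSEQ_inverse_real_of_nat
    by (intro tendsto_intros) (auto simp: divide_inverse intro!: tendsto_mult_right_zero)
  moreover have "\<forall>\<^sub>F n in sequentially. norm_L1 (U t g) \<le> F t + t\<^sup>2 * K / real (Suc n)"
  proof -
    have "\<forall>\<^sub>F n in sequentially. t * S \<le> real (Suc n)"
      using eventually_ge_at_top[of "nat \<lceil>t * S\<rceil>"] by eventually_elim linarith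
    then show ?thesis
    proof eventually_elim
      case (elim n)
      define h where "h = t / real (Suc n)"
      have h: "h > 0" "h * S \<le> 1" "real (Suc n) * h = t"
        using t elim by (simp_all add: h_def field_simps)
      define G where "G = (euler h ^^ Suc n) g"
      have st: "G \<in> L1" "norm_L1 (\<lambda>v. U t g v - G v) \<le> real (Suc n) * (h\<^sup>2 * K)"
        using steps[OF h(1,2), of "Suc n"] h(3) by (simp_all add: G_def)
      have "norm_L1 (U t g) \<le> norm_L1 (\<lambda>v. U t g v - G v) + norm_L1 G"
        using st g t by (intro norm_L1_add_le L1_closure U_L1) auto
      also have "\<dots> \<le> real (Suc n) * (h\<^sup>2 * K) + F t"
        using st decay[of h "Suc n"] h by (intro add_mono) (auto simp: G_def)
      also have "real (Suc n) * (h\<^sup>2 * K) = t\<^sup>2 * K / real (Suc n)"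
        by (simp add: h_def power2_eq_square)
      finally show ?case by simp
    qed
  qed
  ultimately show ?thesis
    by (intro LIMSEQ_le_const[of _ "F t + 0", simplified]) (auto simp: eventually_sequentially)
qed

subsection \<open>Decay of the relative entropy\<close>

text \<open>
  The part of the convex function \<open>x ln x - x + 1\<close> lying above its tangent at \<open>B\<close>, cut off below
  \<open>B\<close>.
\<close>

definition entropy_tail :: "real \<Rightarrow> real \<Rightarrow> real" where
  "entropy_tail B x = (if x \<le> B then 0 else x * ln (x / B) - x + B)"

lemma borel_measurable_entropy_tail [measurable]: "entropy_tail B \<in> borel_measurable borel"
  unfolding entropy_tail_def[abs_def] by measurable

text \<open>The left-hand side is the tangent at \<open>a\<close>, of slope
  \<open>ln (a / B)\<close>. For \<open>a \<ge> B\<close> the slope is nonnegative and the tangent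
  is at most 0 on \<open>[0, B]\<close>, so cutting off there keeps it a minorant.\<close>

lemma entropy_tail_ge_tangent:
  assumes B: "B > 0" and a: "a \<ge> B" and x: "x \<ge> 0"
  shows "x * ln (a / B) - a + B \<le> entropy_tail B x"
proof (cases "x \<le> B")
  case True
  have "x * ln (a / B) \<le> B * ln (a / B)"
    using True B a by (intro mult_right_mono) (auto intro: ln_ge_zero)
  also have "\<dots> \<le> B * (a / B - 1)"
    using B a ln_le_minus_one[of "a / B"] by (intro mult_left_mono) auto
  also have "\<dots> = a - B" using B by (simp add: field_simps)
  finally show ?thesis using True by (simp add: entropy_tail_def)
next
  case False
  then have xp: "x > 0" using B by simp
  have "x * ln (a / x) \<le> x * (a / x - 1)"
    using xp B a ln_le_minus_one[of "a / x"] by (intro mult_left_mono) auto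
  also have "\<dots> = a - x" using xp by (simp add: field_simps)
  finally have "x * (ln a - ln x) \<le> a - x" using xp B a by (simp add: ln_div)
  then show ?thesis
    using False xp B a by (simp add: entropy_tail_def ln_div algebra_simps)
qed

lemma entropy_tail_nonneg:
  assumes "B > 0" "x \<ge> 0" shows "0 \<le> entropy_tail B x"
  using entropy_tail_ge_tangent[of B B x] assms by simp

text \<open>Countably many tangents already determine the function. This matters because each
  tangent inequality for \<open>U t f\<close> holds only outside a null set of its own.\<close>

lemma entropy_tail_le_of_rational_tangents:
  assumes B: "B > 0" and y: "y \<ge> 0" and x: "x \<ge> 0"
    and le: "\<And>q::rat. of_rat q \<ge> B \<Longrightarrow> x * ln (of_rat q / B) - of_rat q + B \<le> y"
  shows "entropy_tail B x \<le> y"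
proof (rule ccontr)
  assume "\<not> entropy_tail B x \<le> y"
  then have gt: "entropy_tail B x > y" by simp
  then have xB: "x > B" using y by (auto simp: entropy_tail_def split: if_splits)
  define F where "F a = x * ln (a / B) - a + B" for a
  have Fx: "F x > y" using gt xB by (simp add: F_def entropy_tail_def)
  have "isCont F x"
    unfolding F_def using xB B by (intro continuous_intros) auto
  then have "\<forall>\<^sub>F a in at x. F a > y"
    using Fx by (intro order_tendstoD(1)) (auto simp: isCont_def)
  then obtain d where d: "d > 0" "\<And>a. a \<noteq> x \<Longrightarrow> dist a x < d \<Longrightarrow> F a > y"
    by (auto simp: eventually_at)
  obtain q where q: "q \<in> \<rat>" "x < q" "q < x + d"
    using Rats_dense_in_real[of x "x + d"] d by auto
  then obtain r where r: "q = of_rat r" by (auto elim: Rats_cases)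
  have "F q > y" using d(2)[of q] q by (simp add: dist_real_def)
  then show False using le[of r] q xB r by (simp add: F_def)
qed

text \<open>Against the Maxwellian, \<open>x - 1\<close> integrates to 0 when \<open>x\<close> is
  the density of a unit mass, so these are in effect bounds for \<open>x ln x - x + 1\<close>.
  Between 1 and \<open>B\<close> its slope is at most \<open>ln B\<close>; above \<open>B\<close>
  the excess over the tangent is \<open>entropy_tail B\<close>; below 1 it is at most
  \<open>1 - x\<close>, which is where \<open>ln B \<ge> 1\<close> enters.\<close>

lemma entropy_density_bounds:
  assumes x: "x \<ge> 0" and B: "ln B \<ge> 1" "B > 0"
  shows "x - 1 \<le> x * ln x" "x * ln x \<le> ln B * \<bar>x - 1\<bar> + entropy_tail B x + (x - 1)"
proof -
  have BI: "B \<ge> 1 + ln B" using ln_le_minus_one[of B] B by simp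
  show low: "x - 1 \<le> x * ln x"
  proof (cases "x = 0")
    case False
    then have xp: "x > 0" using x by simp
    have "x * ln (1 / x) \<le> x * (1 / x - 1)"
      using xp ln_le_minus_one[of "1 / x"] by (intro mult_left_mono) auto
    also have "\<dots> = 1 - x" using xp by (simp add: field_simps)
    finally show ?thesis using xp by (simp add: ln_div)
  qed simp
  consider "x = 0" | "0 < x" "x \<le> 1" | "1 < x" "x \<le> B" | "x > B" "1 < x"
    using x B BI by linarith
  then show "x * ln x \<le> ln B * \<bar>x - 1\<bar> + entropy_tail B x + (x - 1)"
  proof cases
    case 1
    then show ?thesis using B BI by (simp add: entropy_tail_def)
  next
    case 2
    have "x * ln x \<le> 0" using 2 by (simp add: mult_nonneg_nonpos)
    moreover have "1 - x \<le> ln B * (1 - x)" using 2 B mult_right_mono[of 1 "ln B" "1 - x"] by simp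
    ultimately show ?thesis using 2 B BI by (simp add: entropy_tail_def)
  next
    case 3
    have "(x - 1) * ln x \<le> (x - 1) * ln B" using 3 B by (intro mult_left_mono) auto
    moreover have "ln x \<le> x - 1" using 3 ln_le_minus_one[of x] by simp
    ultimately have "x * ln x \<le> ln B * (x - 1) + (x - 1)" by (simp add: algebra_simps)
    then show ?thesis using 3 by (simp add: entropy_tail_def)
  next
    case 4
    then have "x * ln x = entropy_tail B x + x * ln B + x - B"
      using B by (simp add: entropy_tail_def ln_div algebra_simps)
    then show ?thesis using 4 BI by (simp add: algebra_simps)
  qed
qed

text \<open>Where the tail is nonzero, its logarithm is
  \<open>l + norm v ^ 2 / 2 - R ^ 2 > 0\<close>, with \<open>l\<close> equal to \<open>ln y\<close>
  up to a constant. If the quadratic term is the larger one, then \<open>norm v > R\<close> and the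
  weight \<open>bracket v powr s\<close> pays; otherwise \<open>2 * l > R ^ 2\<close>, and a power
  of \<open>y\<close> beats the power of \<open>l\<close>.\<close>

lemma maxwellian_entropy_tail_le:
  assumes p: "p > 1" and s: "s > 2"
  obtains K where "K \<ge> 0"
    "\<And>R (v::'a::euclidean_space) y. R \<ge> 1 \<Longrightarrow> y \<ge> 0 \<Longrightarrow>
      maxwellian v * entropy_tail (exp (R\<^sup>2)) (y / maxwellian v) \<le>
      R powr (- (s - 2)) * (bracket v powr s * y + K * y powr p)"
proof -
  \<comment> \<open>\<open>c\<close> is minus the logarithm of the normalising factor of the
    Maxwellian. \<open>D\<close> is chosen so that \<open>(2 * l) powr (s / 2)\<close> is at most
    \<open>K1 * exp ((p - 1) * l)\<close>, a constant times \<open>y powr (p - 1)\<close>.\<close>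
  define c where "c = real DIM('a) / 2 * ln (2 * pi)"
  define D where "D = s / (p - 1)"
  define K1 where "K1 = exp (s / 2 * ln D)"
  define K where "K = K1 * exp ((p - 1) * c)"
  have D: "D > 0" using p s by (simp add: D_def)
  have K: "K \<ge> 0" by (simp add: K_def K1_def)
  have main: "maxwellian v * entropy_tail (exp (R\<^sup>2)) (y / maxwellian v) \<le>
      R powr (- (s - 2)) * (bracket v powr s * y + K * y powr p)"
    if R: "R \<ge> 1" and y: "y \<ge> 0" for R and v :: 'a and y
  proof (cases "y / maxwellian v \<le> exp (R\<^sup>2)")
    case True
    then show ?thesis using y K by (simp add: entropy_tail_def)
  next
    case False
    define M where "M = maxwellian v"
    have M: "M > 0" by (simp add: M_def maxwellian_pos)
    have yM: "y > exp (R\<^sup>2) * M" using False M by (simp add: M_def field_simps)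
    have "exp (R\<^sup>2) * M > 0" using M by simp
    then have yp: "y > 0" using yM by linarith
    define l where "l = ln y + c"
    have lnM: "ln M = - c - (norm v)\<^sup>2 / 2"
      by (simp add: M_def maxwellian_def ln_mult ln_powr c_def)
    have lnq: "ln (y / M / exp (R\<^sup>2)) = l + (norm v)\<^sup>2 / 2 - R\<^sup>2"
      using yp M by (simp add: ln_div ln_mult lnM l_def)
    have "y / M / exp (R\<^sup>2) > 1" using yM M by (simp add: field_simps)
    then have pos: "l + (norm v)\<^sup>2 / 2 - R\<^sup>2 > 0" unfolding lnq[symmetric] by (rule ln_gt_zero)
    have "M * entropy_tail (exp (R\<^sup>2)) (y / M) = y * (l + (norm v)\<^sup>2 / 2 - R\<^sup>2) - y + M * exp (R\<^sup>2)"
      using False M unfolding entropy_tail_def lnq[symmetric] by (simp add: M_def[symmetric] algebra_simps)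
    also have "\<dots> \<le> y * (l + (norm v)\<^sup>2 / 2 - R\<^sup>2)"
      using yM by (simp add: mult.commute)
    finally have le: "M * entropy_tail (exp (R\<^sup>2)) (y / M) \<le> y * (l + (norm v)\<^sup>2 / 2 - R\<^sup>2)" .
    have "y * (l + (norm v)\<^sup>2 / 2 - R\<^sup>2) \<le> R powr (- (s - 2)) * (bracket v powr s * y + K * y powr p)"
    proof (cases "l \<le> (norm v)\<^sup>2 / 2")
      case True
      then have "R\<^sup>2 < (norm v)\<^sup>2" using pos by linarith
      then have "R < norm v" by (rule power2_less_imp_less) simp
      then have Rb: "R \<le> bracket v" using norm_le_bracket[of v] by linarith
      have b0: "bracket v > 0" using bracket_ge_1[of v] by linarith
      have "l + (norm v)\<^sup>2 / 2 - R\<^sup>2 \<le> (norm v)\<^sup>2"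
        using True zero_le_power2[of R] by linarith
      also have "\<dots> \<le> (bracket v)\<^sup>2"
        using norm_le_bracket[of v] by (intro power_mono) auto
      also have "\<dots> = bracket v powr (- (s - 2)) * bracket v powr s"
        using b0 by (simp add: powr_add[symmetric])
      also have "\<dots> \<le> R powr (- (s - 2)) * bracket v powr s"
        using Rb R s by (intro mult_right_mono powr_mono2') auto
      finally have "y * (l + (norm v)\<^sup>2 / 2 - R\<^sup>2) \<le> y * (R powr (- (s - 2)) * bracket v powr s)"
        using y by (intro mult_left_mono)
      also have "\<dots> \<le> R powr (- (s - 2)) * (bracket v powr s * y + K * y powr p)"
        using K by (simp add: algebra_simps)
      finally show ?thesis .
    next
      case False
      then have Rl: "R\<^sup>2 < 2 * l" using pos by linarith
      then have l: "2 * l > 0" using zero_le_power2[of R] by linarith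
      have "ln (2 * l / D) \<le> 2 * l / D - 1" using l D by (intro ln_le_minus_one) simp
      then have "ln (2 * l) \<le> 2 * l / D + ln D" using l D by (simp add: ln_div)
      then have "s / 2 * ln (2 * l) \<le> s / 2 * (2 * l / D + ln D)"
        using s by (intro mult_left_mono) auto
      also have "\<dots> = (p - 1) * l + s / 2 * ln D"
        using p s by (simp add: D_def field_simps)
      finally have "exp (s / 2 * ln (2 * l)) \<le> exp ((p - 1) * l + s / 2 * ln D)" by simp
      then have "(2 * l) powr (s / 2) \<le> K1 * exp ((p - 1) * l)"
        using l by (simp add: powr_def K1_def exp_add mult.commute)
      also have "\<dots> = K * y powr (p - 1)"
        using yp by (simp add: K_def l_def powr_def exp_add distrib_left mult_ac)
      finally have b1: "(2 * l) powr (s / 2) \<le> K * y powr (p - 1)" .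
      have "R powr (s - 2) = (R\<^sup>2) powr ((s - 2) / 2)"
      proof -
        have R2: "R\<^sup>2 = R powr 2" using R by simp
        have "2 * ((s - 2) / 2) = s - 2" by (simp add: field_simps)
        then show ?thesis unfolding R2 powr_powr by (simp only:)
      qed
      also have "\<dots> \<le> (2 * l) powr ((s - 2) / 2)"
        using Rl s by (intro powr_mono2) auto
      finally have "2 * l * R powr (s - 2) \<le> 2 * l * (2 * l) powr ((s - 2) / 2)"
        using l by (intro mult_left_mono) auto
      also have "\<dots> = (2 * l) powr (1 + (s - 2) / 2)"
        using l by (simp only: powr_add) simp
      also have "1 + (s - 2) / 2 = s / 2" by (simp add: field_simps)
      also note b1
      finally have b2: "R powr (- (s - 2)) * (2 * l * R powr (s - 2)) \<le> R powr (- (s - 2)) * (K * y powr (p - 1))"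
        by (intro mult_left_mono) auto
      have b3: "R powr (- (s - 2)) * (2 * l * R powr (s - 2)) = 2 * l"
      proof -
        have "R powr (- (s - 2)) * R powr (s - 2) = 1" using R by (simp add: powr_add[symmetric])
        then show ?thesis by (metis mult.left_commute mult.right_neutral)
      qed
      have "2 * l \<le> R powr (- (s - 2)) * (K * y powr (p - 1))" by (rule b2[unfolded b3])
      moreover have "l + (norm v)\<^sup>2 / 2 - R\<^sup>2 \<le> 2 * l"
        using False zero_le_power2[of R] by linarith
      ultimately have "y * (l + (norm v)\<^sup>2 / 2 - R\<^sup>2) \<le> y * (R powr (- (s - 2)) * (K * y powr (p - 1)))"
        using y by (intro mult_left_mono) auto
      also have "\<dots> = R powr (- (s - 2)) * (K * y powr p)"
        using yp by (simp add: powr_diff)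
      also have "\<dots> \<le> R powr (- (s - 2)) * (bracket v powr s * y + K * y powr p)"
        using y by (intro mult_left_mono) auto
      finally show ?thesis .
    qed
    with le show ?thesis by (simp add: M_def)
  qed
  show ?thesis using main K by (intro that[of K]) auto
qed

lemma maxwellian_L1w:
  assumes "s > 0"
  shows "(maxwellian :: 'a::euclidean_space \<Rightarrow> real) \<in> L1w s"
proof -
  let ?I = "\<integral>\<^sup>+v. ennreal ((1 + 2 * norm v) powr s * maxwellian (v::'a)) \<partial>lborel"
  have "(\<integral>\<^sup>+v. ennreal (bracket v powr s) * ennreal \<bar>maxwellian (v::'a)\<bar> \<partial>lborel) \<le> ?I"
  proof (rule nn_integral_mono)
    fix v :: 'a
    have "bracket v powr s \<le> (1 + 2 * norm v) powr s"
      using assms bracket_le[of v] bracket_ge_1[of v] norm_ge_zero[of v] by (intro powr_mono2) linarith+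
    then have "bracket v powr s * maxwellian v \<le> (1 + 2 * norm v) powr s * maxwellian v"
      using maxwellian_pos[of v] by (intro mult_right_mono) auto
    then show "ennreal (bracket v powr s) * ennreal \<bar>maxwellian v\<bar> \<le> ennreal ((1 + 2 * norm v) powr s * maxwellian v)"
      using maxwellian_pos[of v] by (simp add: ennreal_mult'[symmetric] ennreal_leI)
  qed
  moreover have "?I < \<infinity>" by (rule nn_integral_maxwellian_poly_finite[OF assms])
  then obtain c where "?I = ennreal c" "c \<ge> 0"
    using less_top_ennreal[of ?I] by auto
  ultimately show ?thesis by (intro L1wI(1)[of _ _ c]) auto
qed

lemma integral_maxwellian:
  "maxwellian \<in> (L1 :: ('a::euclidean_space \<Rightarrow> real) set)" "(\<integral>v. maxwellian (v::'a) \<partial>lborel) = 1"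
proof -
  show "maxwellian \<in> (L1 :: ('a \<Rightarrow> real) set)"
    using L1w_nonneg_imp_L1(1)[OF maxwellian_L1w[of 1]] by simp
  have "(\<integral>v. maxwellian (v::'a) \<partial>lborel) = enn2real (\<integral>\<^sup>+v. ennreal (maxwellian (v::'a)) \<partial>lborel)"
    by (intro integral_eq_nn_integral) (auto simp: less_imp_le[OF maxwellian_pos])
  then show "(\<integral>v. maxwellian (v::'a) \<partial>lborel) = 1" by (simp add: nn_integral_maxwellian)
qed

context stochastic_semigroup
begin

text \<open>Jensen's inequality without a transition kernel: each tangent makes a combination of
  \<open>F\<close>, \<open>f\<close> and the Maxwellian nonnegative, positivity preserves this, and
  the Maxwellian is fixed. The supremum over rational tangents is taken afterwards. \<open>F\<close>
  uses \<open>\<bar>f v\<bar>\<close> because \<open>f\<close> is nonnegative only almost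
  everywhere.\<close>

lemma entropy_tail_contraction:
  assumes t: "t \<ge> 0" and fixM: "AE v in lborel. U t maxwellian v = maxwellian v"
    and f: "f \<in> L1" "AE v in lborel. 0 \<le> f v" and B: "B > 0"
    and F: "F \<in> L1" "\<And>v. F v = maxwellian v * entropy_tail B (\<bar>f v\<bar> / maxwellian v)"
  shows "AE v in lborel. maxwellian v * entropy_tail B (U t f v / maxwellian v) \<le> U t F v"
proof -
  note maxwellian1 = integral_maxwellian(1)[where 'a='a]
  have Fnn: "0 \<le> F v" for v
    unfolding F(2) using maxwellian_pos[of v] B
    by (intro mult_nonneg_nonneg entropy_tail_nonneg) (auto intro: divide_nonneg_pos)
  have UF0: "AE v in lborel. 0 \<le> U t F v"
    by (rule U_nonneg[OF t F(1)]) (simp add: Fnn)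
  have Uf0: "AE v in lborel. 0 \<le> U t f v"
    by (rule U_nonneg[OF t f])
  have tangent: "AE v in lborel. of_rat q \<ge> B \<longrightarrow>
      ln (of_rat q / B) * U t f v - (of_rat q - B) * maxwellian v \<le> U t F v" for q :: rat
  proof (cases "of_rat q \<ge> B")
    case True
    define a where "a = (of_rat q :: real)"
    have a: "a \<ge> B" using True by (simp add: a_def)
    define c where "c = ln (a / B)"
    define D where "D v = F v + (- c) * f v + (a - B) * maxwellian v" for v
    have D1: "(\<lambda>v. F v + (- c) * f v) \<in> L1" by (intro L1_closure F f)
    have D: "D \<in> L1" unfolding D_def[abs_def] by (intro L1_closure F f maxwellian1)
    have "AE v in lborel. 0 \<le> D v"
      using f(2)
    proof eventually_elim
      case (elim v)
      define m where "m = maxwellian v"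
      have m: "m > 0" by (simp add: m_def maxwellian_pos)
      have "m * (f v / m * c - a + B) \<le> m * entropy_tail B (f v / m)"
        unfolding c_def using m elim B a by (intro mult_left_mono entropy_tail_ge_tangent) auto
      moreover have "m * (f v / m * c - a + B) = c * f v - (a - B) * m"
        using m by (simp add: field_simps)
      ultimately show ?case using elim by (simp add: D_def F(2) m_def)
    qed
    then have "AE v in lborel. 0 \<le> U t D v" by (rule U_nonneg[OF t D])
    moreover have "AE v in lborel. U t D v = U t (\<lambda>v. F v + (- c) * f v) v + (a - B) * U t maxwellian v"
      unfolding D_def[abs_def] by (rule U_lincomb[OF t D1 maxwellian1])
    moreover have "AE v in lborel. U t (\<lambda>v. F v + (- c) * f v) v = U t F v + (- c) * U t f v"
      by (rule U_lincomb[OF t F(1) f(1)])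
    ultimately show ?thesis
      using fixM by eventually_elim (simp add: a_def c_def algebra_simps)
  qed simp
  have "AE v in lborel. \<forall>q::rat. of_rat q \<ge> B \<longrightarrow>
      ln (of_rat q / B) * U t f v - (of_rat q - B) * maxwellian v \<le> U t F v"
    using tangent by (simp add: AE_all_countable)
  then show ?thesis
    using UF0 Uf0
  proof eventually_elim
    case (elim v)
    define m where "m = maxwellian v"
    have m: "m > 0" by (simp add: m_def maxwellian_pos)
    have "entropy_tail B (U t f v / m) \<le> U t F v / m"
    proof (rule entropy_tail_le_of_rational_tangents[OF B])
      show "0 \<le> U t F v / m" "0 \<le> U t f v / m" using elim m by auto
      fix q :: rat assume "B \<le> of_rat q"
      then have "ln (of_rat q / B) * U t f v - (of_rat q - B) * m \<le> U t F v"
        using elim(1) by (simp add: m_def)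
      then have "(ln (of_rat q / B) * U t f v - (of_rat q - B) * m) / m \<le> U t F v / m"
        using m by (intro divide_right_mono) auto
      moreover have "(w * u - (r - B) * m) / m = u / m * w - r + B" for w u r :: real
        using m by (simp add: field_simps)
      ultimately show "U t f v / m * ln (of_rat q / B) - of_rat q + B \<le> U t F v / m"
        by simp
    qed
    then show ?case using m by (simp add: m_def[symmetric] field_simps)
  qed
qed

end

section \<open>From the given angular kernel to a uniform decay estimate\<close>

lemma soft_kernel_of_angular_kernel:
  fixes b :: "real \<Rightarrow> real"
  assumes b: "angular_kernel TYPE('a::euclidean_space) b" and \<gamma>: "- real DIM('a) < \<gamma>" "\<gamma> < 0"
  shows "soft_kernel TYPE('a) \<gamma> (\<lambda>x. indicator {-1..1} x * b x)"
proof
  let ?b = "\<lambda>x. indicator {-1..1} x * b x"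
  show "- real DIM('a) < \<gamma>" "\<gamma> < 0" by fact+
  have "b \<in> borel_measurable (restrict_space borel {-1..1})"
    using b by (simp add: angular_kernel_def)
  then show bm [measurable]: "?b \<in> borel_measurable borel"
    by (subst (asm) borel_measurable_restrict_space_iff) auto
  show "0 \<le> ?b x" for x using b by (auto simp: angular_kernel_def indicator_def)
  show "?b (- x) = ?b x" for x using b by (auto simp: angular_kernel_def indicator_def)
  fix e :: 'a assume e: "norm e = 1"
  have eq: "b (e \<bullet> \<omega>) = ?b (e \<bullet> \<omega>)" if "\<omega> \<in> space sphere_measure" for \<omega>
  proof -
    have "\<bar>e \<bullet> \<omega>\<bar> \<le> 1"
      using Cauchy_Schwarz_ineq2[of e \<omega>] e that by (simp add: space_sphere_measure)
    then have "e \<bullet> \<omega> \<in> {-1..1}" by auto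
    then show ?thesis by simp
  qed
  have "(\<integral>\<omega>. b (e \<bullet> \<omega>) \<partial>sphere_measure) = 1"
    using b e by (simp add: angular_kernel_def)
  moreover have "(\<integral>\<omega>. b (e \<bullet> \<omega>) \<partial>sphere_measure) = (\<integral>\<omega>. ?b (e \<bullet> \<omega>) \<partial>sphere_measure)"
    by (rule Bochner_Integration.integral_cong[OF refl eq])
  ultimately have one: "(\<integral>\<omega>. ?b (e \<bullet> \<omega>) \<partial>sphere_measure) = 1" by simp
  \<comment> \<open>The Bochner integral of a non-integrable function is 0, so the value 1 forces
    integrability.\<close>
  have "integrable sphere_measure (\<lambda>\<omega>. ?b (e \<bullet> \<omega>))"
    using one not_integrable_integral_eq[of sphere_measure "\<lambda>\<omega>. ?b (e \<bullet> \<omega>)"] by fastforce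
  then have "(\<integral>\<^sup>+\<omega>. ennreal (?b (e \<bullet> \<omega>)) \<partial>sphere_measure) = ennreal (\<integral>\<omega>. ?b (e \<bullet> \<omega>) \<partial>sphere_measure)"
    using b by (intro nn_integral_eq_integral) (auto simp: angular_kernel_def indicator_def)
  then have "(\<integral>\<^sup>+\<omega>. ennreal (?b (e \<bullet> \<omega>)) \<partial>sphere_measure) = 1" by (simp only: one ennreal_1)
  then show "(\<integral>\<^sup>+\<omega>. ennreal (?b (e \<bullet> \<omega>)) \<partial>usphere) = 1"
    by (subst nn_integral_usphere_eq) measurable
qed

lemma L1w_diff:
  assumes "f \<in> L1w s" "g \<in> L1w s"
  shows "(\<lambda>v. f v - g v) \<in> L1w s" "norm_L1w s (\<lambda>v. f v - g v) \<le> norm_L1w s f + norm_L1w s g"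
proof -
  note [measurable] = L1wD(1)[OF assms(1)] L1wD(1)[OF assms(2)]
  have i: "integrable lborel (\<lambda>v. bracket v powr s * \<bar>f v\<bar> + bracket v powr s * \<bar>g v\<bar>)"
    using L1wD(2)[OF assms(1)] L1wD(2)[OF assms(2)] by simp
  have le: "bracket v powr s * \<bar>f v - g v\<bar> \<le> bracket v powr s * \<bar>f v\<bar> + bracket v powr s * \<bar>g v\<bar>" for v
    using mult_left_mono[of "\<bar>f v - g v\<bar>" "\<bar>f v\<bar> + \<bar>g v\<bar>" "bracket v powr s"] by (simp add: distrib_left)
  have d: "integrable lborel (\<lambda>v. bracket v powr s * \<bar>f v - g v\<bar>)"
    by (rule Bochner_Integration.integrable_bound[OF i]) (auto intro!: AE_I2 le order_trans[OF le])
  then show "(\<lambda>v. f v - g v) \<in> L1w s" by (simp add: L1w_def)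
  have "norm_L1w s (\<lambda>v. f v - g v) \<le> (\<integral>v. bracket v powr s * \<bar>f v\<bar> + bracket v powr s * \<bar>g v\<bar> \<partial>lborel)"
    unfolding norm_L1w_def by (rule integral_mono[OF d i le])
  also have "\<dots> = norm_L1w s f + norm_L1w s g"
    unfolding norm_L1w_def using L1wD(2)[OF assms(1)] L1wD(2)[OF assms(2)] by simp
  finally show "norm_L1w s (\<lambda>v. f v - g v) \<le> norm_L1w s f + norm_L1w s g" .
qed

text \<open>\<open>C\<close> is chosen before \<open>U\<close> and \<open>g\<close>. The existence
  of some semigroup enters through \<open>integral_generator\<close>: it shows that the operator
  produces functions of integral 0, a property that no longer mentions \<open>U\<close>.\<close>

lemma (in soft_kernel) semigroup_L1_decay:
  assumes U: "\<exists>U. stochastic_semigroup U (boltzmann_op \<gamma> b :: ('a \<Rightarrow> real) \<Rightarrow> 'a \<Rightarrow> real)"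
    and k: "- \<gamma> < k" "k < s" and X0: "X0 \<ge> 0"
  obtains C where "C > 0"
    "\<And>U g t. stochastic_semigroup U (boltzmann_op \<gamma> b :: ('a \<Rightarrow> real) \<Rightarrow> 'a \<Rightarrow> real) \<Longrightarrow> g \<in> L1w s \<Longrightarrow> (\<integral>v. g v \<partial>lborel) = 0 \<Longrightarrow>
      norm_L1w s g \<le> X0 \<Longrightarrow> 0 \<le> t \<Longrightarrow> norm_L1 (U t g) \<le> C * (1 + t) powr (- ((s - k) / \<bar>\<gamma>\<bar>))"
proof -
  obtain S where S: "S > 0" "\<And>v. sig v \<le> ennreal S" using sig_bounded by blast
  then have S0: "S \<ge> 0" by simp
  have mass: "(\<integral>v. boltzmann_op \<gamma> b f v \<partial>lborel) = 0" if "f \<in> L1" for f :: "'a \<Rightarrow> real"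
  proof -
    obtain U where "stochastic_semigroup U (boltzmann_op \<gamma> b :: ('a \<Rightarrow> real) \<Rightarrow> 'a \<Rightarrow> real)"
      using U by blast
    then interpret stochastic_semigroup U "boltzmann_op \<gamma> b" .
    show ?thesis by (rule integral_generator[OF that])
  qed
  obtain C where C: "C > 0"
    "\<And>g h n. g \<in> L1w s \<Longrightarrow> (\<integral>v. g v \<partial>lborel) = 0 \<Longrightarrow> norm_L1w s g \<le> X0 \<Longrightarrow> 0 \<le> h \<Longrightarrow> h * S \<le> 1 \<Longrightarrow>
      norm_L1 ((euler h ^^ n) g) \<le> C * (1 + real n * h) powr (- ((s - k) / \<bar>\<gamma>\<bar>))"
    using euler_decay[OF S(2) S0 k mass X0] by blast
  have "norm_L1 (U t g) \<le> C * (1 + t) powr (- ((s - k) / \<bar>\<gamma>\<bar>))"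
    if U: "stochastic_semigroup U (boltzmann_op \<gamma> b)" and g: "g \<in> L1w s" "(\<integral>v. g v \<partial>lborel) = 0"
      "norm_L1w s g \<le> X0" and t: "0 \<le> t" for U t and g :: "'a \<Rightarrow> real"
  proof -
    have gL: "g \<in> L1" using L1w_nonneg_imp_L1(1)[OF g(1)] k gamma by simp
    show ?thesis
    \<comment> \<open>\<open>semigroup_decay\<close> needs a positive time; at 0 the bound comes
      from the empty iteration.\<close>
    proof (cases "t = 0")
      case True
      interpret stochastic_semigroup U "boltzmann_op \<gamma> b" by (rule U)
      have "norm_L1 (U t g) \<le> norm_L1 g" by (rule U_contraction[OF t gL])
      also have "\<dots> \<le> C * 1" using C(2)[OF g, of 0 0] by simp
      finally show ?thesis using True by simp
    next
      case False
      then have "t > 0" using t by simp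
      from semigroup_decay[OF U S(2) S(1) gL this, of "\<lambda>r. C * (1 + r) powr (- ((s - k) / \<bar>\<gamma>\<bar>))"]
      show ?thesis using C(2)[OF g] by blast
    qed
  qed
  then show ?thesis by (rule that[OF C(1)])
qed

theorem theorem1p4:
  fixes p \<gamma> :: real
  assumes "DIM('a::euclidean_space) \<ge> 2"
    and "p > 1"
    and "- real DIM('a) < \<gamma>" and "\<gamma> < 0"
  shows "\<exists>s\<^sub>0 > 2 + \<bar>\<gamma>\<bar>.
    \<forall>(b :: real \<Rightarrow> real) (s :: real) (\<sigma> :: real).
      angular_kernel TYPE('a) b \<longrightarrow> bounded (b ` {-1..1}) \<longrightarrow>
      s \<ge> s\<^sub>0 \<longrightarrow> \<sigma> < -1 + (s - 2) / \<bar>\<gamma>\<bar> \<longrightarrow>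
      (\<forall>m q h :: real. \<exists>C\<^sub>0 > 0.
         \<forall>(U :: real \<Rightarrow> ('a \<Rightarrow> real) \<Rightarrow> 'a \<Rightarrow> real) (f\<^sub>0 :: 'a \<Rightarrow> real).
           boltzmann_semigroup \<gamma> b U \<longrightarrow>
           f\<^sub>0 \<in> L1w s \<inter> Lp p \<longrightarrow>
           (AE v in lborel. 0 \<le> f\<^sub>0 v) \<longrightarrow>
           (\<integral>v. f\<^sub>0 v \<partial>lborel) = 1 \<longrightarrow>
           norm_L1w s f\<^sub>0 = m \<longrightarrow> norm_Lp p f\<^sub>0 = q \<longrightarrow> relative_entropy f\<^sub>0 = h \<longrightarrow>
           (\<forall>t\<ge>0. integrable lborel (entropy_integrand (U t f\<^sub>0)) \<and>
                  relative_entropy (U t f\<^sub>0) \<le> C\<^sub>0 * (1 + t) powr (- \<sigma>)))"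
proof (rule exI[of _ "3 + \<bar>\<gamma>\<bar>"], intro conjI allI impI)
  show "2 + \<bar>\<gamma>\<bar> < 3 + \<bar>\<gamma>\<bar>" by simp
  fix b :: "real \<Rightarrow> real" and s \<sigma> m q h :: real
  assume b: "angular_kernel TYPE('a) b" and s: "s \<ge> 3 + \<bar>\<gamma>\<bar>" and \<sigma>: "\<sigma> < -1 + (s - 2) / \<bar>\<gamma>\<bar>"
  define b' where "b' x = indicator {-1..1} x * b x" for x
  have sk: "soft_kernel TYPE('a) \<gamma> b'"
    unfolding b'_def[abs_def] by (rule soft_kernel_of_angular_kernel[OF b assms(3,4)])
  have op: "boltzmann_op \<gamma> b = (boltzmann_op \<gamma> b' :: ('a \<Rightarrow> real) \<Rightarrow> 'a \<Rightarrow> real)"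
    by (intro ext fun_cong[OF boltzmann_op_cong_kernel]) (simp add: b'_def)
  interpret soft_kernel \<gamma> b' "TYPE('a)" by (rule sk)
  define g where "g = \<bar>\<gamma>\<bar>"
  \<comment> \<open>The threshold \<open>3 + \<bar>\<gamma>\<bar>\<close> guarantees
    \<open>s - 2 > \<bar>\<gamma>\<bar>\<close>, which makes the limiting rate \<open>\<rho>\<close>
    positive and \<open>k < s\<close>.\<close>
  have g: "g > 0" "s - 2 > g" "s > 2" "s > 0" and absg: "\<bar>\<gamma>\<bar> = g" and negg: "- \<gamma> = g"
    using assms s by (auto simp: g_def)
  \<comment> \<open>\<open>\<rho>\<close> is the limiting exponent and \<open>\<kappa>\<close> the
    growth exponent of \<open>R\<close>, set so that \<open>R powr (2 - s)\<close> equals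
    \<open>(1 + t) powr (- \<rho>)\<close>. The term \<open>R\<^sup>2 * norm_L1 \<Delta>\<close>
    decays equally fast when the rate in \<open>L1\<close> is \<open>2 * \<kappa> + \<rho>\<close>;
    solving \<open>(s - k) / g = 2 * \<kappa> + \<rho>\<close> gives \<open>k\<close>.\<close>
  define \<rho> where "\<rho> = (s - 2) / g - 1"
  define \<kappa> where "\<kappa> = \<rho> / (s - 2)"
  define k where "k = g * s / (s - 2)"
  have \<rho>: "\<rho> > 0" "\<sigma> < \<rho>" using g \<sigma> unfolding absg by (auto simp: \<rho>_def pos_less_divide_eq)
  have \<kappa>: "\<kappa> > 0" using \<rho> g by (simp add: \<kappa>_def)
  have k: "- \<gamma> < k" "k < s"
  proof -
    have "g * (s - 2) < g * s" using g by simp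
    then show "- \<gamma> < k" unfolding negg using g by (simp add: k_def pos_less_divide_eq)
    have "g * s < (s - 2) * s" using g by (intro mult_strict_right_mono) auto
    then show "k < s" using g by (simp add: k_def pos_divide_less_eq mult.commute[of s])
  qed
  have exps: "(s - k) / \<bar>\<gamma>\<bar> = 2 * \<kappa> + \<rho>" "\<kappa> * (s - 2) = \<rho>"
  proof -
    show "\<kappa> * (s - 2) = \<rho>" using g by (simp add: \<kappa>_def)
    have "(s - k) / g = s / g - s / (s - 2)" using g by (simp add: k_def diff_divide_distrib)
    moreover have "2 * \<kappa> + \<rho> = \<rho> * (s / (s - 2))" using g by (simp add: \<kappa>_def field_simps)
    moreover have "\<rho> * (s / (s - 2)) = s / g - s / (s - 2)" using g by (simp add: \<rho>_def field_simps)
    ultimately show "(s - k) / \<bar>\<gamma>\<bar> = 2 * \<kappa> + \<rho>" by (simp add: absg)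
  qed
  note Mw = maxwellian_L1w[of s, where 'a='a]
  note M1 = integral_maxwellian[where 'a='a]
  show "\<exists>C\<^sub>0 > 0.
         \<forall>(U :: real \<Rightarrow> ('a \<Rightarrow> real) \<Rightarrow> 'a \<Rightarrow> real) (f\<^sub>0 :: 'a \<Rightarrow> real).
           boltzmann_semigroup \<gamma> b U \<longrightarrow>
           f\<^sub>0 \<in> L1w s \<inter> Lp p \<longrightarrow>
           (AE v in lborel. 0 \<le> f\<^sub>0 v) \<longrightarrow>
           (\<integral>v. f\<^sub>0 v \<partial>lborel) = 1 \<longrightarrow>
           norm_L1w s f\<^sub>0 = m \<longrightarrow> norm_Lp p f\<^sub>0 = q \<longrightarrow> relative_entropy f\<^sub>0 = h \<longrightarrow>
           (\<forall>t\<ge>0. integrable lborel (entropy_integrand (U t f\<^sub>0)) \<and>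
                  relative_entropy (U t f\<^sub>0) \<le> C\<^sub>0 * (1 + t) powr (- \<sigma>))"
  \<comment> \<open>Without any semigroup the claim is vacuous and an arbitrary constant does.
    Otherwise one is at hand for \<open>semigroup_L1_decay\<close> before the quantified
    \<open>U\<close> is introduced.\<close>
  proof (cases "\<exists>U. stochastic_semigroup U (boltzmann_op \<gamma> b' :: ('a \<Rightarrow> real) \<Rightarrow> 'a \<Rightarrow> real)")
    case False
    then show ?thesis
      by (intro exI[of _ 1]) (auto simp: boltzmann_semigroup_def op stochastic_semigroup_def)
  next
    case True
    \<comment> \<open>\<open>m\<close> is an arbitrary real at this point, hence the absolute value.
      \<open>X0\<close> will bound the weighted norm of the initial datum minus the
      Maxwellian.\<close>
    define X0 where "X0 = \<bar>m\<bar> + norm_L1w s (maxwellian :: 'a \<Rightarrow> real)"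
    have X0: "X0 \<ge> 0" by (simp add: X0_def norm_L1w_nonneg)
    obtain C where C: "C > 0"
      "\<And>U g t. stochastic_semigroup U (boltzmann_op \<gamma> b' :: ('a \<Rightarrow> real) \<Rightarrow> 'a \<Rightarrow> real) \<Longrightarrow> g \<in> L1w s \<Longrightarrow>
        (\<integral>v. g v \<partial>lborel) = 0 \<Longrightarrow> norm_L1w s g \<le> X0 \<Longrightarrow> 0 \<le> t \<Longrightarrow>
        norm_L1 (U t g) \<le> C * (1 + t) powr (- ((s - k) / \<bar>\<gamma>\<bar>))"
      using semigroup_L1_decay[OF True k X0] by blast
    obtain K where K: "K \<ge> 0"
      "\<And>R (v::'a) y. R \<ge> 1 \<Longrightarrow> y \<ge> 0 \<Longrightarrow>
        maxwellian v * entropy_tail (exp (R\<^sup>2)) (y / maxwellian v) \<le>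
        R powr (- (s - 2)) * (bracket v powr s * y + K * y powr p)"
      using maxwellian_entropy_tail_le[OF assms(2) g(3), where 'a='a] by blast
    define C0 where "C0 = C + \<bar>m\<bar> + K * q powr p"
    have C0: "C0 > 0" using C K by (simp add: C0_def add_pos_nonneg)
    have main: "integrable lborel (entropy_integrand (U t f)) \<and>
        relative_entropy (U t f) \<le> C0 * (1 + t) powr (- \<sigma>)"
      if bU: "boltzmann_semigroup \<gamma> b U" and f: "f \<in> L1w s" "f \<in> Lp p" "AE v in lborel. 0 \<le> f v"
        "(\<integral>v. f v \<partial>lborel) = 1" "norm_L1w s f = m" "norm_Lp p f = q" and t: "t \<ge> 0"
      for U and f :: "'a \<Rightarrow> real" and t
    proof -
      have ssU: "stochastic_semigroup U (boltzmann_op \<gamma> b')"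
        using bU by (simp add: boltzmann_semigroup_def op stochastic_semigroup_def)
      interpret ss: stochastic_semigroup U "boltzmann_op \<gamma> b'" by (rule ssU)
      have fL: "f \<in> L1" using L1w_nonneg_imp_L1(1)[OF f(1)] g by simp
      have fb [measurable]: "f \<in> borel_measurable borel" by (rule L1_borel[OF fL])
      have UM: "AE v in lborel. U t maxwellian v = maxwellian v"
        by (rule ss.U_fixed[OF M1(1) boltzmann_op_maxwellian t])
      define f1 where "f1 = U t f"
      have f1: "f1 \<in> L1" unfolding f1_def by (rule ss.U_L1[OF t fL])
      note [measurable] = L1_borel[OF f1]
      have f1_int: "(\<integral>v. f1 v \<partial>lborel) = 1"
        unfolding f1_def using ss.U_mass[OF t fL] f(4) by simp
      have f1_nn: "AE v in lborel. 0 \<le> f1 v"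
        unfolding f1_def by (rule ss.U_nonneg[OF t fL f(3)])
      define \<Delta> where "\<Delta> v = f1 v - maxwellian v" for v
      have \<Delta>: "\<Delta> \<in> L1" unfolding \<Delta>_def[abs_def] by (intro L1_closure f1 M1(1))
      have dist: "norm_L1 \<Delta> \<le> C * (1 + t) powr (- (2 * \<kappa> + \<rho>))"
      proof -
        have gw: "(\<lambda>v. f v - maxwellian v) \<in> L1w s" "norm_L1w s (\<lambda>v. f v - maxwellian v) \<le> X0"
          using L1w_diff[OF f(1) Mw] g f(5) by (auto simp: X0_def)
        have g0: "(\<integral>v. f v - maxwellian v \<partial>lborel) = 0"
          using fL M1 f(4) by (simp add: L1_def)
        have "AE v in lborel. \<Delta> v = U t (\<lambda>v. f v - maxwellian v) v"
          using ss.U_diff[OF t fL M1(1)] UM by eventually_elim (simp add: \<Delta>_def f1_def)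
        then have "norm_L1 \<Delta> = norm_L1 (U t (\<lambda>v. f v - maxwellian v))"
          by (intro norm_L1_cong_AE \<Delta> ss.U_L1 t L1_closure fL M1(1))
        then show ?thesis using C(2)[OF ssU gw(1) g0 gw(2) t] exps by simp
      qed
      define R where "R = (1 + t) powr \<kappa>"
      have R: "R \<ge> 1" using t \<kappa> by (simp add: R_def ge_one_powr_ge_zero)
      have R2: "R\<^sup>2 = (1 + t) powr (2 * \<kappa>)"
      proof -
        have "R\<^sup>2 = R powr 2" using R by simp
        then show ?thesis by (simp add: R_def powr_powr mult.commute)
      qed
      have Rs: "R powr (- (s - 2)) = (1 + t) powr (- \<rho>)"
      proof -
        have "\<kappa> * (- (s - 2)) = - \<rho>" using exps(2) by (metis mult_minus_right)
        then show ?thesis unfolding R_def powr_powr by (simp only:)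
      qed
      define B where "B = exp (R\<^sup>2)"
      have B: "B > 0" "ln B = R\<^sup>2" "ln B \<ge> 1" using R by (simp_all add: B_def)
      define F where "F v = maxwellian v * entropy_tail B (\<bar>f v\<bar> / maxwellian v)" for v
      have Fnn: "0 \<le> F v" for v
        unfolding F_def using maxwellian_pos[of v] B
        by (intro mult_nonneg_nonneg entropy_tail_nonneg) (auto intro: divide_nonneg_pos)
      have Fle: "F v \<le> R powr (- (s - 2)) * (bracket v powr s * \<bar>f v\<bar> + K * \<bar>f v\<bar> powr p)" for v
        unfolding F_def B_def by (rule K(2)[OF R]) simp
      have lp: "integrable lborel (\<lambda>v. \<bar>f v\<bar> powr p)" using f(2) by (simp add: Lp_def)
      have lpn: "(\<integral>v. \<bar>f v\<bar> powr p \<partial>lborel) = q powr p"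
      proof -
        have "0 \<le> (\<integral>v. \<bar>f v\<bar> powr p \<partial>lborel)" by simp
        then show ?thesis using assms(2) f(6)[symmetric] by (simp add: norm_Lp_def powr_powr)
      qed
      have bi: "integrable lborel (\<lambda>v. R powr (- (s - 2)) * (bracket v powr s * \<bar>f v\<bar> + K * \<bar>f v\<bar> powr p))"
        using lp L1wD(2)[OF f(1)] by simp
      have Fm: "F \<in> borel_measurable borel" unfolding F_def[abs_def] by measurable
      have Fi: "integrable lborel F"
        by (rule Bochner_Integration.integrable_bound[OF bi])
           (use Fm Fle Fnn in \<open>auto intro!: AE_I2 intro: order_trans[OF _ abs_ge_self]\<close>)
      then have FL: "F \<in> L1" by (simp add: L1_def)
      have "(\<integral>v. F v \<partial>lborel) \<le> (\<integral>v. R powr (- (s - 2)) * (bracket v powr s * \<bar>f v\<bar> + K * \<bar>f v\<bar> powr p) \<partial>lborel)"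
        by (rule integral_mono[OF Fi bi Fle])
      also have "\<dots> = R powr (- (s - 2)) * (m + K * q powr p)"
        using lp L1wD(2)[OF f(1)] f(5) lpn by (simp add: norm_L1w_def)
      also have "\<dots> \<le> (1 + t) powr (- \<rho>) * (\<bar>m\<bar> + K * q powr p)"
        unfolding Rs by (intro mult_left_mono) auto
      finally have Fint: "(\<integral>v. F v \<partial>lborel) \<le> (1 + t) powr (- \<rho>) * (\<bar>m\<bar> + K * q powr p)" .
      have UF: "U t F \<in> L1" "(\<integral>v. U t F v \<partial>lborel) = (\<integral>v. F v \<partial>lborel)"
        by (rule ss.U_L1[OF t FL], rule ss.U_mass[OF t FL])
      have tail: "AE v in lborel. maxwellian v * entropy_tail B (f1 v / maxwellian v) \<le> U t F v"
        unfolding f1_def by (rule ss.entropy_tail_contraction[OF t UM fL f(3) B(1) FL F_def])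
      \<comment> \<open>The lower bound controls the negative part, as needed for integrability of
        the entropy. The last summand \<open>\<Delta> v\<close> integrates to 0 because both
        functions have unit mass.\<close>
      have bounds: "AE v in lborel. \<Delta> v \<le> entropy_integrand f1 v \<and>
          entropy_integrand f1 v \<le> R\<^sup>2 * \<bar>\<Delta> v\<bar> + U t F v + \<Delta> v"
        using tail f1_nn
      proof eventually_elim
        case (elim v)
        define M where "M = maxwellian v"
        have M: "M > 0" by (simp add: M_def maxwellian_pos)
        define x where "x = f1 v / M"
        have x: "x \<ge> 0" "f1 v = M * x" using elim M by (simp_all add: x_def)
        have e: "entropy_integrand f1 v = M * (x * ln x)"
          by (simp add: entropy_integrand_def M_def[symmetric] x_def[symmetric] x(2))
        have d: "\<Delta> v = M * (x - 1)" by (simp add: \<Delta>_def M_def[symmetric] x(2) algebra_simps)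
        have da: "\<bar>\<Delta> v\<bar> = M * \<bar>x - 1\<bar>" unfolding d using M by (simp add: abs_mult)
        note bd = entropy_density_bounds[OF x(1) B(3) B(1)]
        have "\<Delta> v \<le> entropy_integrand f1 v"
          unfolding e d using bd(1) M by (intro mult_left_mono) auto
        moreover have "M * (x * ln x) \<le> M * (R\<^sup>2 * \<bar>x - 1\<bar> + entropy_tail B x + (x - 1))"
          using bd(2) M unfolding B(2) by (intro mult_left_mono) auto
        then have "entropy_integrand f1 v \<le> R\<^sup>2 * \<bar>\<Delta> v\<bar> + M * entropy_tail B x + \<Delta> v"
          unfolding e da unfolding d by (simp add: algebra_simps)
        moreover have "M * entropy_tail B x \<le> U t F v"
          using elim(1) by (simp add: M_def x_def)
        ultimately show ?case by linarith
      qed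
      have \<Delta>i: "integrable lborel \<Delta>" "integrable lborel (U t F)" using \<Delta> UF by (simp_all add: L1_def)
      have em: "entropy_integrand f1 \<in> borel_measurable borel"
        unfolding entropy_integrand_def[abs_def] by measurable
      have Gi: "integrable lborel (\<lambda>v. R\<^sup>2 * \<bar>\<Delta> v\<bar> + \<bar>U t F v\<bar> + \<bar>\<Delta> v\<bar>)"
        using \<Delta>i by simp
      have ei: "integrable lborel (entropy_integrand f1)"
      proof (rule Bochner_Integration.integrable_bound[OF Gi])
        show "AE v in lborel. norm (entropy_integrand f1 v) \<le> norm (R\<^sup>2 * \<bar>\<Delta> v\<bar> + \<bar>U t F v\<bar> + \<bar>\<Delta> v\<bar>)"
          using bounds
        proof eventually_elim
          case (elim v)
          have "0 \<le> R\<^sup>2 * \<bar>\<Delta> v\<bar>" by simp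
          then show ?case using elim unfolding real_norm_def by linarith
        qed
      qed (use em in simp)
      have Ri: "integrable lborel (\<lambda>v. R\<^sup>2 * \<bar>\<Delta> v\<bar> + U t F v + \<Delta> v)"
        using \<Delta>i by simp
      have "relative_entropy f1 \<le> (\<integral>v. R\<^sup>2 * \<bar>\<Delta> v\<bar> + U t F v + \<Delta> v \<partial>lborel)"
        unfolding relative_entropy_def using bounds by (intro integral_mono_AE ei Ri) (auto elim!: eventually_mono)
      also have "\<dots> = R\<^sup>2 * norm_L1 \<Delta> + (\<integral>v. F v \<partial>lborel) + (\<integral>v. \<Delta> v \<partial>lborel)"
        using \<Delta>i UF(2) by (simp add: norm_L1_def)
      also have "(\<integral>v. \<Delta> v \<partial>lborel) = 0"
        unfolding \<Delta>_def using f1 M1 f1_int by (simp add: L1_def)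
      also have "R\<^sup>2 * norm_L1 \<Delta> + (\<integral>v. F v \<partial>lborel) + 0 \<le>
          (1 + t) powr (2 * \<kappa>) * (C * (1 + t) powr (- (2 * \<kappa> + \<rho>))) + (1 + t) powr (- \<rho>) * (\<bar>m\<bar> + K * q powr p)"
        unfolding R2 using mult_left_mono[OF dist, of "(1 + t) powr (2 * \<kappa>)"] Fint by simp
      also have "(1 + t) powr (2 * \<kappa>) * (C * (1 + t) powr (- (2 * \<kappa> + \<rho>))) = C * (1 + t) powr (- \<rho>)"
      proof -
        have "(1 + t) powr (2 * \<kappa>) * (1 + t) powr (- (2 * \<kappa> + \<rho>)) = (1 + t) powr (- \<rho>)"
          by (simp add: powr_add[symmetric])
        then show ?thesis by (metis mult.left_commute)
      qed
      also have "C * (1 + t) powr (- \<rho>) + (1 + t) powr (- \<rho>) * (\<bar>m\<bar> + K * q powr p) = C0 * (1 + t) powr (- \<rho>)"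
        by (simp add: C0_def algebra_simps)
      also have "\<dots> \<le> C0 * (1 + t) powr (- \<sigma>)"
        using C0 \<rho> t by (intro mult_left_mono powr_mono) auto
      finally show ?thesis using ei by (simp add: f1_def)
    qed
    show ?thesis using C0 main by (intro exI[of _ C0]) auto
  qed
qed

end
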